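(* Let $X$ be an elliptic curve, $\alpha\in H^0(X,\Omega^1_X)$ a nowhere-vanishing holomorphic one-form, and $E=\mathcal O_X^{\oplus2}$ with its fixed trivial Dolbeault operator $\bar\partial$. Let $U\subset\mathbb C$ be a disk about $0$, and set $$\theta_z=\begin{pmatrix} 0 & z \\ {z^2} & 0 \end{pmatrix}\alpha,\qquad z\in U.$$ This is a real-analytic family of polystable Higgs bundles. On no neighbourhood of $0$ does it admit a continuous family of harmonic metrics. It also admits no continuous relative harmonic filtration on such a neighbourhood. Consequently $(E,\bar\partial+\theta)\notin\mathscr M^{\mathcal H}_{\mathrm{Dol},d}(X)$ locally at $0$ for every $d\in\{0,1,2,\ldots,\infty\}$.
   Context: A Hermitian metric $h$ on a Higgs bundle $(E,\bar\partial_E+\theta)$ is harmonic if $\nabla_h=\bar\partial_E+\theta+\partial_{E,h}+\theta^{\dagger_h}$ is flat, where $\partial_{E,h}$ is the $(1,0)$-part of the Chern connection and $\theta^{\dagger_h}$ the $h$-adjoint. Mixed regularity $C^d_UC^\infty_X$: locally on $U$ the bundle family over $U\times X$ is identified with the pullback of a fixed bundle on $X$ so that all transition, operator, metric and subbundle coefficients are smooth in $x\in X$ and $C^d$ in $u$ with values in $C^\infty(X)$ (continuous when $d=0$); Higgs operators act in the $X$-direction only and are integrable on each slice. A $C^d$ relative harmonic filtration of a $C^d_UC^\infty_X$ Higgs family $(E,\mathcal D'')$ is a finite filtration $0=F_0\subset F_1\subset\cdots\subset F_\ell=E$ by $\mathcal D''$-invariant $C^d_UC^\infty_X$ subbundles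 such that every quotient $F_i/F_{i-1}$ admits a (slicewise) harmonic metric of class $C^d_UC^\infty_X$. A continuous relative harmonic filtration is the case $d=0$. $\mathscr M^{\mathcal H}_{\mathrm{Dol},d}(X)$ is the stackification, on the site of $C^d$ manifolds with open covers, of the prestack generated from $C^d_UC^\infty_X$ Higgs families admitting $C^d_UC^\infty_X$ harmonic metrics by finite iterated extensions (short exact sequences of $C^d_UC^\infty_X$ Higgs families). "Locally at $0$" means: the restriction of the family to any neighbourhood of $0$ is not an object. *)

theory Defs
  imports
    "HOL-Analysis.Analysis"
    "HOL-Library.Extended_Nat"
    "Jordan_Normal_Form.Schur_Decomposition"
begin

hide_const (open) Finite_Cartesian_Product.mat Finite_Cartesian_Product.vec

text \<open>
  The elliptic curve is \<open>X = \<complex>/L\<close> for a lattice \<open>L\<close>. Open subsets of \<open>X\<close> are represented by their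
  \<open>L\<close>-invariant open preimages in \<open>\<complex>\<close>, and functions on them by \<open>L\<close>-periodic functions; \<open>x\<close> is the
  coordinate of \<open>\<complex>\<close>, so \<open>dx\<close> and its conjugate \<open>dxbar\<close> are global frames of the (1,0)- and
  (0,1)-forms on \<open>X\<close>. The parameter space of a family is an open subset of \<open>\<complex>\<close>, with coordinate \<open>u\<close>.
\<close>

definition lattice_basis :: "complex set \<Rightarrow> complex \<Rightarrow> complex \<Rightarrow> bool" where
  "lattice_basis L w1 w2 \<longleftrightarrow>
     Im (w2 / w1) \<noteq> 0 \<and> L = {of_int m * w1 + of_int n * w2 | m n. True}"

definition is_lattice :: "complex set \<Rightarrow> bool" where
  "is_lattice L \<longleftrightarrow> (\<exists>w1 w2. lattice_basis L w1 w2)"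

definition invariant_open :: "complex set \<Rightarrow> complex set \<Rightarrow> bool" where
  "invariant_open L D \<longleftrightarrow> open D \<and> (\<forall>x\<in>D. \<forall>w\<in>L. x + w \<in> D)"

definition periodic_on :: "complex set \<Rightarrow> complex set \<Rightarrow> (complex \<Rightarrow> 'a) \<Rightarrow> bool" where
  "periodic_on L D f \<longleftrightarrow> (\<forall>x\<in>D. \<forall>w\<in>L. f (x + w) = f x)"

text \<open>Derivatives are real derivatives on \<open>\<complex> = \<real>\<^sup>2\<close>; the directions \<open>1\<close> and \<open>\<i>\<close> give the two partials.\<close>

definition dird :: "complex \<Rightarrow> (complex \<Rightarrow> complex) \<Rightarrow> complex \<Rightarrow> complex" where
  "dird v f x = frechet_derivative f (at x) v"

definition dx :: "(complex \<Rightarrow> complex) \<Rightarrow> complex \<Rightarrow> complex" where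
  "dx f x = (dird 1 f x - \<i> * dird \<i> f x) / 2"

definition dxbar :: "(complex \<Rightarrow> complex) \<Rightarrow> complex \<Rightarrow> complex" where
  "dxbar f x = (dird 1 f x + \<i> * dird \<i> f x) / 2"

primrec iter_dird :: "complex list \<Rightarrow> (complex \<Rightarrow> complex) \<Rightarrow> complex \<Rightarrow> complex" where
  "iter_dird [] f = f"
| "iter_dird (v # vs) f = iter_dird vs (dird v f)"

definition smooth_fun :: "complex set \<Rightarrow> (complex \<Rightarrow> complex) \<Rightarrow> bool" where
  "smooth_fun D f \<longleftrightarrow> (\<forall>vs. set vs \<subseteq> {1, \<i>} \<longrightarrow> iter_dird vs f differentiable_on D)"

text \<open>Convergence in the Frechet space \<open>C\<^sup>\<infinity>(D)\<close>: locally uniform convergence of all derivatives.\<close>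

definition smooth_tendsto ::
    "complex set \<Rightarrow> ('b \<Rightarrow> complex \<Rightarrow> complex) \<Rightarrow> (complex \<Rightarrow> complex) \<Rightarrow> 'b filter \<Rightarrow> bool" where
  "smooth_tendsto D f l F \<longleftrightarrow>
     (\<forall>vs K. set vs \<subseteq> {1, \<i>} \<longrightarrow> compact K \<longrightarrow> K \<subseteq> D \<longrightarrow>
        uniform_limit K (\<lambda>t. iter_dird vs (f t)) (iter_dird vs l) F)"

text \<open>A regularity class singles out functions \<open>f u x\<close> on \<open>B \<times> D\<close> (\<open>B\<close> in the parameter space, \<open>D\<close> over
  \<open>X\<close>), regarded as maps from \<open>B\<close> to \<open>C\<^sup>\<infinity>(D)\<close>.\<close>

type_synonym regularity = "complex set \<Rightarrow> complex set \<Rightarrow> (complex \<Rightarrow> complex \<Rightarrow> complex) \<Rightarrow> bool"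

definition cont_smooth :: regularity where
  "cont_smooth B D f \<longleftrightarrow>
     (\<forall>u\<in>B. smooth_fun D (f u)) \<and> (\<forall>u\<in>B. smooth_tendsto D f (f u) (at u within B))"

primrec Ck_smooth :: "nat \<Rightarrow> regularity" where
  "Ck_smooth 0 B D f \<longleftrightarrow> cont_smooth B D f"
| "Ck_smooth (Suc k) B D f \<longleftrightarrow> cont_smooth B D f \<and>
     (\<forall>v\<in>{1, \<i>}. \<exists>g.
        (\<forall>u\<in>B. smooth_tendsto D (\<lambda>t x. (f (u + of_real t * v) x - f u x) / of_real t) (g u)
                 (at (0::real))) \<and>
        Ck_smooth k B D g)"

text \<open>The class \<open>C\<^sup>d\<^sub>U C\<^sup>\<infinity>\<^sub>X\<close>, with \<open>d = \<infinity>\<close> allowed.\<close>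

definition Cd_smooth :: "enat \<Rightarrow> regularity" where
  "Cd_smooth d B D f \<longleftrightarrow> (\<forall>k. enat k \<le> d \<longrightarrow> Ck_smooth k B D f)"

text \<open>Real-analytic in \<open>u\<close> with values in \<open>C\<^sup>\<infinity>(D)\<close>: locally an unconditionally convergent power series
  in the two real coordinates of \<open>u\<close>.\<close>

definition analytic_smooth :: regularity where
  "analytic_smooth B D f \<longleftrightarrow>
     (\<forall>u\<in>B. smooth_fun D (f u)) \<and>
     (\<forall>u0\<in>B. \<exists>c \<rho>. \<rho> > 0 \<and> (\<forall>m n. smooth_fun D (c m n)) \<and>
        (\<forall>u \<in> B \<inter> ball u0 \<rho>.
           smooth_tendsto D
             (\<lambda>F x. \<Sum>(m, n)\<in>F. c m n x * of_real (Re (u - u0) ^ m * Im (u - u0) ^ n))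
             (f u) (finite_subsets_at_top (UNIV :: (nat \<times> nat) set))))"

definition smooth_mat ::
    "complex set \<Rightarrow> complex set \<Rightarrow> nat \<Rightarrow> nat \<Rightarrow> (complex \<Rightarrow> complex mat) \<Rightarrow> bool" where
  "smooth_mat L D m n M \<longleftrightarrow>
     (\<forall>x\<in>D. M x \<in> carrier_mat m n) \<and> periodic_on L D M \<and>
     (\<forall>i<m. \<forall>j<n. smooth_fun D (\<lambda>x. M x $$ (i, j)))"

definition regular_mat ::
    "regularity \<Rightarrow> complex set \<Rightarrow> complex set \<Rightarrow> nat \<Rightarrow> nat \<Rightarrow>
     (complex \<Rightarrow> complex \<Rightarrow> complex mat) \<Rightarrow> bool" where
  "regular_mat R B D m n M \<longleftrightarrow>
     (\<forall>u\<in>B. \<forall>x\<in>D. M u x \<in> carrier_mat m n) \<and>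
     (\<forall>i<m. \<forall>j<n. R B D (\<lambda>u x. M u x $$ (i, j)))"

definition mat_dx :: "(complex \<Rightarrow> complex mat) \<Rightarrow> complex \<Rightarrow> complex mat" where
  "mat_dx M x = mat (dim_row (M x)) (dim_col (M x)) (\<lambda>(i, j). dx (\<lambda>y. M y $$ (i, j)) x)"

definition mat_dxbar :: "(complex \<Rightarrow> complex mat) \<Rightarrow> complex \<Rightarrow> complex mat" where
  "mat_dxbar M x = mat (dim_row (M x)) (dim_col (M x)) (\<lambda>(i, j). dxbar (\<lambda>y. M y $$ (i, j)) x)"

text \<open>
  A bundle is given by a countable open cover of \<open>X\<close> (unused indices carry the empty set) and a
  cocycle: local sections transform by \<open>s\<^sub>c = g\<^sub>c\<^sub>c\<^sub>' s\<^sub>c\<^sub>'\<close>, where \<open>g\<^sub>c\<^sub>c\<^sub>' = htrans E c c'\<close>. In chart \<open>c\<close>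
  the Higgs operator is \<open>dbar + (hdbar E c) dxbar + (hphi E c) dx\<close>. Charts are indexed by pairs so that
  the slices of the families below are again of this type.
\<close>

type_synonym chart = "nat \<times> nat"

record higgs_bundle =
  hrank :: nat
  hdom :: "chart \<Rightarrow> complex set"
  htrans :: "chart \<Rightarrow> chart \<Rightarrow> complex \<Rightarrow> complex mat"
  hdbar :: "chart \<Rightarrow> complex \<Rightarrow> complex mat"
  hphi :: "chart \<Rightarrow> complex \<Rightarrow> complex mat"

definition is_vector_bundle :: "complex set \<Rightarrow> higgs_bundle \<Rightarrow> bool" where
  "is_vector_bundle L E \<longleftrightarrow>
     (\<forall>c. invariant_open L (hdom E c)) \<and> (\<Union>c. hdom E c) = UNIV \<and>
     (\<forall>c c'. smooth_mat L (hdom E c \<inter> hdom E c') (hrank E) (hrank E) (htrans E c c')) \<and>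
     (\<forall>c. \<forall>x\<in>hdom E c. htrans E c c x = 1\<^sub>m (hrank E)) \<and>
     (\<forall>c c' c''. \<forall>x \<in> hdom E c \<inter> hdom E c' \<inter> hdom E c''.
        htrans E c c' x * htrans E c' c'' x = htrans E c c'' x)"

text \<open>The third and fourth clauses say that the local operators glue. On a curve the square of
  \<open>dbar\<^sub>E + \<theta>\<close> is \<open>dbar\<^sub>E \<theta>\<close>, so integrability is the last clause.\<close>

definition is_higgs_bundle :: "complex set \<Rightarrow> higgs_bundle \<Rightarrow> bool" where
  "is_higgs_bundle L E \<longleftrightarrow> is_vector_bundle L E \<and>
     (\<forall>c. smooth_mat L (hdom E c) (hrank E) (hrank E) (hdbar E c) \<and>
          smooth_mat L (hdom E c) (hrank E) (hrank E) (hphi E c)) \<and>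
     (\<forall>c c'. \<forall>x \<in> hdom E c \<inter> hdom E c'.
        mat_dxbar (htrans E c c') x + hdbar E c x * htrans E c c' x
          = htrans E c c' x * hdbar E c' x) \<and>
     (\<forall>c c'. \<forall>x \<in> hdom E c \<inter> hdom E c'.
        hphi E c x * htrans E c c' x = htrans E c c' x * hphi E c' x) \<and>
     (\<forall>c. \<forall>x\<in>hdom E c.
        mat_dxbar (hphi E c) x + hdbar E c x * hphi E c x - hphi E c x * hdbar E c x
          = 0\<^sub>m (hrank E) (hrank E))"

text \<open>A morphism \<open>f : S \<rightarrow> E\<close> has a matrix \<open>f c b\<close> for every chart \<open>c\<close> of \<open>E\<close> and \<open>b\<close> of \<open>S\<close>.\<close>

definition higgs_hom ::
    "complex set \<Rightarrow> higgs_bundle \<Rightarrow> higgs_bundle \<Rightarrow> (chart \<Rightarrow> chart \<Rightarrow> complex \<Rightarrow> complex mat) \<Rightarrow> bool" where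
  "higgs_hom L S E f \<longleftrightarrow>
     (\<forall>c b. smooth_mat L (hdom E c \<inter> hdom S b) (hrank E) (hrank S) (f c b)) \<and>
     (\<forall>c c' b b'. \<forall>x \<in> hdom E c \<inter> hdom E c' \<inter> hdom S b \<inter> hdom S b'.
        htrans E c' c x * f c b x * htrans S b b' x = f c' b' x) \<and>
     (\<forall>c b. \<forall>x \<in> hdom E c \<inter> hdom S b.
        mat_dxbar (f c b) x + hdbar E c x * f c b x = f c b x * hdbar S b x) \<and>
     (\<forall>c b. \<forall>x \<in> hdom E c \<inter> hdom S b.
        hphi E c x * f c b x = f c b x * hphi S b x)"

definition fibre_image :: "complex mat \<Rightarrow> complex vec set" where
  "fibre_image A = (\<lambda>v. A *\<^sub>v v) ` carrier_vec (dim_col A)"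

definition fibre_kernel :: "complex mat \<Rightarrow> complex vec set" where
  "fibre_kernel A = {v \<in> carrier_vec (dim_col A). A *\<^sub>v v = 0\<^sub>v (dim_row A)}"

definition fibrewise_inj ::
    "higgs_bundle \<Rightarrow> higgs_bundle \<Rightarrow> (chart \<Rightarrow> chart \<Rightarrow> complex \<Rightarrow> complex mat) \<Rightarrow> bool" where
  "fibrewise_inj S E f \<longleftrightarrow>
     (\<forall>c b. \<forall>x \<in> hdom E c \<inter> hdom S b. fibre_kernel (f c b x) = {0\<^sub>v (hrank S)})"

definition fibrewise_surj ::
    "higgs_bundle \<Rightarrow> higgs_bundle \<Rightarrow> (chart \<Rightarrow> chart \<Rightarrow> complex \<Rightarrow> complex mat) \<Rightarrow> bool" where
  "fibrewise_surj S E f \<longleftrightarrow>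
     (\<forall>c b. \<forall>x \<in> hdom E c \<inter> hdom S b. fibre_image (f c b x) = carrier_vec (hrank E))"

text \<open>In chart \<open>c\<close> the metric is \<open>h(s,t) = t\<^sup>* H\<^sub>c s\<close> with \<open>H\<^sub>c = H c x\<close>.\<close>

definition hermitian_metric ::
    "complex set \<Rightarrow> higgs_bundle \<Rightarrow> (chart \<Rightarrow> complex \<Rightarrow> complex mat) \<Rightarrow> bool" where
  "hermitian_metric L E H \<longleftrightarrow>
     (\<forall>c. smooth_mat L (hdom E c) (hrank E) (hrank E) (H c)) \<and>
     (\<forall>c. \<forall>x\<in>hdom E c. mat_adjoint (H c x) = H c x) \<and>
     (\<forall>c. \<forall>x\<in>hdom E c. \<forall>v \<in> carrier_vec (hrank E). v \<noteq> 0\<^sub>v (hrank E) \<longrightarrow>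
        0 < Re ((H c x *\<^sub>v v) \<bullet>c v)) \<and>
     (\<forall>c c'. \<forall>x \<in> hdom E c \<inter> hdom E c'.
        mat_adjoint (htrans E c c' x) * H c x * htrans E c c' x = H c' x)"

text \<open>\<open>\<partial>\<^sub>E\<^sub>,\<^sub>h = \<partial> + (b c) dx\<close> is determined by \<open>\<partial> h(s,t) = h(\<partial>\<^sub>E\<^sub>,\<^sub>h s, t) + h(s, dbar\<^sub>E t)\<close>.\<close>

definition chern_10 ::
    "higgs_bundle \<Rightarrow> (chart \<Rightarrow> complex \<Rightarrow> complex mat) \<Rightarrow> (chart \<Rightarrow> complex \<Rightarrow> complex mat) \<Rightarrow> bool" where
  "chern_10 E H b \<longleftrightarrow> (\<forall>c. \<forall>x\<in>hdom E c.
     b c x \<in> carrier_mat (hrank E) (hrank E) \<and>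
     mat_dx (H c) x = H c x * b c x + mat_adjoint (hdbar E c x) * H c x)"

text \<open>The adjoint of \<open>\<theta> = \<phi> dx\<close> is \<open>\<psi> dxbar\<close> with \<open>h(\<phi> s, t) = h(s, \<psi> t)\<close>.\<close>

definition higgs_adjoint ::
    "higgs_bundle \<Rightarrow> (chart \<Rightarrow> complex \<Rightarrow> complex mat) \<Rightarrow> (chart \<Rightarrow> complex \<Rightarrow> complex mat) \<Rightarrow> bool" where
  "higgs_adjoint E H \<psi> \<longleftrightarrow> (\<forall>c. \<forall>x\<in>hdom E c.
     \<psi> c x \<in> carrier_mat (hrank E) (hrank E) \<and>
     H c x * hphi E c x = mat_adjoint (\<psi> c x) * H c x)"

text \<open>Coefficient at \<open>dx \<and> dxbar\<close> of the curvature of the connection \<open>d + P dx + Q dxbar\<close>.\<close>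

definition curvature ::
    "(complex \<Rightarrow> complex mat) \<Rightarrow> (complex \<Rightarrow> complex mat) \<Rightarrow> complex \<Rightarrow> complex mat" where
  "curvature P Q x = mat_dx Q x - mat_dxbar P x + P x * Q x - Q x * P x"

definition harmonic_metric ::
    "complex set \<Rightarrow> higgs_bundle \<Rightarrow> (chart \<Rightarrow> complex \<Rightarrow> complex mat) \<Rightarrow> bool" where
  "harmonic_metric L E H \<longleftrightarrow> hermitian_metric L E H \<and>
     (\<exists>b \<psi>. chern_10 E H b \<and> higgs_adjoint E H \<psi> \<and>
        (\<forall>c. \<forall>x\<in>hdom E c.
           curvature (\<lambda>y. b c y + hphi E c y) (\<lambda>y. hdbar E c y + \<psi> c y) x
             = 0\<^sub>m (hrank E) (hrank E)))"

text \<open>\<open>deg E = (\<i>/2\<pi>) \<integral>\<^sub>X tr F\<close> for the Chern curvature \<open>F\<close> of any Hermitian metric; since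
  \<open>dx \<and> dxbar = -2\<i> dA\<close>, this is \<open>1/\<pi>\<close> times the area integral of the \<open>dx \<and> dxbar\<close>-coefficient over a
  fundamental parallelogram. The value does not depend on the metric or on the basis.\<close>

definition has_degree :: "complex set \<Rightarrow> higgs_bundle \<Rightarrow> real \<Rightarrow> bool" where
  "has_degree L E d \<longleftrightarrow>
     (\<exists>H b K w1 w2. hermitian_metric L E H \<and> chern_10 E H b \<and>
        (\<forall>c. \<forall>x\<in>hdom E c. K x = (\<Sum>i<hrank E. curvature (b c) (hdbar E c) x $$ (i, i))) \<and>
        lattice_basis L w1 w2 \<and>
        (K has_integral of_real (pi * d))
          {of_real s * w1 + of_real t * w2 | s t. s \<in> {0..1} \<and> t \<in> {0..1}})"

definition has_slope :: "complex set \<Rightarrow> higgs_bundle \<Rightarrow> real \<Rightarrow> bool" where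
  "has_slope L E \<mu> \<longleftrightarrow> (\<exists>d. has_degree L E d \<and> \<mu> = d / real (hrank E))"

definition stable :: "complex set \<Rightarrow> higgs_bundle \<Rightarrow> bool" where
  "stable L E \<longleftrightarrow> is_higgs_bundle L E \<and> 0 < hrank E \<and>
     (\<forall>S f \<mu> \<nu>. is_higgs_bundle L S \<longrightarrow> higgs_hom L S E f \<longrightarrow> fibrewise_inj S E f \<longrightarrow>
        0 < hrank S \<longrightarrow> hrank S < hrank E \<longrightarrow> has_slope L S \<mu> \<longrightarrow> has_slope L E \<nu> \<longrightarrow> \<mu> < \<nu>)"

text \<open>\<open>E\<close> is the internal direct sum of the images of \<open>f1 : E1 \<rightarrow> E\<close> and \<open>f2 : E2 \<rightarrow> E\<close>.\<close>

definition higgs_direct_sum :: "complex set \<Rightarrow> higgs_bundle \<Rightarrow> higgs_bundle \<Rightarrow> higgs_bundle \<Rightarrow> bool" where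
  "higgs_direct_sum L E1 E2 E \<longleftrightarrow>
     (\<exists>f1 f2. higgs_hom L E1 E f1 \<and> higgs_hom L E2 E f2 \<and>
        (\<forall>c b1 b2. \<forall>x \<in> hdom E c \<inter> hdom E1 b1 \<inter> hdom E2 b2.
           bij_betw (\<lambda>(v1, v2). f1 c b1 x *\<^sub>v v1 + f2 c b2 x *\<^sub>v v2)
             (carrier_vec (hrank E1) \<times> carrier_vec (hrank E2)) (carrier_vec (hrank E))))"

inductive polystable_of_slope :: "complex set \<Rightarrow> real \<Rightarrow> higgs_bundle \<Rightarrow> bool"
  for L :: "complex set" and \<mu> :: real where
  stable: "stable L E \<Longrightarrow> has_slope L E \<mu> \<Longrightarrow> polystable_of_slope L \<mu> E"
| sum: "polystable_of_slope L \<mu> E1 \<Longrightarrow> polystable_of_slope L \<mu> E2 \<Longrightarrow> is_higgs_bundle L E \<Longrightarrow>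
        higgs_direct_sum L E1 E2 E \<Longrightarrow> polystable_of_slope L \<mu> E"

definition polystable :: "complex set \<Rightarrow> higgs_bundle \<Rightarrow> bool" where
  "polystable L E \<longleftrightarrow> (\<exists>\<mu>. polystable_of_slope L \<mu> E)"

text \<open>
  A family over an open \<open>V\<close> is given by an open cover \<open>fbase G i\<close> of \<open>V\<close> and, for each \<open>i\<close>, an open
  cover \<open>fxdom G (i, a)\<close> of \<open>X\<close>; the chart \<open>(i, a)\<close> lives on \<open>fbase G i \<times> fxdom G (i, a)\<close>. Over
  \<open>fbase G i\<close> the bundle is the pullback of a fixed bundle on \<open>X\<close>: the transition matrices between
  \<open>(i, a)\<close> and \<open>(i, a')\<close> do not depend on \<open>u\<close>.
\<close>

record higgs_family =
  frank :: nat
  fbase :: "nat \<Rightarrow> complex set"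
  fxdom :: "chart \<Rightarrow> complex set"
  ftrans :: "chart \<Rightarrow> chart \<Rightarrow> complex \<Rightarrow> complex \<Rightarrow> complex mat"
  fdbar :: "chart \<Rightarrow> complex \<Rightarrow> complex \<Rightarrow> complex mat"
  fphi :: "chart \<Rightarrow> complex \<Rightarrow> complex \<Rightarrow> complex mat"

definition slice :: "higgs_family \<Rightarrow> complex \<Rightarrow> higgs_bundle" where
  "slice G u = \<lparr>
     hrank = frank G,
     hdom = (\<lambda>c. if u \<in> fbase G (fst c) then fxdom G c else {}),
     htrans = (\<lambda>c c'. ftrans G c c' u),
     hdbar = (\<lambda>c. fdbar G c u),
     hphi = (\<lambda>c. fphi G c u)\<rparr>"

definition restrict_family :: "higgs_family \<Rightarrow> complex set \<Rightarrow> higgs_family" where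
  "restrict_family G W = G\<lparr>fbase := (\<lambda>i. fbase G i \<inter> W)\<rparr>"

definition is_higgs_family :: "complex set \<Rightarrow> regularity \<Rightarrow> complex set \<Rightarrow> higgs_family \<Rightarrow> bool" where
  "is_higgs_family L R V G \<longleftrightarrow>
     (\<forall>i. open (fbase G i)) \<and> (\<Union>i. fbase G i) = V \<and>
     (\<forall>i. (\<Union>a. fxdom G (i, a)) = UNIV) \<and>
     (\<forall>i a a'. \<forall>u \<in> fbase G i. \<forall>u' \<in> fbase G i. \<forall>x \<in> fxdom G (i, a) \<inter> fxdom G (i, a').
        ftrans G (i, a) (i, a') u x = ftrans G (i, a) (i, a') u' x) \<and>
     (\<forall>c c'. regular_mat R (fbase G (fst c) \<inter> fbase G (fst c')) (fxdom G c \<inter> fxdom G c')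
               (frank G) (frank G) (ftrans G c c')) \<and>
     (\<forall>c. regular_mat R (fbase G (fst c)) (fxdom G c) (frank G) (frank G) (fdbar G c) \<and>
          regular_mat R (fbase G (fst c)) (fxdom G c) (frank G) (frank G) (fphi G c)) \<and>
     (\<forall>u\<in>V. is_higgs_bundle L (slice G u))"

type_synonym family_map = "chart \<Rightarrow> chart \<Rightarrow> complex \<Rightarrow> complex \<Rightarrow> complex mat"

definition map_slice ::
    "family_map \<Rightarrow> complex \<Rightarrow> chart \<Rightarrow> chart \<Rightarrow> complex \<Rightarrow> complex mat" where
  "map_slice f u = (\<lambda>c b. f c b u)"

definition family_hom ::
    "complex set \<Rightarrow> regularity \<Rightarrow> complex set \<Rightarrow> higgs_family \<Rightarrow> higgs_family \<Rightarrow> family_map \<Rightarrow> bool" where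
  "family_hom L R V S G f \<longleftrightarrow>
     (\<forall>c b. regular_mat R (fbase G (fst c) \<inter> fbase S (fst b)) (fxdom G c \<inter> fxdom S b)
              (frank G) (frank S) (f c b)) \<and>
     (\<forall>u\<in>V. higgs_hom L (slice S u) (slice G u) (map_slice f u))"

definition family_iso ::
    "complex set \<Rightarrow> regularity \<Rightarrow> complex set \<Rightarrow> higgs_family \<Rightarrow> higgs_family \<Rightarrow> bool" where
  "family_iso L R V S G \<longleftrightarrow>
     (\<exists>f. family_hom L R V S G f \<and>
        (\<forall>u\<in>V. fibrewise_inj (slice S u) (slice G u) (map_slice f u) \<and>
                fibrewise_surj (slice S u) (slice G u) (map_slice f u)))"

definition short_exact ::
    "complex set \<Rightarrow> regularity \<Rightarrow> complex set \<Rightarrow> higgs_family \<Rightarrow> higgs_family \<Rightarrow> higgs_family \<Rightarrow> bool" where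
  "short_exact L R V S G Q \<longleftrightarrow>
     (\<exists>f g. family_hom L R V S G f \<and> family_hom L R V G Q g \<and>
        (\<forall>u\<in>V. fibrewise_inj (slice S u) (slice G u) (map_slice f u) \<and>
                fibrewise_surj (slice G u) (slice Q u) (map_slice g u) \<and>
                (\<forall>b c q. \<forall>x \<in> hdom (slice S u) b \<inter> hdom (slice G u) c \<inter> hdom (slice Q u) q.
                   fibre_image (f c b u x) = fibre_kernel (g q c u x))))"

definition admits_harmonic_metric ::
    "complex set \<Rightarrow> regularity \<Rightarrow> complex set \<Rightarrow> higgs_family \<Rightarrow> bool" where
  "admits_harmonic_metric L R V G \<longleftrightarrow>
     (\<exists>H. (\<forall>c. regular_mat R (fbase G (fst c)) (fxdom G c) (frank G) (frank G) (H c)) \<and>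
          (\<forall>u\<in>V. harmonic_metric L (slice G u) (\<lambda>c. H c u)))"

text \<open>
  An invariant subbundle of \<open>G\<close> is a Higgs family with a fibrewise injective morphism to \<open>G\<close>. In a
  filtration with members \<open>j i : F i \<rightarrow> G\<close>, the quotient of \<open>F i\<close> by \<open>F (i-1)\<close> is a Higgs family \<open>Q\<close>
  with a fibrewise surjective morphism \<open>p : F i \<rightarrow> Q\<close> whose kernel consists of the vectors that \<open>j i\<close>
  sends into the image of \<open>j (i-1)\<close>.
\<close>

definition higgs_subbundle ::
    "complex set \<Rightarrow> regularity \<Rightarrow> complex set \<Rightarrow> higgs_family \<Rightarrow> higgs_family \<Rightarrow> family_map \<Rightarrow> bool" where
  "higgs_subbundle L R V F G j \<longleftrightarrow>
     is_higgs_family L R V F \<and> family_hom L R V F G j \<and>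
     (\<forall>u\<in>V. fibrewise_inj (slice F u) (slice G u) (map_slice j u))"

definition subbundle_le ::
    "complex set \<Rightarrow> higgs_family \<Rightarrow> higgs_family \<Rightarrow> family_map \<Rightarrow> higgs_family \<Rightarrow> family_map \<Rightarrow> bool" where
  "subbundle_le V G F j F' j' \<longleftrightarrow>
     (\<forall>u\<in>V. \<forall>c b b'. \<forall>x \<in> hdom (slice G u) c \<inter> hdom (slice F u) b \<inter> hdom (slice F' u) b'.
        fibre_image (j c b u x) \<subseteq> fibre_image (j' c b' u x))"

definition is_quotient ::
    "complex set \<Rightarrow> regularity \<Rightarrow> complex set \<Rightarrow> higgs_family \<Rightarrow>
     higgs_family \<Rightarrow> family_map \<Rightarrow> higgs_family \<Rightarrow> family_map \<Rightarrow> higgs_family \<Rightarrow> bool" where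
  "is_quotient L R V G F j F' j' Q \<longleftrightarrow>
     is_higgs_family L R V Q \<and>
     (\<exists>p. family_hom L R V F' Q p \<and>
        (\<forall>u\<in>V. fibrewise_surj (slice F' u) (slice Q u) (map_slice p u) \<and>
           (\<forall>c b b' q. \<forall>x \<in> hdom (slice G u) c \<inter> hdom (slice F u) b
                              \<inter> hdom (slice F' u) b' \<inter> hdom (slice Q u) q.
              fibre_kernel (p q b' u x)
                = {v \<in> carrier_vec (frank F'). j' c b' u x *\<^sub>v v \<in> fibre_image (j c b u x)})))"

definition admits_harmonic_filtration ::
    "complex set \<Rightarrow> regularity \<Rightarrow> complex set \<Rightarrow> higgs_family \<Rightarrow> bool" where
  "admits_harmonic_filtration L R V G \<longleftrightarrow>
     (\<exists>l F j. (\<forall>i\<le>l. higgs_subbundle L R V (F i) G (j i)) \<and>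
        frank (F 0) = 0 \<and> frank (F l) = frank G \<and>
        (\<forall>i<l. subbundle_le V G (F i) (j i) (F (Suc i)) (j (Suc i)) \<and>
           (\<exists>Q. is_quotient L R V G (F i) (j i) (F (Suc i)) (j (Suc i)) Q \<and>
                admits_harmonic_metric L R V Q)))"

text \<open>Objects over an open subset \<open>V\<close> of \<open>\<complex>\<close> of the prestack generated by extensions.\<close>

inductive prestack_Dol :: "complex set \<Rightarrow> enat \<Rightarrow> complex set \<Rightarrow> higgs_family \<Rightarrow> bool"
  for L :: "complex set" and d :: enat and V :: "complex set" where
  harmonic: "is_higgs_family L (Cd_smooth d) V G \<Longrightarrow> admits_harmonic_metric L (Cd_smooth d) V G \<Longrightarrow>
             prestack_Dol L d V G"
| extension: "prestack_Dol L d V S \<Longrightarrow> prestack_Dol L d V Q \<Longrightarrow> is_higgs_family L (Cd_smooth d) V G \<Longrightarrow>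
              short_exact L (Cd_smooth d) V S G Q \<Longrightarrow> prestack_Dol L d V G"

text \<open>The prestack is a full sub-prestack of the stack of all \<open>C\<^sup>d\<^sub>U C\<^sup>\<infinity>\<^sub>X\<close> Higgs families, so the objects
  of its stackification are the families that are, on an open cover, isomorphic to objects of the
  prestack.\<close>

definition stack_Dol :: "complex set \<Rightarrow> enat \<Rightarrow> complex set \<Rightarrow> higgs_family \<Rightarrow> bool" where
  "stack_Dol L d V G \<longleftrightarrow> is_higgs_family L (Cd_smooth d) V G \<and>
     (\<forall>u\<in>V. \<exists>W G'. open W \<and> u \<in> W \<and> W \<subseteq> V \<and> prestack_Dol L d W G' \<and>
        family_iso L (Cd_smooth d) W (restrict_family G W) G')"

text \<open>The trivial bundle of rank 2 with its trivial Dolbeault operator, for \<open>\<alpha> = a(x) dx\<close>. All charts are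
  copies of the same global one.\<close>

definition theta_family :: "(complex \<Rightarrow> complex) \<Rightarrow> complex set \<Rightarrow> higgs_family" where
  "theta_family a U = \<lparr>
     frank = 2,
     fbase = (\<lambda>i. U),
     fxdom = (\<lambda>c. UNIV),
     ftrans = (\<lambda>c c' z x. 1\<^sub>m 2),
     fdbar = (\<lambda>c z x. 0\<^sub>m 2 2),
     fphi = (\<lambda>c z x. a x \<cdot>\<^sub>m mat_of_rows_list 2 [[0, z], [z\<^sup>2, 0]])\<rparr>"

end

theory Submission
  imports Defs "HOL-Complex_Analysis.Cauchy_Integral_Formula"
begin

text \<open>
  By Liouville's theorem \<open>\<alpha>\<close> is a constant multiple of \<open>dx\<close>, so for \<open>z = s\<^sup>2 \<noteq> 0\<close> the Higgs field has the
  constant eigenvectors \<open>(1, s)\<close> and \<open>(1, -s)\<close> with distinct eigenvalues. Let \<open>e\<close> be the first of them and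
  \<open>h\<close> a harmonic metric. The Bochner formula expresses the Laplacian of \<open>h(e, e)\<close> as a sum of two squares,
  one of which measures the failure of \<open>e\<close> to be an eigenvector of the adjoint Higgs field. At a maximum
  point both squares vanish, and there the two eigenvectors are \<open>h\<close>-orthogonal. As \<open>z\<close> tends to \<open>0\<close> both
  eigenvectors tend to \<open>(1, 0)\<close>, so a metric depending continuously on \<open>z\<close> would degenerate at \<open>z = 0\<close>.

  A step of rank one in a filtration or an extension would be an eigenline depending continuously on \<open>z\<close>,
  that is, a continuous square root of \<open>z\<close> around \<open>0\<close>. All other filtrations and iterated extensions have
  a graded piece isomorphic to the whole family, to which the first argument applies.
\<close>

text \<open>The two entries of the Higgs field vanish to different orders at \<open>0\<close>. The
  characteristic polynomial \<open>t\<^sup>2 - \<alpha>\<^sup>2 z\<^sup>3\<close> therefore has a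
  discriminant of odd order: a turn around \<open>0\<close> exchanges the two eigenlines, and they
  merge at \<open>0\<close>. The Higgs field itself is zero there, so that slice stays polystable.
  With equal orders the eigenlines would be constant and nothing would degenerate.

  Orthogonality is obtained only at a maximum point of each slice, and this point moves with z.
  Compactness of a fundamental parallelogram makes the points accumulate, and the limit then calls
  for continuity jointly in z and x.

  The pieces of a filtration or extension come with charts of their own and are of class C^d,
  whereas the model is real-analytic. The obstruction is therefore proved for every family with a
  \<open>theta_frame\<close>. Continuity in the parameter is what both arguments consume, and it
  survives composition and inversion, so such frames can be moved along isomorphisms in both
  directions.\<close>

no_notation vec_index (infixl \<open>$\<close> 100)

section \<open>Calculus of smooth functions\<close>

lemma dird_cong:
  assumes "open D" "x \<in> D" "\<And>y. y \<in> D \<Longrightarrow> f y = g y"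
  shows "dird v f x = dird v g x"
proof -
  have "(f has_derivative f') (at x) \<longleftrightarrow> (g has_derivative f') (at x)" for f'
    using assms has_derivative_transform_within_open[of f f' x UNIV D g]
      has_derivative_transform_within_open[of g f' x UNIV D f] by auto
  then show ?thesis by (simp add: dird_def frechet_derivative_def)
qed

lemma iter_dird_cong:
  assumes "open D" "\<And>y. y \<in> D \<Longrightarrow> f y = g y" "x \<in> D"
  shows "iter_dird vs f x = iter_dird vs g x"
  using assms(2,3)
proof (induction vs arbitrary: f g x)
  case (Cons v vs)
  have "dird v f y = dird v g y" if "y \<in> D" for y
    using dird_cong[OF assms(1) that] Cons.prems(1) by blast
  then have "iter_dird vs (dird v f) x = iter_dird vs (dird v g) x"
    using Cons.IH[of "dird v f" "dird v g" x] Cons.prems(2) by blast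
  then show ?case by simp
qed simp

lemma differentiable_on_cong:
  assumes "f differentiable_on D" "\<And>y. y \<in> D \<Longrightarrow> f y = g y"
  shows "g differentiable_on D"
  using assms unfolding differentiable_on_def differentiable_def
  by (metis has_derivative_transform)

lemma smooth_fun_cong:
  assumes "smooth_fun D f" "open D" "\<And>y. y \<in> D \<Longrightarrow> f y = g y"
  shows "smooth_fun D g"
  using assms iter_dird_cong[of D f g] unfolding smooth_fun_def
  by (metis differentiable_on_cong)

lemma smooth_fun_dird:
  assumes "smooth_fun D f" "v \<in> {1, \<i>}"
  shows "smooth_fun D (dird v f)"
  unfolding smooth_fun_def
proof (intro allI impI)
  fix vs :: "complex list" assume "set vs \<subseteq> {1, \<i>}"
  then have "set (v # vs) \<subseteq> {1, \<i>}" using assms(2) by simp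
  then have "iter_dird (v # vs) f differentiable_on D"
    using assms(1) unfolding smooth_fun_def by blast
  then show "iter_dird vs (dird v f) differentiable_on D" by simp
qed

lemma smooth_fun_differentiable_on: "smooth_fun D f \<Longrightarrow> f differentiable_on D"
  unfolding smooth_fun_def by (metis empty_subsetI iter_dird.simps(1) list.set(1))

lemma smooth_fun_differentiable:
  "smooth_fun D f \<Longrightarrow> open D \<Longrightarrow> x \<in> D \<Longrightarrow> f differentiable at x"
  using smooth_fun_differentiable_on differentiable_on_eq_differentiable_at by blast

lemma smooth_fun_continuous_on: "smooth_fun D f \<Longrightarrow> continuous_on D f"
  using smooth_fun_differentiable_on differentiable_imp_continuous_on by blast

lemma has_derivative_dird:
  "f differentiable at x \<Longrightarrow> (f has_derivative (\<lambda>v. dird v f x)) (at x)"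
  unfolding dird_def by (simp add: frechet_derivative_works)

lemma dird_eqI: "(f has_derivative f') (at x) \<Longrightarrow> dird v f x = f' v"
  unfolding dird_def using frechet_derivative_at by metis

lemma dird_const [simp]: "dird v (\<lambda>x. c) = (\<lambda>x. 0)"
  by (rule ext, subst dird_eqI[OF has_derivative_const]) simp

lemma dird_add:
  assumes "f differentiable at x" "g differentiable at x"
  shows "dird v (\<lambda>x. f x + g x) x = dird v f x + dird v g x"
  by (rule dird_eqI[OF has_derivative_add]) (use assms has_derivative_dird in auto)

lemma dird_diff:
  assumes "f differentiable at x" "g differentiable at x"
  shows "dird v (\<lambda>x. f x - g x) x = dird v f x - dird v g x"
  by (rule dird_eqI[OF has_derivative_diff]) (use assms has_derivative_dird in auto)

lemma dird_mult:
  assumes "f differentiable at x" "g differentiable at x"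
  shows "dird v (\<lambda>x. f x * g x) x = dird v f x * g x + f x * dird v g x"
  using dird_eqI[OF has_derivative_mult[OF has_derivative_dird[OF assms(1)] has_derivative_dird[OF assms(2)]], of v]
  by (simp add: algebra_simps)

lemma dird_divide:
  assumes "f differentiable at x" "g differentiable at x" "g x \<noteq> 0"
  shows "dird v (\<lambda>x. f x / g x) x = (dird v f x * g x - f x * dird v g x) / (g x * g x)"
  using dird_eqI[OF has_derivative_divide'[OF has_derivative_dird[OF assms(1)] has_derivative_dird[OF assms(2)]], of v]
    assms(3) by simp

lemma dird_cnj:
  assumes "f differentiable at x"
  shows "dird v (\<lambda>x. cnj (f x)) x = cnj (dird v f x)"
  by (rule dird_eqI[OF has_derivative_cnj]) (use assms has_derivative_dird in auto)

lemma iter_dird_const: "iter_dird vs (\<lambda>x. c) = (\<lambda>x. if vs = [] then c else 0)"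
  by (induction vs arbitrary: c) auto

lemma smooth_fun_const: "smooth_fun D (\<lambda>x. c)"
  unfolding smooth_fun_def iter_dird_const by simp

text \<open>A derivative of a product is a sum of two products, so induction on the number of
  derivatives closes up only for finite sums of products. Products and sums of smooth functions are
  the special cases below.\<close>

lemma smooth_fun_sum_products:
  assumes "open D" "\<And>f g. (f, g) \<in> set ps \<Longrightarrow> smooth_fun D f \<and> smooth_fun D g"
  shows "smooth_fun D (\<lambda>x. \<Sum>(f, g)\<leftarrow>ps. f x * g x)"
proof -
  have diff: "(\<lambda>x. \<Sum>(f, g)\<leftarrow>ps. f x * g x) differentiable at x"
    if "\<And>f g. (f, g) \<in> set ps \<Longrightarrow> smooth_fun D f \<and> smooth_fun D g" "x \<in> D"
    for ps :: "((complex \<Rightarrow> complex) \<times> (complex \<Rightarrow> complex)) list" and x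
    using that
  proof (induction ps)
    case (Cons p ps)
    then show ?case
      using assms(1) smooth_fun_differentiable[of D "fst p"] smooth_fun_differentiable[of D "snd p"]
      by (cases p) (auto intro!: differentiable_add differentiable_mult)
  qed simp
  have leibniz: "dird v (\<lambda>x. \<Sum>(f, g)\<leftarrow>ps. f x * g x) x =
      (\<Sum>(f, g)\<leftarrow>concat (map (\<lambda>(f, g). [(dird v f, g), (f, dird v g)]) ps). f x * g x)"
    if "\<And>f g. (f, g) \<in> set ps \<Longrightarrow> smooth_fun D f \<and> smooth_fun D g" "x \<in> D"
    for ps :: "((complex \<Rightarrow> complex) \<times> (complex \<Rightarrow> complex)) list" and v x
    using that
  proof (induction ps)
    case (Cons p ps)
    obtain f g where p: "p = (f, g)" by (cases p)
    have fg: "f differentiable at x" "g differentiable at x"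
      using Cons.prems p smooth_fun_differentiable[OF _ assms(1)] by auto
    have "dird v (\<lambda>x. f x * g x + (\<Sum>(f, g)\<leftarrow>ps. f x * g x)) x =
        dird v (\<lambda>x. f x * g x) x + dird v (\<lambda>x. \<Sum>(f, g)\<leftarrow>ps. f x * g x) x"
      by (intro dird_add differentiable_mult diff fg) (use Cons.prems in auto)
    moreover have "dird v (\<lambda>x. \<Sum>(f, g)\<leftarrow>ps. f x * g x) x =
      (\<Sum>(f, g)\<leftarrow>concat (map (\<lambda>(f, g). [(dird v f, g), (f, dird v g)]) ps). f x * g x)"
      by (rule Cons.IH) (use Cons.prems in auto)
    ultimately show ?case by (simp add: p dird_mult[OF fg] add.assoc)
  qed simp
  have "iter_dird vs (\<lambda>x. \<Sum>(f, g)\<leftarrow>ps. f x * g x) differentiable_on D" if "set vs \<subseteq> {1, \<i>}" for vs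
    using assms(2) that
  proof (induction vs arbitrary: ps)
    case Nil
    then show ?case
      using diff[of ps] assms(1) by (simp add: differentiable_on_eq_differentiable_at)
  next
    case (Cons v vs)
    define qs where "qs = concat (map (\<lambda>(f, g). [(dird v f, g), (f, dird v g)]) ps)"
    have qs: "smooth_fun D f \<and> smooth_fun D g" if "(f, g) \<in> set qs" for f g
      using that Cons.prems smooth_fun_dird[of D _ v] unfolding qs_def by fastforce
    then have "iter_dird vs (\<lambda>x. \<Sum>(f, g)\<leftarrow>qs. f x * g x) differentiable_on D"
      using Cons.IH[of qs] Cons.prems(2) by auto
    then have "iter_dird vs (dird v (\<lambda>x. \<Sum>(f, g)\<leftarrow>ps. f x * g x)) differentiable_on D"
      by (rule differentiable_on_cong)
        (rule iter_dird_cong[OF assms(1)], unfold qs_def, rule leibniz[symmetric],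
          use Cons.prems in auto)
    then show ?case by simp
  qed
  then show ?thesis by (simp add: smooth_fun_def)
qed

lemma smooth_fun_mult:
  assumes "open D" "smooth_fun D f" "smooth_fun D g"
  shows "smooth_fun D (\<lambda>x. f x * g x)"
  using smooth_fun_sum_products[of D "[(f, g)]"] assms by simp

lemma smooth_fun_add:
  assumes "open D" "smooth_fun D f" "smooth_fun D g"
  shows "smooth_fun D (\<lambda>x. f x + g x)"
  using smooth_fun_sum_products[of D "[(f, \<lambda>x. 1), (g, \<lambda>x. 1)]"] assms smooth_fun_const by fastforce

lemma smooth_fun_diff:
  assumes "open D" "smooth_fun D f" "smooth_fun D g"
  shows "smooth_fun D (\<lambda>x. f x - g x)"
  using smooth_fun_add[OF assms(1,2) smooth_fun_mult[OF assms(1) smooth_fun_const[of D "-1"] assms(3)]]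
  by simp

text \<open>The quotient rule yields again a quotient of smooth functions, with the
  nowhere-vanishing denominator \<open>g x * g x\<close>. Hence the induction over derivatives
  generalizes over \<open>f\<close> and \<open>g\<close>.\<close>

lemma smooth_fun_divide:
  assumes "open D" "smooth_fun D f" "smooth_fun D g" "\<And>x. x \<in> D \<Longrightarrow> g x \<noteq> 0"
  shows "smooth_fun D (\<lambda>x. f x / g x)"
proof -
  have "iter_dird vs (\<lambda>x. f x / g x) differentiable_on D" if "set vs \<subseteq> {1, \<i>}" for vs
    using assms(2-4) that
  proof (induction vs arbitrary: f g)
    case Nil
    then show ?case
      using smooth_fun_differentiable[OF _ assms(1)]
      by (simp add: differentiable_on_eq_differentiable_at[OF assms(1)] differentiable_divide)
  next
    case (Cons v vs)
    have "iter_dird vs (\<lambda>x. (dird v f x * g x - f x * dird v g x) / (g x * g x)) differentiable_on D"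
      using Cons.prems smooth_fun_dird
      by (intro Cons.IH smooth_fun_mult smooth_fun_diff assms(1)) auto
    then have "iter_dird vs (dird v (\<lambda>x. f x / g x)) differentiable_on D"
      by (rule differentiable_on_cong)
        (rule iter_dird_cong[OF assms(1)], rule dird_divide[symmetric],
          use Cons.prems smooth_fun_differentiable[OF _ assms(1)] in auto)
    then show ?case by simp
  qed
  then show ?thesis by (simp add: smooth_fun_def)
qed

lemma smooth_fun_cnj:
  assumes "open D" "smooth_fun D f"
  shows "smooth_fun D (\<lambda>x. cnj (f x))"
proof -
  have "iter_dird vs (\<lambda>x. cnj (f x)) differentiable_on D" if "set vs \<subseteq> {1, \<i>}" for vs
    using assms(2) that
  proof (induction vs arbitrary: f)
    case Nil
    then have "f differentiable_on D" by (intro smooth_fun_differentiable_on)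
    then show ?case
      unfolding differentiable_on_def differentiable_def by (auto intro: has_derivative_cnj)
  next
    case (Cons v vs)
    have "iter_dird vs (\<lambda>x. cnj (dird v f x)) differentiable_on D"
      using Cons.prems smooth_fun_dird by (intro Cons.IH) auto
    then have "iter_dird vs (dird v (\<lambda>x. cnj (f x))) differentiable_on D"
      by (rule differentiable_on_cong)
        (rule iter_dird_cong[OF assms(1)], rule dird_cnj[symmetric],
          use Cons.prems smooth_fun_differentiable[OF _ assms(1)] in auto)
    then show ?case by simp
  qed
  then show ?thesis by (simp add: smooth_fun_def)
qed

lemma smooth_fun_dx:
  assumes "open D" "smooth_fun D f"
  shows "smooth_fun D (dx f)"
proof -
  have "smooth_fun D (\<lambda>x. (dird 1 f x - \<i> * dird \<i> f x) / 2)"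
    using assms smooth_fun_dird by (intro smooth_fun_divide smooth_fun_diff smooth_fun_mult smooth_fun_const) auto
  then show ?thesis by (rule smooth_fun_cong) (auto simp: dx_def assms)
qed

lemma smooth_fun_subset: "smooth_fun D f \<Longrightarrow> D' \<subseteq> D \<Longrightarrow> smooth_fun D' f"
  unfolding smooth_fun_def using differentiable_on_subset by blast

lemma smooth_fun_local:
  assumes "\<And>x. x \<in> D \<Longrightarrow> \<exists>D' g. open D' \<and> x \<in> D' \<and> smooth_fun D' g \<and> (\<forall>y\<in>D'. f y = g y)"
  shows "smooth_fun D f"
  unfolding smooth_fun_def
proof (intro allI impI)
  fix vs :: "complex list" assume vs: "set vs \<subseteq> {1, \<i>}"
  show "iter_dird vs f differentiable_on D"
    unfolding differentiable_on_def
  proof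
    fix x assume "x \<in> D"
    then obtain D' g where D': "open D'" "x \<in> D'" "smooth_fun D' g" "\<forall>y\<in>D'. f y = g y"
      using assms by metis
    then have "smooth_fun D' f" using smooth_fun_cong[of D' g f] by simp
    then have "iter_dird vs f differentiable_on D'" using vs unfolding smooth_fun_def by blast
    then show "iter_dird vs f differentiable at x within D"
      using D' differentiable_at_withinI differentiable_on_eq_differentiable_at by blast
  qed
qed

lemma dx_const [simp]: "dx (\<lambda>x. c) x = 0" and dxbar_const [simp]: "dxbar (\<lambda>x. c) x = 0"
  by (simp_all add: dx_def dxbar_def)

lemma dx_cong:
  assumes "open D" "x \<in> D" "\<And>y. y \<in> D \<Longrightarrow> f y = g y"
  shows "dx f x = dx g x" and "dxbar f x = dxbar g x"
  using dird_cong[OF assms] by (simp_all add: dx_def dxbar_def)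

lemma dx_add:
  assumes "f differentiable at x" "g differentiable at x"
  shows "dx (\<lambda>x. f x + g x) x = dx f x + dx g x"
    and "dxbar (\<lambda>x. f x + g x) x = dxbar f x + dxbar g x"
  by (simp_all add: dx_def dxbar_def dird_add[OF assms] algebra_simps add_divide_distrib diff_divide_distrib)

lemma dx_mult:
  assumes "f differentiable at x" "g differentiable at x"
  shows "dx (\<lambda>x. f x * g x) x = dx f x * g x + f x * dx g x"
    and "dxbar (\<lambda>x. f x * g x) x = dxbar f x * g x + f x * dxbar g x"
  by (simp_all add: dx_def dxbar_def dird_mult[OF assms] algebra_simps add_divide_distrib diff_divide_distrib)

lemma dx_cnj:
  assumes "f differentiable at x"
  shows "dx (\<lambda>x. cnj (f x)) x = cnj (dxbar f x)"
    and "dxbar (\<lambda>x. cnj (f x)) x = cnj (dx f x)"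
  by (simp_all add: dx_def dxbar_def dird_cnj[OF assms])

section \<open>Symmetry of second derivatives\<close>

lemma has_vector_derivative_along_line:
  assumes "f differentiable at (p + of_real t * v)"
  shows "((\<lambda>s. f (p + of_real s * v)) has_vector_derivative dird v f (p + of_real t * v)) (at t)"
proof -
  have line: "((\<lambda>s. p + of_real s * v) has_derivative (\<lambda>s. of_real s * v)) (at t)"
    by (auto intro!: derivative_eq_intros)
  have "bounded_linear (\<lambda>w. dird w f (p + of_real t * v))"
    using has_derivative_dird[OF assms] has_derivative_bounded_linear by blast
  then have "dird (of_real s * v) f (p + of_real t * v) = s *\<^sub>R dird v f (p + of_real t * v)" for s
    using linear_simps(5)[of "\<lambda>w. dird w f (p + of_real t * v)"]
    by (metis scaleR_conv_of_real)
  then show ?thesis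
    using has_derivative_compose[OF line has_derivative_dird[OF assms]]
    by (simp add: has_vector_derivative_def)
qed

text \<open>Two applications of the mean value theorem, first along \<open>v\<close> and then along
  \<open>w\<close>. The second difference over the parallelogram with edges \<open>h v\<close> and
  \<open>h w\<close> becomes a value of one iterated derivative, and the left-hand side is symmetric
  in \<open>v\<close> and \<open>w\<close>.\<close>

lemma double_difference_mean_value:
  fixes g g1 g12 :: "complex \<Rightarrow> real"
  assumes "0 < h" "2 * h < r" "norm v \<le> 1" "norm w \<le> 1"
    and g1: "\<And>q t. q + of_real t * v \<in> ball p r \<Longrightarrow>
      ((\<lambda>s. g (q + of_real s * v)) has_real_derivative g1 (q + of_real t * v)) (at t)"
    and g12: "\<And>q t. q + of_real t * w \<in> ball p r \<Longrightarrow>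
      ((\<lambda>s. g1 (q + of_real s * w)) has_real_derivative g12 (q + of_real t * w)) (at t)"
  obtains q where "q \<in> ball p r" "norm (q - p) \<le> 2 * h"
    "g (p + of_real h * v + of_real h * w) - g (p + of_real h * v) - g (p + of_real h * w) + g p
      = h * h * g12 q"
proof -
  have near: "norm (of_real s * v + of_real t * w) \<le> 2 * h" if "0 \<le> s" "s \<le> h" "0 \<le> t" "t \<le> h" for s t
  proof -
    have "norm (of_real s * v + of_real t * w) \<le> s * norm v + t * norm w"
      using norm_triangle_ineq[of "of_real s * v" "of_real t * w"] that by (simp add: norm_mult)
    also have "\<dots> \<le> h * 1 + h * 1"
      using that assms by (intro add_mono mult_mono) auto
    finally show ?thesis by simp
  qed
  have inb: "p + of_real s * v + of_real t * w \<in> ball p r" if "0 \<le> s" "s \<le> h" "0 \<le> t" "t \<le> h" for s t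
  proof -
    have "dist (p + (of_real s * v + of_real t * w)) p < r"
      using near[OF that] assms(2) by (simp add: dist_norm)
    then show ?thesis by (simp add: dist_commute add.assoc)
  qed
  \<comment> \<open>The difference across the edge \<open>h w\<close>, as a function along
    \<open>v\<close>; its increment over \<open>[0, h]\<close> is the second difference.\<close>
  define \<phi> where "\<phi> s = g ((p + of_real h * w) + of_real s * v) - g (p + of_real s * v)" for s
  have "\<exists>\<xi>. 0 < \<xi> \<and> \<xi> < h \<and> \<phi> h - \<phi> 0 =
      (h - 0) * (g1 ((p + of_real h * w) + of_real \<xi> * v) - g1 (p + of_real \<xi> * v))"
  proof (rule MVT2[OF assms(1)])
    fix s assume "0 \<le> s" "s \<le> h"
    then show "(\<phi> has_real_derivative g1 ((p + of_real h * w) + of_real s * v) - g1 (p + of_real s * v)) (at s)"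
      unfolding \<phi>_def using inb[of s h] inb[of s 0] assms(1)
      by (intro DERIV_diff g1) (simp_all add: algebra_simps)
  qed
  then obtain \<xi> where \<xi>: "0 < \<xi>" "\<xi> < h"
    "\<phi> h - \<phi> 0 = h * (g1 ((p + of_real h * w) + of_real \<xi> * v) - g1 (p + of_real \<xi> * v))" by auto
  have "\<exists>\<eta>. 0 < \<eta> \<and> \<eta> < h \<and>
      g1 ((p + of_real \<xi> * v) + of_real h * w) - g1 ((p + of_real \<xi> * v) + of_real 0 * w) =
      (h - 0) * g12 ((p + of_real \<xi> * v) + of_real \<eta> * w)"
    by (rule MVT2[OF assms(1)], rule g12, rule inb) (use \<xi> in auto)
  then obtain \<eta> where \<eta>: "0 < \<eta>" "\<eta> < h"
    "g1 ((p + of_real \<xi> * v) + of_real h * w) - g1 (p + of_real \<xi> * v) =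
      h * g12 ((p + of_real \<xi> * v) + of_real \<eta> * w)" by auto
  show ?thesis
  proof (rule that[of "p + of_real \<xi> * v + of_real \<eta> * w"])
    show "p + of_real \<xi> * v + of_real \<eta> * w \<in> ball p r" using inb \<xi> \<eta> by simp
    show "norm (p + of_real \<xi> * v + of_real \<eta> * w - p) \<le> 2 * h" using near[of \<xi> \<eta>] \<xi> \<eta> by (simp add: add.assoc)
    have "\<phi> h - \<phi> 0 = h * (h * g12 (p + of_real \<xi> * v + of_real \<eta> * w))"
      using \<xi>(3) \<eta>(3) by (simp add: algebra_simps)
    then show "g (p + of_real h * v + of_real h * w) - g (p + of_real h * v) - g (p + of_real h * w) + g p
      = h * h * g12 (p + of_real \<xi> * v + of_real \<eta> * w)"
      by (simp add: \<phi>_def algebra_simps)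
  qed
qed

text \<open>By symmetry of the second difference, \<open>g12\<close> and \<open>g21\<close> take
  equal values at two points within \<open>2 * h\<close> of \<open>p\<close>. For small
  \<open>h\<close> continuity at \<open>p\<close> carries the equality to \<open>p\<close>.\<close>

lemma mixed_partials_real:
  fixes g g1 g2 g12 g21 :: "complex \<Rightarrow> real"
  assumes "0 < r" "norm v \<le> 1" "norm w \<le> 1"
    and g1: "\<And>q t. q + of_real t * v \<in> ball p r \<Longrightarrow>
      ((\<lambda>s. g (q + of_real s * v)) has_real_derivative g1 (q + of_real t * v)) (at t)"
    and g12: "\<And>q t. q + of_real t * w \<in> ball p r \<Longrightarrow>
      ((\<lambda>s. g1 (q + of_real s * w)) has_real_derivative g12 (q + of_real t * w)) (at t)"
    and g2: "\<And>q t. q + of_real t * w \<in> ball p r \<Longrightarrow>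
      ((\<lambda>s. g (q + of_real s * w)) has_real_derivative g2 (q + of_real t * w)) (at t)"
    and g21: "\<And>q t. q + of_real t * v \<in> ball p r \<Longrightarrow>
      ((\<lambda>s. g2 (q + of_real s * v)) has_real_derivative g21 (q + of_real t * v)) (at t)"
    and cont: "isCont g12 p" "isCont g21 p"
  shows "g12 p = g21 p"
proof (rule ccontr)
  assume "g12 p \<noteq> g21 p"
  define e where "e = \<bar>g12 p - g21 p\<bar> / 2"
  have "e > 0" using \<open>g12 p \<noteq> g21 p\<close> by (simp add: e_def)
  obtain d1 where d1: "d1 > 0" "\<And>q. dist q p < d1 \<Longrightarrow> dist (g12 q) (g12 p) < e"
    using cont(1) \<open>e > 0\<close> by (metis continuous_at_eps_delta dist_norm real_norm_def)
  obtain d2 where d2: "d2 > 0" "\<And>q. dist q p < d2 \<Longrightarrow> dist (g21 q) (g21 p) < e"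
    using cont(2) \<open>e > 0\<close> by (metis continuous_at_eps_delta dist_norm real_norm_def)
  define h where "h = min r (min d1 d2) / 3"
  have h: "0 < h" "2 * h < r" "2 * h < d1" "2 * h < d2" using assms(1) d1 d2 by (auto simp: h_def)
  obtain q where q: "norm (q - p) \<le> 2 * h"
    "g (p + of_real h * v + of_real h * w) - g (p + of_real h * v) - g (p + of_real h * w) + g p
      = h * h * g12 q"
    using double_difference_mean_value[OF h(1,2) assms(2,3) g1 g12] by metis
  obtain q' where q': "norm (q' - p) \<le> 2 * h"
    "g (p + of_real h * w + of_real h * v) - g (p + of_real h * w) - g (p + of_real h * v) + g p
      = h * h * g21 q'"
    using double_difference_mean_value[OF h(1,2) assms(3,2) g2 g21] by metis
  have "h * h * g12 q = h * h * g21 q'" using q(2) q'(2) by (simp add: algebra_simps)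
  then have eq: "g12 q = g21 q'" using h(1) by simp
  have "dist (g12 q) (g12 p) < e" "dist (g21 q') (g21 p) < e"
    using d1 d2 h q(1) q'(1) by (auto simp: dist_norm)
  moreover have "\<bar>g12 p - g21 p\<bar> \<le> dist (g12 q) (g12 p) + dist (g21 q') (g21 p)"
    using eq unfolding dist_real_def by linarith
  ultimately show False unfolding e_def by simp
qed

lemma dird_commute:
  assumes "open D" "smooth_fun D f" "p \<in> D"
  shows "dird \<i> (dird 1 f) p = dird 1 (dird \<i> f) p"
proof -
  obtain r where r: "r > 0" "ball p r \<subseteq> D" using assms open_contains_ball by blast
  have sm: "smooth_fun D (dird 1 f)" "smooth_fun D (dird \<i> f)"
    "smooth_fun D (dird \<i> (dird 1 f))" "smooth_fun D (dird 1 (dird \<i> f))"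
    using assms(2) by (simp_all add: smooth_fun_dird)
  have cont: "isCont (dird \<i> (dird 1 f)) p" "isCont (dird 1 (dird \<i> f)) p"
    using sm(3,4) assms(1,3) smooth_fun_continuous_on continuous_on_eq_continuous_at by blast+
  have der: "((\<lambda>s. g (q + of_real s * v)) has_vector_derivative dird v g (q + of_real t * v)) (at t)"
    if "smooth_fun D g" "q + of_real t * v \<in> ball p r" for g q v t
    by (rule has_vector_derivative_along_line, rule smooth_fun_differentiable)
      (use that assms(1) r in auto)
  \<comment> \<open>The mean value theorem is real, so real and imaginary part are treated
    separately.\<close>
  have part: "R (dird \<i> (dird 1 f) p) = R (dird 1 (dird \<i> f) p)"
    if R: "bounded_linear R" for R :: "complex \<Rightarrow> real"
  proof -
    have derR: "((\<lambda>s. R (g (q + of_real s * v))) has_real_derivative R (dird v g (q + of_real t * v))) (at t)"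
      if "smooth_fun D g" "q + of_real t * v \<in> ball p r" for g q v t
      unfolding has_real_derivative_iff_has_vector_derivative
      by (rule bounded_linear.has_vector_derivative[OF R der[OF that]])
    show ?thesis
    proof (rule mixed_partials_real[OF r(1), where v = 1 and w = \<i> and g = "\<lambda>x. R (f x)"
          and ?g1.0 = "\<lambda>x. R (dird 1 f x)" and ?g2.0 = "\<lambda>x. R (dird \<i> f x)"
          and ?g12.0 = "\<lambda>x. R (dird \<i> (dird 1 f) x)" and ?g21.0 = "\<lambda>x. R (dird 1 (dird \<i> f) x)"])
      show "isCont (\<lambda>x. R (dird \<i> (dird 1 f) x)) p" "isCont (\<lambda>x. R (dird 1 (dird \<i> f) x)) p"
        by (rule bounded_linear.isCont[OF R] cont)+
    qed (simp, simp, (rule derR, rule sm assms, assumption)+)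
  qed
  show ?thesis using part[OF bounded_linear_Re] part[OF bounded_linear_Im] by (simp add: complex_eq_iff)
qed

lemma dird_dx:
  assumes "open D" "smooth_fun D f" "p \<in> D"
  shows "dird v (dx f) p = (dird v (dird 1 f) p - \<i> * dird v (dird \<i> f) p) / 2"
    and "dird v (dxbar f) p = (dird v (dird 1 f) p + \<i> * dird v (dird \<i> f) p) / 2"
proof -
  have d: "dird 1 f differentiable at p" "dird \<i> f differentiable at p"
    using assms smooth_fun_dird smooth_fun_differentiable by blast+
  have m: "(\<lambda>x. \<i> * dird \<i> f x) differentiable at p" using d(2) by (intro differentiable_mult) auto
  have div2: "dird v (\<lambda>x. g x / 2) p = dird v g p / 2" if "g differentiable at p" for g
    using dird_divide[OF that, of "\<lambda>x. 2" v] by simp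
  have mi: "dird v (\<lambda>x. \<i> * dird \<i> f x) p = \<i> * dird v (dird \<i> f) p"
    using dird_mult[of "\<lambda>x. \<i>" p "dird \<i> f" v] d(2) by simp
  show "dird v (dx f) p = (dird v (dird 1 f) p - \<i> * dird v (dird \<i> f) p) / 2"
    unfolding dx_def[abs_def] using d m by (subst div2) (auto simp: dird_diff mi)
  show "dird v (dxbar f) p = (dird v (dird 1 f) p + \<i> * dird v (dird \<i> f) p) / 2"
    unfolding dxbar_def[abs_def] using d m by (subst div2) (auto simp: dird_add mi)
qed

lemma dx_dxbar_commute:
  assumes "open D" "smooth_fun D f" "p \<in> D"
  shows "dx (dxbar f) p = dxbar (dx f) p"
  unfolding dx_def[of "dxbar f"] dxbar_def[of "dx f"] dird_dx[OF assms] dird_commute[OF assms]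
  by (simp add: field_simps)

section \<open>Smooth functions with values in the 2 by 2 matrices\<close>

text \<open>With the size fixed in the type, sums and products are total, and the algebra of the
  Bochner formula is free of carrier conditions. The matrices of the definitions are translated by
  \<open>m2\<close> below.\<close>

type_synonym cmat = "complex^2^2"

definition madj :: "cmat \<Rightarrow> cmat" where
  "madj M = (\<chi> i j. cnj (M $ j $ i))"

definition mdet :: "cmat \<Rightarrow> complex" where
  "mdet M = M$1$1 * M$2$2 - M$1$2 * M$2$1"

text \<open>Adjugate over determinant: smoothness and continuity of the inverse follow entry by
  entry.\<close>

definition minv :: "cmat \<Rightarrow> cmat" where
  "minv M = (\<chi> i j. (if i = j then M $ (if i = 1 then 2 else 1) $ (if i = 1 then 2 else 1)
     else - (M $ i $ j)) / mdet M)"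

definition msmooth :: "complex set \<Rightarrow> (complex \<Rightarrow> cmat) \<Rightarrow> bool" where
  "msmooth D M \<longleftrightarrow> (\<forall>i j. smooth_fun D (\<lambda>x. M x $ i $ j))"

definition mdx :: "(complex \<Rightarrow> cmat) \<Rightarrow> complex \<Rightarrow> cmat" where
  "mdx M x = (\<chi> i j. dx (\<lambda>y. M y $ i $ j) x)"

definition mdxbar :: "(complex \<Rightarrow> cmat) \<Rightarrow> complex \<Rightarrow> cmat" where
  "mdxbar M x = (\<chi> i j. dxbar (\<lambda>y. M y $ i $ j) x)"

lemma cmat_eq_iff:
  "(M :: cmat) = N \<longleftrightarrow> M$1$1 = N$1$1 \<and> M$1$2 = N$1$2 \<and> M$2$1 = N$2$1 \<and> M$2$2 = N$2$2"
  by (auto simp: Finite_Cartesian_Product.vec_eq_iff forall_2)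

lemma mmult_nth: "((M :: cmat) ** N) $ i $ j = M$i$1 * N$1$j + M$i$2 * N$2$j"
  by (simp add: matrix_matrix_mult_def sum_2)

lemma mmult_assoc: "((M :: cmat) ** N) ** K = M ** (N ** K)"
  by (simp add: matrix_mul_assoc)

lemma mmult_distrib:
  fixes M N K :: cmat
  shows "M ** (N + K) = M ** N + M ** K" "(N + K) ** M = N ** M + K ** M"
    "M ** (N - K) = M ** N - M ** K" "(N - K) ** M = N ** M - K ** M"
    "M ** (- N) = - (M ** N)" "(- M) ** N = - (M ** N)" "M ** 0 = 0" "0 ** M = 0"
  by (simp_all add: cmat_eq_iff mmult_nth algebra_simps)

lemma madj_nth [simp]: "madj M $ i $ j = cnj (M $ j $ i)"
  by (simp add: madj_def)

lemma madj_simps [simp]: "madj (madj M) = M" "madj (M ** N) = madj N ** madj M"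
  "madj (M + N) = madj M + madj N" "madj (M - N) = madj M - madj N" "madj (- M) = - madj M"
  "madj 0 = 0"
  by (simp_all add: cmat_eq_iff mmult_nth)

lemma two_neq_one_type2 [simp]: "(2 :: 2) \<noteq> 1" "(1 :: 2) \<noteq> 2"
  by simp_all

lemma minv_cancel:
  assumes "mdet M \<noteq> 0"
  shows "minv M ** (M ** N) = N" "M ** (minv M ** N) = N"
proof -
  define k where "k = inverse (mdet M)"
  have k: "k * (M$1$1 * M$2$2 - M$1$2 * M$2$1) = 1" using assms by (simp add: k_def mdet_def)
  have d: "minv M $ 1 $ 1 = M$2$2 * k" "minv M $ 2 $ 2 = M$1$1 * k"
    "minv M $ 1 $ 2 = - M$1$2 * k" "minv M $ 2 $ 1 = - M$2$1 * k"
    by (simp_all add: minv_def k_def divide_inverse)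
  have "minv M ** M = Finite_Cartesian_Product.mat 1" "M ** minv M = Finite_Cartesian_Product.mat 1"
    using k by (simp_all add: cmat_eq_iff mmult_nth d Finite_Cartesian_Product.mat_def algebra_simps)
  then show "minv M ** (M ** N) = N" "M ** (minv M ** N) = N"
    by (metis matrix_mul_assoc matrix_mul_lid)+
qed

lemma mmult_left_cancel:
  assumes "mdet M \<noteq> 0" "M ** N = M ** K"
  shows "N = K"
  using minv_cancel(1)[OF assms(1)] assms(2) by metis

lemma mdet_mult: "mdet (M ** N) = mdet M * mdet N"
  by (simp add: mdet_def mmult_nth algebra_simps)

lemma msmooth_differentiable:
  "msmooth D M \<Longrightarrow> open D \<Longrightarrow> x \<in> D \<Longrightarrow> (\<lambda>x. M x $ i $ j) differentiable at x"
  unfolding msmooth_def using smooth_fun_differentiable by blast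

lemma msmooth_add: "open D \<Longrightarrow> msmooth D M \<Longrightarrow> msmooth D N \<Longrightarrow> msmooth D (\<lambda>x. M x + N x)"
  unfolding msmooth_def by (auto intro: smooth_fun_add)

lemma msmooth_diff: "open D \<Longrightarrow> msmooth D M \<Longrightarrow> msmooth D N \<Longrightarrow> msmooth D (\<lambda>x. M x - N x)"
  unfolding msmooth_def by (auto intro: smooth_fun_diff)

lemma msmooth_mult: "open D \<Longrightarrow> msmooth D M \<Longrightarrow> msmooth D N \<Longrightarrow> msmooth D (\<lambda>x. M x ** N x)"
  unfolding msmooth_def mmult_nth by (intro allI smooth_fun_add smooth_fun_mult) auto

lemma msmooth_madj: "open D \<Longrightarrow> msmooth D M \<Longrightarrow> msmooth D (\<lambda>x. madj (M x))"
  unfolding msmooth_def by (auto intro: smooth_fun_cnj)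

lemma msmooth_const: "msmooth D (\<lambda>x. M)"
  unfolding msmooth_def by (auto intro: smooth_fun_const)

lemma msmooth_mdx: "open D \<Longrightarrow> msmooth D M \<Longrightarrow> msmooth D (mdx M)"
  unfolding msmooth_def mdx_def using smooth_fun_dx by auto

lemma msmooth_cong: "msmooth D M \<Longrightarrow> open D \<Longrightarrow> (\<And>x. x \<in> D \<Longrightarrow> M x = N x) \<Longrightarrow> msmooth D N"
  unfolding msmooth_def by (metis (no_types, lifting) smooth_fun_cong)

lemma msmooth_minv:
  assumes "open D" "msmooth D M" "\<And>x. x \<in> D \<Longrightarrow> mdet (M x) \<noteq> 0"
  shows "msmooth D (\<lambda>x. minv (M x))"
proof -
  have s: "smooth_fun D (\<lambda>x. M x $ i $ j)" for i j using assms(2) by (simp add: msmooth_def)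
  have d: "smooth_fun D (\<lambda>x. mdet (M x))"
    unfolding mdet_def by (intro smooth_fun_diff smooth_fun_mult s assms(1))
  have n: "smooth_fun D (\<lambda>x. - (M x $ i $ j))" for i j
    using smooth_fun_mult[OF assms(1) smooth_fun_const[of D "-1"] s] by simp
  show ?thesis
    unfolding msmooth_def forall_2 minv_def
    by (simp only: if_True if_False simp_thms two_neq_one_type2 vec_lambda_beta)
      (intro conjI smooth_fun_divide assms d s n)
qed

lemma mdx_cong:
  assumes "open D" "x \<in> D" "\<And>y. y \<in> D \<Longrightarrow> M y = N y"
  shows "mdx M x = mdx N x" "mdxbar M x = mdxbar N x"
proof -
  have "dx (\<lambda>y. M y $ i $ j) x = dx (\<lambda>y. N y $ i $ j) x"
    "dxbar (\<lambda>y. M y $ i $ j) x = dxbar (\<lambda>y. N y $ i $ j) x" for i j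
    by (rule dx_cong[OF assms(1,2)], simp add: assms(3))+
  then show "mdx M x = mdx N x" "mdxbar M x = mdxbar N x" by (simp_all add: mdx_def mdxbar_def)
qed

context
  fixes D :: "complex set" and M N :: "complex \<Rightarrow> cmat" and x :: complex
  assumes D: "open D" "x \<in> D" and M: "msmooth D M" and N: "msmooth D N"
begin

lemma mdx_add: "mdx (\<lambda>y. M y + N y) x = mdx M x + mdx N x"
  "mdxbar (\<lambda>y. M y + N y) x = mdxbar M x + mdxbar N x"
  using msmooth_differentiable[OF M D] msmooth_differentiable[OF N D]
  by (simp_all add: cmat_eq_iff mdx_def mdxbar_def dx_add)

lemma mdx_mult: "mdx (\<lambda>y. M y ** N y) x = mdx M x ** N x + M x ** mdx N x"
  "mdxbar (\<lambda>y. M y ** N y) x = mdxbar M x ** N x + M x ** mdxbar N x"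
  using msmooth_differentiable[OF M D] msmooth_differentiable[OF N D]
  by (simp_all add: cmat_eq_iff mdx_def mdxbar_def mmult_nth dx_add dx_mult differentiable_mult algebra_simps)

end

context
  fixes D :: "complex set" and M :: "complex \<Rightarrow> cmat" and x :: complex
  assumes D: "open D" "x \<in> D" and M: "msmooth D M"
begin

lemma mdx_madj: "mdx (\<lambda>y. madj (M y)) x = madj (mdxbar M x)"
  "mdxbar (\<lambda>y. madj (M y)) x = madj (mdx M x)"
  using msmooth_differentiable[OF M D]
  by (simp_all add: cmat_eq_iff mdx_def mdxbar_def dx_cnj)

lemma mdx_mdxbar_commute: "mdxbar (mdx M) x = mdx (mdxbar M) x"
  using M dx_dxbar_commute[OF D(1) _ D(2)]
  by (simp add: cmat_eq_iff mdx_def[abs_def] mdxbar_def[abs_def] msmooth_def)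

lemma mdx_uminus: "mdx (\<lambda>y. - M y) x = - mdx M x"
  using msmooth_differentiable[OF M D] dx_mult(1)[of "\<lambda>x. -1" x "\<lambda>y. M y $ i $ j" for i j]
  by (simp add: cmat_eq_iff mdx_def)

end

section \<open>Orthogonality of eigensections at a maximum\<close>

text \<open>The operator is a quarter of the Laplacian, so each of the two pure second derivatives
  may be bounded separately. If one were positive at \<open>p\<close>, the first derivative, zero at
  \<open>p\<close>, would be positive just beyond it, and the mean value theorem would give a larger
  value of \<open>u\<close>.\<close>

lemma dxbar_dx_nonpos_at_max:
  assumes "open D" "smooth_fun D u" "p \<in> D" and max: "\<And>y. y \<in> D \<Longrightarrow> Re (u y) \<le> Re (u p)"
  shows "Re (dxbar (dx u) p) \<le> 0"
proof -
  obtain r where r: "r > 0" "ball p r \<subseteq> D" using assms open_contains_ball by blast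
  have second: "Re (dird v (dird v u) p) \<le> 0" if v: "v \<in> {1, \<i>}" for v
  proof (rule ccontr)
    assume "\<not> Re (dird v (dird v u) p) \<le> 0"
    then have pos: "Re (dird v (dird v u) p) > 0" by simp
    have nv: "norm v = 1" using v by auto
    have inD: "p + of_real t * v \<in> D" if "\<bar>t\<bar> < r" for t
    proof -
      have "dist (p + of_real t * v) p < r" using that nv by (simp add: dist_norm norm_mult)
      then show ?thesis using r(2) by (auto simp: dist_commute)
    qed
    have der: "((\<lambda>s. Re (g (p + of_real s * v))) has_real_derivative Re (dird v g (p + of_real t * v))) (at t)"
      if "smooth_fun D g" "\<bar>t\<bar> < r" for g t
      unfolding has_real_derivative_iff_has_vector_derivative
      by (rule bounded_linear.has_vector_derivative[OF bounded_linear_Re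
            has_vector_derivative_along_line[OF smooth_fun_differentiable[OF that(1) assms(1) inD[OF that(2)]]]])
    have "Re (dird v u (p + of_real 0 * v)) = 0"
      by (rule DERIV_local_max[OF der[OF assms(2), of 0] r(1)]) (use inD max r in auto)
    then have z: "Re (dird v u p) = 0" by simp
    obtain d where d: "d > 0" "\<And>h. 0 < h \<Longrightarrow> h < d \<Longrightarrow> Re (dird v u p) < Re (dird v u (p + of_real h * v))"
      using DERIV_pos_inc_right[OF der[OF smooth_fun_dird[OF assms(2) v], of 0]] pos r(1) by auto
    define h where "h = min d r / 2"
    have h: "0 < h" "h < d" "h < r" using d r by (auto simp: h_def)
    obtain z where z': "0 < z" "z < h" "Re (u (p + of_real h * v)) - Re (u (p + of_real 0 * v)) =
       (h - 0) * Re (dird v u (p + of_real z * v))"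
      using MVT2[OF h(1), of "\<lambda>s. Re (u (p + of_real s * v))" "\<lambda>s. Re (dird v u (p + of_real s * v))"]
        der[OF assms(2)] h by fastforce
    have "Re (dird v u (p + of_real z * v)) > 0" using d(2)[of z] z' h z by simp
    then have "Re (u (p + of_real h * v)) > Re (u p)"
      using z'(3) mult_pos_pos[OF h(1)] by fastforce
    then show False using max[OF inD[of h]] h by simp
  qed
  have laplace: "dxbar (dx u) p = (dird 1 (dird 1 u) p + dird \<i> (dird \<i> u) p) / 4"
    unfolding dxbar_def[of "dx u"] dird_dx[OF assms(1-3)] dird_commute[OF assms(1-3)]
    by (simp add: field_simps)
  show ?thesis unfolding laplace using second[of 1] second[of \<i>] by simp
qed

text \<open>One chart of a harmonic bundle: \<open>A\<close>, \<open>b\<close>,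
  \<open>\<phi>\<close>, \<open>\<psi>\<close> are the coefficients of dbar_E, of the (1,0)-part of
  the Chern connection, of the Higgs field and of its adjoint. The columns of \<open>P\<close> are
  holomorphic eigensections with eigenvalues on the diagonal of \<open>\<Lambda>\<close>. Positivity
  is stated for the first column of a matrix, so that it applies directly to first columns of
  matrices built from \<open>P\<close>.\<close>

locale local_harmonic_frame =
  fixes D :: "complex set" and H A \<phi> b \<psi> P :: "complex \<Rightarrow> cmat" and \<Lambda> :: cmat
  assumes D: "open D"
    and smooth: "msmooth D H" "msmooth D A" "msmooth D \<phi>" "msmooth D P"
    and herm: "\<And>x. x \<in> D \<Longrightarrow> madj (H x) = H x"
    and pos: "\<And>x T. x \<in> D \<Longrightarrow> T$1$1 \<noteq> 0 \<or> T$2$1 \<noteq> 0 \<Longrightarrow> 0 < Re ((madj T ** (H x ** T)) $ 1 $ 1)"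
    and chern: "\<And>x. x \<in> D \<Longrightarrow> mdx H x = H x ** b x + madj (A x) ** H x"
    and adj: "\<And>x. x \<in> D \<Longrightarrow> H x ** \<phi> x = madj (\<psi> x) ** H x"
    and flat: "\<And>x. x \<in> D \<Longrightarrow> mdx (\<lambda>y. A y + \<psi> y) x - mdxbar (\<lambda>y. b y + \<phi> y) x
      + (b x + \<phi> x) ** (A x + \<psi> x) - (A x + \<psi> x) ** (b x + \<phi> x) = 0"
    and integrable: "\<And>x. x \<in> D \<Longrightarrow> mdxbar \<phi> x + A x ** \<phi> x - \<phi> x ** A x = 0"
    and holomorphic: "\<And>x. x \<in> D \<Longrightarrow> mdxbar P x + A x ** P x = 0"
    and eigen: "\<And>x. x \<in> D \<Longrightarrow> \<phi> x ** P x = P x ** \<Lambda>"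
    and diagonal: "\<Lambda>$1$2 = 0" "\<Lambda>$2$1 = 0"
begin

lemma mdet_H: assumes "x \<in> D" shows "mdet (H x) \<noteq> 0"
proof
  assume z: "mdet (H x) = 0"
  have pos': "0 < Re (cnj v * (H x$1$1 * v + H x$1$2 * w) + cnj w * (H x$2$1 * v + H x$2$2 * w))"
    if "v \<noteq> 0 \<or> w \<noteq> 0" for v w
    using pos[OF assms, of "\<chi> i j. if i = 1 then v else w"] that by (simp add: mmult_nth)
  have "0 < Re (H x$1$1)" using pos'[of 1 0] by simp
  then have "H x$1$1 \<noteq> 0" by auto
  \<comment> \<open>The test vector \<open>(- H12, H11)\<close> is mapped by \<open>H\<close> to
    \<open>(0, mdet H)\<close>, which is zero here.\<close>
  then have "0 < Re (cnj (H x$1$1) * (H x$2$1 * - (H x$1$2) + H x$2$2 * H x$1$1))"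
    using pos'[of "- (H x$1$2)" "H x$1$1"] by (simp add: algebra_simps)
  moreover have "H x$2$1 * - (H x$1$2) + H x$2$2 * H x$1$1 = 0"
    using z by (simp add: mdet_def algebra_simps)
  ultimately show False by (metis less_irrefl mult_zero_right zero_complex.sel(1))
qed

text \<open>The Chern equation can be solved for \<open>b\<close> because \<open>H\<close> is
  invertible; smoothness is inherited from \<open>H\<close> and \<open>A\<close>. The same happens
  for \<open>\<psi>\<close> below.\<close>

lemma smooth_b: "msmooth D b"
proof -
  have "msmooth D (\<lambda>x. minv (H x) ** (mdx H x - madj (A x) ** H x))"
    by (intro msmooth_mult msmooth_minv msmooth_diff msmooth_mdx msmooth_madj smooth D mdet_H)
  moreover have "minv (H x) ** (mdx H x - madj (A x) ** H x) = b x" if "x \<in> D" for x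
    using chern[OF that] minv_cancel(1)[OF mdet_H[OF that]] by simp
  ultimately show ?thesis using msmooth_cong[OF _ D] by blast
qed

lemma H_psi: assumes "x \<in> D" shows "H x ** \<psi> x = madj (\<phi> x) ** H x"
  using arg_cong[OF adj[OF assms], of madj] by (simp add: herm[OF assms])

lemma smooth_psi: "msmooth D \<psi>"
proof -
  have "msmooth D (\<lambda>x. minv (H x) ** (madj (\<phi> x) ** H x))"
    by (intro msmooth_mult msmooth_minv msmooth_madj smooth D mdet_H)
  moreover have "minv (H x) ** (madj (\<phi> x) ** H x) = \<psi> x" if "x \<in> D" for x
    using H_psi[OF that] minv_cancel(1)[OF mdet_H[OF that]] by metis
  ultimately show ?thesis using msmooth_cong[OF _ D] by blast
qed

lemma mdxbar_P: "x \<in> D \<Longrightarrow> mdxbar P x = - (A x ** P x)"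
  using holomorphic by (simp add: eq_neg_iff_add_eq_0)

lemma mdxbar_H: assumes "x \<in> D" shows "mdxbar H x = madj (b x) ** H x + H x ** A x"
proof -
  have "mdxbar H x = mdxbar (\<lambda>y. madj (H y)) x"
    by (rule mdx_cong(2)[OF D assms]) (simp add: herm)
  then show ?thesis
    using mdx_madj(2)[OF D assms smooth(1)] chern[OF assms] herm[OF assms] by simp
qed

text \<open>The adjoint of the integrability condition: holomorphy of the Higgs field makes its
  adjoint parallel for the (1,0)-part of the Chern connection. It follows by differentiating
  \<open>H \<psi> = \<phi>\<^sup>* H\<close>.\<close>

lemma psi_parallel: assumes "x \<in> D" shows "mdx \<psi> x + b x ** \<psi> x = \<psi> x ** b x"
proof -
  have "mdx (\<lambda>y. H y ** \<psi> y) x = mdx (\<lambda>y. madj (\<phi> y) ** H y) x"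
    by (rule mdx_cong(1)[OF D assms]) (rule H_psi)
  then have "mdx H x ** \<psi> x + H x ** mdx \<psi> x = madj (mdxbar \<phi> x) ** H x + madj (\<phi> x) ** mdx H x"
    using mdx_mult(1)[OF D assms smooth(1) smooth_psi]
      mdx_mult(1)[OF D assms msmooth_madj[OF D smooth(3)] smooth(1)]
      mdx_madj(1)[OF D assms smooth(3)] by simp
  moreover have "mdxbar \<phi> x = \<phi> x ** A x - A x ** \<phi> x"
    using integrable[OF assms] by (simp add: algebra_simps)
  ultimately have "(H x ** b x + madj (A x) ** H x) ** \<psi> x + H x ** mdx \<psi> x =
      madj (\<phi> x ** A x - A x ** \<phi> x) ** H x + madj (\<phi> x) ** (H x ** b x + madj (A x) ** H x)"
    using chern[OF assms] by simp
  moreover have "madj (\<phi> x) ** (H x ** b x) = H x ** (\<psi> x ** b x)"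
    by (metis H_psi[OF assms] mmult_assoc)
  ultimately have "H x ** (mdx \<psi> x + b x ** \<psi> x) = H x ** (\<psi> x ** b x)"
    using H_psi[OF assms] by (simp add: mmult_distrib mmult_assoc algebra_simps)
  then show ?thesis using mmult_left_cancel[OF mdet_H[OF assms]] by blast
qed

text \<open>Hitchin's equation: once the derivatives of \<open>\<phi>\<close> and
  \<open>\<psi>\<close> are removed by holomorphy and parallelism, flatness says that the Chern
  curvature is minus the commutator of \<open>\<phi>\<close> and \<open>\<psi>\<close>.\<close>

lemma curvature_eq: assumes "x \<in> D"
  shows "mdxbar b x = mdx A x + b x ** A x - A x ** b x + \<phi> x ** \<psi> x - \<psi> x ** \<phi> x"
proof -
  have "mdx \<psi> x = \<psi> x ** b x - b x ** \<psi> x" "mdxbar \<phi> x = \<phi> x ** A x - A x ** \<phi> x"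
    using psi_parallel[OF assms] integrable[OF assms] by (simp_all add: algebra_simps)
  then have "mdx A x + (\<psi> x ** b x - b x ** \<psi> x) - (mdxbar b x + (\<phi> x ** A x - A x ** \<phi> x))
      + (b x + \<phi> x) ** (A x + \<psi> x) - (A x + \<psi> x) ** (b x + \<phi> x) = 0"
    using flat[OF assms] mdx_add(1)[OF D assms smooth(2) smooth_psi]
      mdx_add(2)[OF D assms smooth_b smooth(3)] by simp
  then show ?thesis by (simp add: mmult_distrib algebra_simps)
qed

text \<open>The Gram matrix of the eigensections: entry \<open>(i, j)\<close> is
  \<open>h(e\<^sub>j, e\<^sub>i)\<close>.\<close>

definition K :: "complex \<Rightarrow> cmat" where
  "K x = madj (P x) ** (H x ** P x)"

lemma smooth_K: "msmooth D K"
  unfolding K_def[abs_def] by (intro msmooth_mult msmooth_madj D smooth)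

text \<open>The covariant (1,0)-derivative of the eigensections.\<close>

definition T :: "complex \<Rightarrow> cmat" where
  "T x = mdx P x + b x ** P x"

lemma smooth_T: "msmooth D T"
  unfolding T_def[abs_def] by (intro msmooth_add msmooth_mult msmooth_mdx D smooth smooth_b)

text \<open>Compatibility of the Chern connection with \<open>h\<close>; the term with dbar_E of the
  other section drops out because that section is holomorphic.\<close>

lemma mdx_K: assumes "x \<in> D" shows "mdx K x = madj (P x) ** (H x ** T x)"
proof -
  have "mdx K x = madj (mdxbar P x) ** (H x ** P x) + madj (P x) ** (mdx H x ** P x + H x ** mdx P x)"
    unfolding K_def[abs_def]
    using mdx_mult(1)[OF D assms msmooth_madj[OF D smooth(4)] msmooth_mult[OF D smooth(1,4)]]
      mdx_mult(1)[OF D assms smooth(1,4)] mdx_madj(1)[OF D assms smooth(4)] by simp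
  then show ?thesis
    unfolding chern[OF assms] mdxbar_P[OF assms] T_def
    by (simp add: mmult_distrib mmult_assoc algebra_simps)
qed

text \<open>On holomorphic sections dbar_E after the (1,0)-derivative leaves only curvature, which
  Hitchin's equation turns into a commutator.\<close>

lemma mdxbar_T: assumes "x \<in> D"
  shows "mdxbar T x = (\<phi> x ** \<psi> x - \<psi> x ** \<phi> x) ** P x - A x ** T x"
proof -
  have "mdxbar T x = mdxbar (mdx P) x + (mdxbar b x ** P x + b x ** mdxbar P x)"
    unfolding T_def[abs_def]
    using mdx_add(2)[OF D assms msmooth_mdx[OF D smooth(4)] msmooth_mult[OF D smooth_b smooth(4)]]
      mdx_mult(2)[OF D assms smooth_b smooth(4)] by simp
  also have "mdxbar (mdx P) x = mdx (mdxbar P) x"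
    by (rule mdx_mdxbar_commute[OF D assms smooth(4)])
  also have "\<dots> = mdx (\<lambda>y. - (A y ** P y)) x"
    by (rule mdx_cong(1)[OF D assms]) (rule mdxbar_P)
  also have "\<dots> = - (mdx A x ** P x + A x ** mdx P x)"
    using mdx_uminus[OF D assms msmooth_mult[OF D smooth(2,4)]]
      mdx_mult(1)[OF D assms smooth(2,4)] by simp
  finally show ?thesis
    unfolding curvature_eq[OF assms] mdxbar_P[OF assms] T_def
    by (simp add: mmult_distrib mmult_assoc algebra_simps)
qed

text \<open>The Bochner formula: the squared norm of the covariant derivative plus the commutator
  paired with the sections.\<close>

lemma mdxbar_mdx_K: assumes "x \<in> D"
  shows "mdxbar (mdx K) x = madj (T x) ** (H x ** T x)
    + madj (P x) ** (H x ** ((\<phi> x ** \<psi> x - \<psi> x ** \<phi> x) ** P x))"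
proof -
  have "mdxbar (mdx K) x = mdxbar (\<lambda>x. madj (P x) ** (H x ** T x)) x"
    by (rule mdx_cong(2)[OF D assms]) (rule mdx_K)
  also have "\<dots> = madj (mdx P x) ** (H x ** T x) + madj (P x) ** (mdxbar H x ** T x + H x ** mdxbar T x)"
    using mdx_mult(2)[OF D assms msmooth_madj[OF D smooth(4)] msmooth_mult[OF D smooth(1) smooth_T]]
      mdx_mult(2)[OF D assms smooth(1) smooth_T] mdx_madj(2)[OF D assms smooth(4)] by simp
  finally show ?thesis
    unfolding mdxbar_H[OF assms] mdxbar_T[OF assms]
    by (simp add: T_def mmult_distrib mmult_assoc algebra_simps)
qed

text \<open>For an eigensection \<open>e\<close> with eigenvalue \<open>l\<close>, the adjoint
  relation gives \<open>h(\<psi> e, e) = cnj l * h(e, e)\<close>. Hence the commutator term equals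
  the squared norm of \<open>\<psi> e\<close>, minus \<open>|l|^2\<close> times that of
  \<open>e\<close>, which is the squared norm of \<open>\<psi> e - cnj l e\<close>. At a maximum it
  vanishes, so \<open>\<psi> e = cnj l e\<close>. Pairing \<open>\<phi> e' = l' e'\<close> with
  \<open>e\<close> then gives \<open>l' h(e', e) = l h(e', e)\<close>.\<close>

lemma eigensections_orthogonal_at_max:
  assumes p: "p \<in> D" and max: "\<And>y. y \<in> D \<Longrightarrow> Re (K y $ 1 $ 1) \<le> Re (K p $ 1 $ 1)"
    and distinct: "\<Lambda>$1$1 \<noteq> \<Lambda>$2$2"
  shows "K p $ 1 $ 2 = 0"
proof -
  have "Re (dxbar (dx (\<lambda>y. K y $ 1 $ 1)) p) \<le> 0"
    by (rule dxbar_dx_nonpos_at_max[OF D _ p], use smooth_K in \<open>simp add: msmooth_def\<close>) (rule max)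
  then have le: "Re (mdxbar (mdx K) p $ 1 $ 1) \<le> 0"
    by (simp add: mdxbar_def mdx_def)
  \<comment> \<open>Column by column, the failure of an eigensection to be an eigenvector of the
    adjoint with the conjugate eigenvalue.\<close>
  define W where "W = \<psi> p ** P p - P p ** madj \<Lambda>"
  have psiP: "madj (\<psi> p ** P p) ** (H p ** P p) = K p ** \<Lambda>"
  proof -
    have "madj (P p) ** ((madj (\<psi> p) ** H p) ** P p) = madj (P p) ** (H p ** (\<phi> p ** P p))"
      by (simp add: adj[OF p, symmetric] mmult_assoc)
    also have "\<dots> = K p ** \<Lambda>" by (simp add: eigen[OF p] K_def mmult_assoc)
    finally show ?thesis by (simp add: mmult_assoc)
  qed
  have KL: "madj (P p) ** (H p ** (\<psi> p ** P p)) = madj \<Lambda> ** K p"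
    using arg_cong[OF psiP, of madj] by (simp add: K_def herm[OF p] mmult_assoc)
  have e1: "madj (P p) ** (H p ** (\<phi> p ** (\<psi> p ** P p))) = madj (\<psi> p ** P p) ** (H p ** (\<psi> p ** P p))"
  proof -
    have "madj (P p) ** ((H p ** \<phi> p) ** (\<psi> p ** P p)) = madj (\<psi> p ** P p) ** (H p ** (\<psi> p ** P p))"
      unfolding adj[OF p] by (simp add: mmult_assoc)
    then show ?thesis by (simp add: mmult_assoc)
  qed
  have e2: "madj (P p) ** (H p ** (\<psi> p ** (\<phi> p ** P p))) = madj \<Lambda> ** (K p ** \<Lambda>)"
    unfolding eigen[OF p] using arg_cong[OF KL, of "\<lambda>M. M ** \<Lambda>"] by (simp add: mmult_assoc)
  have WW: "madj W ** (H p ** W) = madj (\<psi> p ** P p) ** (H p ** (\<psi> p ** P p))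
      - K p ** (\<Lambda> ** madj \<Lambda>) - \<Lambda> ** (madj \<Lambda> ** K p) + \<Lambda> ** (K p ** madj \<Lambda>)"
  proof -
    have "madj (\<psi> p ** P p) ** (H p ** (P p ** madj \<Lambda>)) = K p ** (\<Lambda> ** madj \<Lambda>)"
      using arg_cong[OF psiP, of "\<lambda>M. M ** madj \<Lambda>"] by (simp add: mmult_assoc)
    moreover have "madj (P p ** madj \<Lambda>) ** (H p ** (\<psi> p ** P p)) = \<Lambda> ** (madj \<Lambda> ** K p)"
      by (simp add: mmult_assoc KL)
    moreover have "madj (P p ** madj \<Lambda>) ** (H p ** (P p ** madj \<Lambda>)) = \<Lambda> ** (K p ** madj \<Lambda>)"
      by (simp add: K_def mmult_assoc)
    ultimately show ?thesis unfolding W_def by (simp add: mmult_distrib mmult_assoc algebra_simps)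
  qed
  have "mdxbar (mdx K) p = madj (T p) ** (H p ** T p)
      + (madj (\<psi> p ** P p) ** (H p ** (\<psi> p ** P p)) - madj \<Lambda> ** (K p ** \<Lambda>))"
    unfolding mdxbar_mdx_K[OF p] using e1 e2 by (simp add: mmult_distrib mmult_assoc)
  also have "\<dots> = madj (T p) ** (H p ** T p) + madj W ** (H p ** W) + (K p ** (\<Lambda> ** madj \<Lambda>)
      + \<Lambda> ** (madj \<Lambda> ** K p) - \<Lambda> ** (K p ** madj \<Lambda>) - madj \<Lambda> ** (K p ** \<Lambda>))"
    unfolding WW by (simp add: algebra_simps)
  \<comment> \<open>On the entry \<open>(1, 1)\<close> the four terms with \<open>\<Lambda>\<close>
    are all \<open>|l|^2 * K11\<close>, two with each sign, since \<open>\<Lambda>\<close> is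
    diagonal.\<close>
  finally have "mdxbar (mdx K) p $ 1 $ 1
      = (madj (T p) ** (H p ** T p)) $ 1 $ 1 + (madj W ** (H p ** W)) $ 1 $ 1"
    using diagonal by (simp add: mmult_nth[of "K p"] mmult_nth[of \<Lambda>] mmult_nth[of "madj \<Lambda>"])
  moreover have "0 \<le> Re ((madj (T p) ** (H p ** T p)) $ 1 $ 1)"
    using pos[OF p, of "T p"] by (cases "T p$1$1 \<noteq> 0 \<or> T p$2$1 \<noteq> 0") (auto simp: mmult_nth)
  ultimately have "Re ((madj W ** (H p ** W)) $ 1 $ 1) \<le> 0" using le by simp
  then have "W$1$1 = 0" "W$2$1 = 0" using pos[OF p, of W] by force+
  then have "(\<psi> p ** P p)$i$1 = (P p ** madj \<Lambda>)$i$1" for i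
    using exhaust_2[of i] by (auto simp: W_def)
  then have "(madj (\<psi> p ** P p) ** (H p ** P p)) $ 1 $ 2 = (madj (P p ** madj \<Lambda>) ** (H p ** P p)) $ 1 $ 2"
    unfolding mmult_nth[of "madj _"] madj_nth by simp
  then have "(K p ** \<Lambda>) $ 1 $ 2 = (\<Lambda> ** K p) $ 1 $ 2"
    unfolding psiP by (simp add: K_def mmult_assoc)
  then show ?thesis using diagonal distinct by (simp add: mmult_nth)
qed

end

section \<open>Families of rank two in terms of 2 by 2 matrices\<close>

text \<open>Indices of type \<open>2\<close> are written \<open>1\<close> and \<open>2\<close>,
  while entries of \<open>complex mat\<close> are counted from \<open>0\<close>.\<close>

definition idx :: "2 \<Rightarrow> nat" where
  "idx i = (if i = 1 then 0 else 1)"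

lemma idx_simps [simp]: "idx 1 = 0" "idx 2 = 1"
  by (simp_all add: idx_def)

definition m2 :: "complex mat \<Rightarrow> cmat" where
  "m2 A = (\<chi> i j. A $$ (idx i, idx j))"

lemma m2_nth [simp]: "m2 A $ i $ j = A $$ (idx i, idx j)"
  by (simp add: m2_def)

lemma idx_less [simp]: "idx i < 2" "idx i < Suc (Suc 0)"
  by (simp_all add: idx_def)

lemma mat_adjoint_index:
  assumes "A \<in> carrier_mat m n" "i < n" "j < m"
  shows "mat_adjoint A $$ (i, j) = cnj (A $$ (j, i))"
  using assms by (simp add: mat_adjoint_def mat_of_rows_def)

lemma mat_adjoint_carrier: "A \<in> carrier_mat m n \<Longrightarrow> mat_adjoint A \<in> carrier_mat n m"
  by (rule carrier_matI) (auto simp: mat_adjoint_def)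

lemma mat_dx_carrier:
  assumes "M x \<in> carrier_mat m n"
  shows "mat_dx M x \<in> carrier_mat m n" "mat_dxbar M x \<in> carrier_mat m n"
  using assms by (auto simp: mat_dx_def mat_dxbar_def)

lemma m2_simps:
  assumes "A \<in> carrier_mat 2 2" "B \<in> carrier_mat 2 2"
  shows "m2 (A * B) = m2 A ** m2 B" "m2 (A + B) = m2 A + m2 B" "m2 (A - B) = m2 A - m2 B"
    "m2 (mat_adjoint A) = madj (m2 A)"
  using assms mat_adjoint_index[OF assms(1)]
  by (simp_all add: cmat_eq_iff mmult_nth scalar_prod_def numeral_2_eq_2)

lemma m2_add_commutator:
  assumes "M \<in> carrier_mat 2 2" "A \<in> carrier_mat 2 2" "B \<in> carrier_mat 2 2"
  shows "m2 (M + A * B - B * A) = m2 M + m2 A ** m2 B - m2 B ** m2 A"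
proof -
  have c: "A * B \<in> carrier_mat 2 2" "B * A \<in> carrier_mat 2 2" "M + A * B \<in> carrier_mat 2 2"
    using assms by auto
  show ?thesis
    using m2_simps(3)[OF c(3,2)] m2_simps(2)[OF assms(1) c(1)] m2_simps(1)[OF assms(2,3)]
      m2_simps(1)[OF assms(3,2)] by simp
qed

lemma m2_zero [simp]: "m2 (0\<^sub>m 2 2) = 0"
  by (simp add: cmat_eq_iff)

lemma m2_one: "m2 (1\<^sub>m 2) ** M = (M :: cmat)"
  by (simp add: cmat_eq_iff mmult_nth)

lemma m2_mat_dx:
  assumes "M x \<in> carrier_mat 2 2"
  shows "m2 (mat_dx M x) = mdx (\<lambda>y. m2 (M y)) x" "m2 (mat_dxbar M x) = mdxbar (\<lambda>y. m2 (M y)) x"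
  using assms by (simp_all add: cmat_eq_iff mat_dx_def mat_dxbar_def mdx_def mdxbar_def)

lemma msmooth_m2:
  assumes "smooth_mat L D 2 2 M"
  shows "msmooth D (\<lambda>x. m2 (M x))"
  using assms unfolding smooth_mat_def msmooth_def m2_nth by auto

lemma m2_pos:
  assumes "A \<in> carrier_mat 2 2"
    and pos: "\<forall>v \<in> carrier_vec 2. v \<noteq> 0\<^sub>v 2 \<longrightarrow> 0 < Re ((A *\<^sub>v v) \<bullet>c v)"
    and T: "T$1$1 \<noteq> 0 \<or> T$2$1 \<noteq> 0"
  shows "0 < Re ((madj T ** (m2 A ** T)) $ 1 $ 1)"
proof -
  define v where "v = Matrix.vec 2 (\<lambda>i. if i = 0 then T$1$1 else T$2$1)"
  have v: "v \<in> carrier_vec 2" "vec_index v 0 = T$1$1" "vec_index v (Suc 0) = T$2$1" by (simp_all add: v_def)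
  then have "v \<noteq> 0\<^sub>v 2" using T by auto
  then have "0 < Re ((A *\<^sub>v v) \<bullet>c v)" using pos v by blast
  also have "(A *\<^sub>v v) \<bullet>c v = (madj T ** (m2 A ** T)) $ 1 $ 1"
    using assms(1) v by (simp add: mmult_nth scalar_prod_def numeral_2_eq_2 algebra_simps)
  finally show ?thesis .
qed

text \<open>If the determinant vanishes, the columns of the adjugate lie in the kernel. Injectivity
  makes them zero, so \<open>A\<close> is zero and its kernel is not trivial.\<close>

lemma mdet_m2_if_inj:
  assumes A: "A \<in> carrier_mat 2 2" and inj: "fibre_kernel A = {0\<^sub>v 2}"
  shows "mdet (m2 A) \<noteq> 0"
proof
  assume "mdet (m2 A) = 0"
  then have z: "A $$ (0,0) * A $$ (1,1) - A $$ (0,1) * A $$ (1,0) = 0" by (simp add: mdet_def)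
  have ker: "a = 0 \<and> b = 0" if "A $$ (0,0) * a + A $$ (0,1) * b = 0" "A $$ (1,0) * a + A $$ (1,1) * b = 0" for a b
  proof -
    define v where "v = Matrix.vec 2 (\<lambda>i. if i = 0 then a else b)"
    have v: "v \<in> carrier_vec 2" "vec_index v 0 = a" "vec_index v (Suc 0) = b" by (simp_all add: v_def)
    have "A *\<^sub>v v = 0\<^sub>v 2"
      using A v that by (intro eq_vecI) (auto simp: scalar_prod_def numeral_2_eq_2 less_Suc_eq)
    then have "v \<in> fibre_kernel A" using A v by (auto simp: fibre_kernel_def)
    then have "v = 0\<^sub>v 2" using inj by simp
    then show ?thesis using v by auto
  qed
  have "A $$ (0,0) = 0 \<and> A $$ (0,1) = 0"
    using ker[of "- A $$ (0,1)" "A $$ (0,0)"] z by (simp add: algebra_simps)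
  moreover have "A $$ (1,0) = 0 \<and> A $$ (1,1) = 0"
    using ker[of "A $$ (1,1)" "- A $$ (1,0)"] z by (simp add: algebra_simps)
  ultimately show False using ker[of 1 0] by simp
qed

section \<open>Reading off the data of a family chart by chart\<close>

lemma slice_simps [simp]:
  "hrank (slice G u) = frank G"
  "hdom (slice G u) c = (if u \<in> fbase G (fst c) then fxdom G c else {})"
  "htrans (slice G u) c c' = ftrans G c c' u"
  "hdbar (slice G u) c = fdbar G c u"
  "hphi (slice G u) c = fphi G c u"
  by (simp_all add: slice_def)

lemma is_higgs_familyD:
  assumes "is_higgs_family L R V G"
  shows "\<forall>i. open (fbase G i)" "(\<Union>i. fbase G i) = V" "\<forall>i. (\<Union>a. fxdom G (i, a)) = UNIV"
    "\<forall>u\<in>V. is_higgs_bundle L (slice G u)"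
  using assms unfolding is_higgs_family_def by - (elim conjE; assumption)+

lemma is_higgs_bundleD:
  assumes "is_higgs_bundle L E"
  shows "\<forall>c. invariant_open L (hdom E c)"
    "\<forall>c c'. smooth_mat L (hdom E c \<inter> hdom E c') (hrank E) (hrank E) (htrans E c c')"
    "\<forall>c. \<forall>x\<in>hdom E c. htrans E c c x = 1\<^sub>m (hrank E)"
    "\<forall>c. smooth_mat L (hdom E c) (hrank E) (hrank E) (hdbar E c) \<and>
          smooth_mat L (hdom E c) (hrank E) (hrank E) (hphi E c)"
    "\<forall>c. \<forall>x\<in>hdom E c.
        mat_dxbar (hphi E c) x + hdbar E c x * hphi E c x - hphi E c x * hdbar E c x
          = 0\<^sub>m (hrank E) (hrank E)"
  using assms unfolding is_higgs_bundle_def is_vector_bundle_def by - (elim conjE; assumption)+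

context
  fixes L R V G
  assumes fam: "is_higgs_family L R V G"
begin

lemma family_base: "open (fbase G i)" "u \<in> fbase G i \<Longrightarrow> u \<in> V"
  using is_higgs_familyD(1,2)[OF fam] by auto

lemma family_slice: "u \<in> V \<Longrightarrow> is_higgs_bundle L (slice G u)"
  using is_higgs_familyD(4)[OF fam] by auto

lemma family_chart_exists:
  assumes "u \<in> V"
  obtains c where "u \<in> fbase G (fst c)" "x \<in> fxdom G c"
proof -
  obtain i where "u \<in> fbase G i" using is_higgs_familyD(2)[OF fam] assms by blast
  moreover obtain a where "x \<in> fxdom G (i, a)" using is_higgs_familyD(3)[OF fam] by blast
  ultimately show ?thesis using that[of "(i, a)"] by simp
qed

context
  fixes u and c :: chart
  assumes uc: "u \<in> fbase G (fst c)"
begin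

lemma family_xdom: "open (fxdom G c)" "x \<in> fxdom G c \<Longrightarrow> w \<in> L \<Longrightarrow> x + w \<in> fxdom G c"
  using is_higgs_bundleD(1)[OF family_slice[OF family_base(2)[OF uc]], rule_format, of c] uc
  unfolding invariant_open_def by auto

lemma family_operators:
  "smooth_mat L (fxdom G c) (frank G) (frank G) (fdbar G c u)"
  "smooth_mat L (fxdom G c) (frank G) (frank G) (fphi G c u)"
  using is_higgs_bundleD(4)[OF family_slice[OF family_base(2)[OF uc]], rule_format, of c] uc
  by simp_all

lemma family_integrable:
  assumes "x \<in> fxdom G c"
  shows "mat_dxbar (fphi G c u) x + fdbar G c u x * fphi G c u x - fphi G c u x * fdbar G c u x
    = 0\<^sub>m (frank G) (frank G)"
  using is_higgs_bundleD(5)[OF family_slice[OF family_base(2)[OF uc]], rule_format, of x c] uc assms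
  by simp

lemma family_trans_refl: "x \<in> fxdom G c \<Longrightarrow> ftrans G c c u x = 1\<^sub>m (frank G)"
  using is_higgs_bundleD(3)[OF family_slice[OF family_base(2)[OF uc]], rule_format, of x c] uc
  by simp

lemma family_trans:
  assumes "u \<in> fbase G (fst c')"
  shows "smooth_mat L (fxdom G c \<inter> fxdom G c') (frank G) (frank G) (ftrans G c c' u)"
  using is_higgs_bundleD(2)[OF family_slice[OF family_base(2)[OF uc]], rule_format, of c c'] uc assms
  by simp

end

end

text \<open>With the empty list of derivatives, convergence of the slices is uniform on a closed
  ball around \<open>x\<close>. Together with continuity of the single slice \<open>g u\<close> this
  gives continuity in the pair.\<close>

lemma cont_smooth_jointly_continuous:
  assumes "cont_smooth B D g" "open D"
  shows "continuous_on (B \<times> D) (\<lambda>(u, x). g u x)"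
  unfolding continuous_on_iff
proof (intro ballI allI impI)
  fix p and e :: real assume p: "p \<in> B \<times> D" and e: "0 < e"
  obtain u x where ux: "p = (u, x)" "u \<in> B" "x \<in> D" using p by auto
  obtain r where r: "r > 0" "cball x r \<subseteq> D" using assms(2) ux open_contains_cball by blast
  have "smooth_fun D (g u)" "smooth_tendsto D g (g u) (at u within B)"
    using assms(1) ux unfolding cont_smooth_def by auto
  then have "uniform_limit (cball x r) (\<lambda>t. iter_dird [] (g t)) (iter_dird [] (g u)) (at u within B)"
    using r unfolding smooth_tendsto_def by (metis compact_cball empty_subsetI list.set(1))
  then have "\<forall>\<^sub>F t in at u within B. \<forall>y\<in>cball x r. dist (g t y) (g u y) < e / 2"
    unfolding uniform_limit_iff iter_dird.simps using half_gt_zero[OF e] by blast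
  then obtain d1 where d1: "d1 > 0" "\<And>t y. t \<in> B \<Longrightarrow> t \<noteq> u \<Longrightarrow> dist t u < d1 \<Longrightarrow> y \<in> cball x r \<Longrightarrow>
      dist (g t y) (g u y) < e / 2"
    unfolding eventually_at by blast
  have "continuous_on D (g u)" using \<open>smooth_fun D (g u)\<close> by (rule smooth_fun_continuous_on)
  then obtain d2 where d2: "d2 > 0" "\<And>y. y \<in> D \<Longrightarrow> dist y x < d2 \<Longrightarrow> dist (g u y) (g u x) < e / 2"
    using ux e unfolding continuous_on_iff by (metis half_gt_zero)
  define d where "d = min r (min d1 d2)"
  have "dist (case q of (u, x) \<Rightarrow> g u x) (case p of (u, x) \<Rightarrow> g u x) < e"
    if q: "q \<in> B \<times> D" "dist q p < d" for q
  proof -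
    obtain t y where ty: "q = (t, y)" "t \<in> B" "y \<in> D" using q by auto
    have "dist t u < d" "dist y x < d"
      using q(2) dist_fst_le[of q p] dist_snd_le[of q p] by (auto simp: ty ux)
    then have near: "dist t u < d1" "y \<in> cball x r" "dist y x < d2" by (auto simp: d_def dist_commute)
    have "dist (g t y) (g u y) < e / 2"
      using d1(2)[OF ty(2) _ near(1,2)] e by (cases "t = u") auto
    moreover have "dist (g u y) (g u x) < e / 2" using d2(2)[OF ty(3) near(3)] .
    ultimately show ?thesis using dist_triangle[of "g t y" "g u x" "g u y"]
      by (simp add: ty ux)
  qed
  then show "\<exists>d>0. \<forall>x'\<in>B \<times> D. dist x' p < d \<longrightarrow> dist (case x' of (u, x) \<Rightarrow> g u x) (case p of (u, x) \<Rightarrow> g u x) < e"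
    using r d1 d2 by (intro exI[of _ d]) (auto simp: d_def)
qed

lemma Cd_smooth_imp_cont_smooth: "Cd_smooth d B D g \<Longrightarrow> cont_smooth B D g"
  unfolding Cd_smooth_def by (metis Ck_smooth.simps(1) enat_0 zero_le)

definition Theta :: "complex \<Rightarrow> complex \<Rightarrow> cmat" where
  "Theta \<alpha> u = (\<chi> i j. if i = j then 0 else if i = 1 then \<alpha> * u else \<alpha> * u\<^sup>2)"

text \<open>An isomorphism onto \<open>G\<close> from the family of Higgs fields \<open>Theta \<alpha> u dx\<close> on the trivial bundle; it is
  smooth on slices, but only continuous in the parameter.\<close>

definition theta_frame ::
    "complex set \<Rightarrow> complex \<Rightarrow> higgs_family \<Rightarrow> (chart \<Rightarrow> complex \<Rightarrow> complex \<Rightarrow> cmat) \<Rightarrow> bool" where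
  "theta_frame L \<alpha> G f \<longleftrightarrow> frank G = 2 \<and>
     (\<forall>c. \<forall>u \<in> fbase G (fst c). periodic_on L (fxdom G c) (f c u) \<and> msmooth (fxdom G c) (f c u) \<and>
        (\<forall>x \<in> fxdom G c. mdet (f c u x) \<noteq> 0 \<and>
           mdxbar (f c u) x + m2 (fdbar G c u x) ** f c u x = 0 \<and>
           m2 (fphi G c u x) ** f c u x = f c u x ** Theta \<alpha> u)) \<and>
     (\<forall>c c'. \<forall>u \<in> fbase G (fst c) \<inter> fbase G (fst c'). \<forall>x \<in> fxdom G c \<inter> fxdom G c'.
        m2 (ftrans G c c' u x) ** f c' u x = f c u x) \<and>
     (\<forall>c i j. continuous_on (fbase G (fst c) \<times> fxdom G c) (\<lambda>(u, x). f c u x $ i $ j))"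

section \<open>A continuous harmonic metric does not exist\<close>

text \<open>As \<open>w2 / w1\<close> is not real, every point has real coordinates with respect to
  \<open>w1\<close> and \<open>w2\<close>. Taking their fractional parts is a translation by a
  lattice vector, so the maximum over the compact parallelogram is global.\<close>

lemma periodic_attains_max:
  fixes k :: "complex \<Rightarrow> real"
  assumes "lattice_basis L w1 w2" and cont: "continuous_on UNIV k" and per: "periodic_on L UNIV k"
  obtains p where "p \<in> (\<lambda>(s, t). of_real s * w1 + of_real t * w2) ` ({0..1} \<times> {0..1})"
    "\<And>y. k y \<le> k p"
proof -
  define F where "F = (\<lambda>(s :: real, t :: real). of_real s * w1 + of_real t * w2)"
  have "compact (F ` ({0..1} \<times> {0..1}))"
    unfolding F_def by (intro compact_continuous_image compact_Times)
      (auto simp: case_prod_beta intro!: continuous_intros)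
  moreover have "F ` ({0..1} \<times> {0..1}) \<noteq> {}" by auto
  ultimately obtain p where p: "p \<in> F ` ({0..1} \<times> {0..1})" "\<forall>y \<in> F ` ({0..1} \<times> {0..1}). k y \<le> k p"
    using continuous_attains_sup[of "F ` ({0..1} \<times> {0..1})" k] continuous_on_subset[OF cont] by blast
  have "k y \<le> k p" for y
  proof -
    have im: "Im (w2 / w1) \<noteq> 0" and L: "L = {of_int m * w1 + of_int n * w2 | m n. True}"
      using assms(1) unfolding lattice_basis_def by auto
    have w1: "w1 \<noteq> 0" using im by auto
    define \<tau> where "\<tau> = w2 / w1"
    have "Im \<tau> \<noteq> 0" using im by (simp add: \<tau>_def)
    define Y where "Y = y / w1"
    define t where "t = Im Y / Im \<tau>"
    define s where "s = Re Y - t * Re \<tau>"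
    have "Y = of_real s + of_real t * \<tau>"
      using \<open>Im \<tau> \<noteq> 0\<close> by (simp add: complex_eq_iff s_def t_def)
    then have "y / w1 = of_real s + of_real t * (w2 / w1)" by (simp add: Y_def \<tau>_def)
    then have y: "y = of_real s * w1 + of_real t * w2"
      using w1 by (simp add: field_simps)
    have "of_int \<lfloor>s\<rfloor> * w1 + of_int \<lfloor>t\<rfloor> * w2 \<in> L" using L by blast
    then have "k (F (frac s, frac t) + (of_int \<lfloor>s\<rfloor> * w1 + of_int \<lfloor>t\<rfloor> * w2)) = k (F (frac s, frac t))"
      using per unfolding periodic_on_def by blast
    moreover have "F (frac s, frac t) + (of_int \<lfloor>s\<rfloor> * w1 + of_int \<lfloor>t\<rfloor> * w2) = y"
      unfolding y F_def by (simp add: frac_def algebra_simps)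
    moreover have "F (frac s, frac t) \<in> F ` ({0..1} \<times> {0..1})"
      using frac_ge_0 frac_lt_1 by (intro imageI) (auto intro: less_imp_le)
    ultimately show ?thesis using p(2) by metis
  qed
  then show ?thesis using that p(1) unfolding F_def by blast
qed

lemma theta_frameD:
  assumes "theta_frame L \<alpha> G f"
  shows "frank G = 2"
    and "\<And>c u. u \<in> fbase G (fst c) \<Longrightarrow> periodic_on L (fxdom G c) (f c u)"
    and "\<And>c u. u \<in> fbase G (fst c) \<Longrightarrow> msmooth (fxdom G c) (f c u)"
    and "\<And>c u x. u \<in> fbase G (fst c) \<Longrightarrow> x \<in> fxdom G c \<Longrightarrow> mdet (f c u x) \<noteq> 0"
    and "\<And>c u x. u \<in> fbase G (fst c) \<Longrightarrow> x \<in> fxdom G c \<Longrightarrow>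
      mdxbar (f c u) x + m2 (fdbar G c u x) ** f c u x = 0"
    and "\<And>c u x. u \<in> fbase G (fst c) \<Longrightarrow> x \<in> fxdom G c \<Longrightarrow>
      m2 (fphi G c u x) ** f c u x = f c u x ** Theta \<alpha> u"
    and "\<And>c c' u x. u \<in> fbase G (fst c) \<Longrightarrow> u \<in> fbase G (fst c') \<Longrightarrow> x \<in> fxdom G c \<Longrightarrow>
      x \<in> fxdom G c' \<Longrightarrow> m2 (ftrans G c c' u x) ** f c' u x = f c u x"
    and "\<And>c i j. continuous_on (fbase G (fst c) \<times> fxdom G c) (\<lambda>(u, x). f c u x $ i $ j)"
  using assms unfolding theta_frame_def by blast+

lemma hermitian_metricD:
  assumes "hermitian_metric L E H"
  shows "\<forall>c. smooth_mat L (hdom E c) (hrank E) (hrank E) (H c)"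
    "\<forall>c. \<forall>x\<in>hdom E c. mat_adjoint (H c x) = H c x"
    "\<forall>c. \<forall>x\<in>hdom E c. \<forall>v \<in> carrier_vec (hrank E). v \<noteq> 0\<^sub>v (hrank E) \<longrightarrow>
        0 < Re ((H c x *\<^sub>v v) \<bullet>c v)"
    "\<forall>c c'. \<forall>x \<in> hdom E c \<inter> hdom E c'.
        mat_adjoint (htrans E c c' x) * H c x * htrans E c c' x = H c' x"
  using assms unfolding hermitian_metric_def by - (elim conjE; assumption)+

lemma smooth_mat_carrier: "smooth_mat L D m n M \<Longrightarrow> x \<in> D \<Longrightarrow> M x \<in> carrier_mat m n"
  unfolding smooth_mat_def by blast

lemma smooth_mat_periodic: "smooth_mat L D m n M \<Longrightarrow> periodic_on L D M"
  unfolding smooth_mat_def by blast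

lemma mdx_const [simp]: "mdx (\<lambda>y. M) x = 0" "mdxbar (\<lambda>y. M) x = 0"
  by (simp_all add: cmat_eq_iff mdx_def mdxbar_def)

lemma m2_curvature:
  assumes "open D" "x \<in> D"
    and "\<And>y. y \<in> D \<Longrightarrow> b y \<in> carrier_mat 2 2" "\<And>y. y \<in> D \<Longrightarrow> \<phi> y \<in> carrier_mat 2 2"
      "\<And>y. y \<in> D \<Longrightarrow> A y \<in> carrier_mat 2 2" "\<And>y. y \<in> D \<Longrightarrow> \<psi> y \<in> carrier_mat 2 2"
  shows "m2 (curvature (\<lambda>y. b y + \<phi> y) (\<lambda>y. A y + \<psi> y) x)
    = mdx (\<lambda>y. m2 (A y) + m2 (\<psi> y)) x - mdxbar (\<lambda>y. m2 (b y) + m2 (\<phi> y)) x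
      + (m2 (b x) + m2 (\<phi> x)) ** (m2 (A x) + m2 (\<psi> x)) - (m2 (A x) + m2 (\<psi> x)) ** (m2 (b x) + m2 (\<phi> x))"
proof -
  have P: "b x + \<phi> x \<in> carrier_mat 2 2" "A x + \<psi> x \<in> carrier_mat 2 2" using assms by auto
  have dim: "mat_dx (\<lambda>y. A y + \<psi> y) x \<in> carrier_mat 2 2" "mat_dxbar (\<lambda>y. b y + \<phi> y) x \<in> carrier_mat 2 2"
    by (rule mat_dx_carrier, rule P)+
  have e1: "mdx (\<lambda>y. m2 (A y + \<psi> y)) x = mdx (\<lambda>y. m2 (A y) + m2 (\<psi> y)) x"
    by (rule mdx_cong(1)[OF assms(1,2)]) (use assms in \<open>simp add: m2_simps\<close>)
  have e2: "mdxbar (\<lambda>y. m2 (b y + \<phi> y)) x = mdxbar (\<lambda>y. m2 (b y) + m2 (\<phi> y)) x"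
    by (rule mdx_cong(2)[OF assms(1,2)]) (use assms in \<open>simp add: m2_simps\<close>)
  have s: "m2 (b x + \<phi> x) = m2 (b x) + m2 (\<phi> x)" "m2 (A x + \<psi> x) = m2 (A x) + m2 (\<psi> x)"
    using assms by (simp_all add: m2_simps)
  have "m2 (curvature (\<lambda>y. b y + \<phi> y) (\<lambda>y. A y + \<psi> y) x)
      = m2 (mat_dx (\<lambda>y. A y + \<psi> y) x) - m2 (mat_dxbar (\<lambda>y. b y + \<phi> y) x)
        + m2 (b x + \<phi> x) ** m2 (A x + \<psi> x) - m2 (A x + \<psi> x) ** m2 (b x + \<phi> x)"
    unfolding curvature_def using m2_add_commutator[OF _ P] m2_simps(3)[OF dim] minus_carrier_mat[OF dim(2)]
    by simp
  then show ?thesis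
    unfolding m2_mat_dx(1)[of "\<lambda>y. A y + \<psi> y", OF P(2)] m2_mat_dx(2)[of "\<lambda>y. b y + \<phi> y", OF P(1)] e1 e2 s .
qed

text \<open>\<open>S\<close> is a constant matrix of eigenvectors of
  \<open>Theta \<alpha> u\<close>. The frame \<open>f\<close> is holomorphic and intertwines the
  Higgs fields, so the columns of \<open>f ** S\<close> are holomorphic eigensections.\<close>

lemma local_harmonic_frame_of_metric:
  assumes fam: "is_higgs_family L R V G" and fr: "theta_frame L \<alpha> G f"
    and harm: "harmonic_metric L (slice G u) H" and uc: "u \<in> fbase G (fst c)"
    and S: "Theta \<alpha> u ** S = S ** \<Lambda>" and \<Lambda>: "\<Lambda>$1$2 = 0" "\<Lambda>$2$1 = 0"
  shows "\<exists>b \<psi>. local_harmonic_frame (fxdom G c) (\<lambda>x. m2 (H c x)) (\<lambda>x. m2 (fdbar G c u x))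
    (\<lambda>x. m2 (fphi G c u x)) b \<psi> (\<lambda>x. f c u x ** S) \<Lambda>"
proof -
  note frD = theta_frameD[OF fr]
  obtain b \<psi> where herm: "hermitian_metric L (slice G u) H" and b: "chern_10 (slice G u) H b"
    and \<psi>: "higgs_adjoint (slice G u) H \<psi>"
    and flat: "\<forall>c. \<forall>x\<in>hdom (slice G u) c. curvature (\<lambda>y. b c y + hphi (slice G u) c y)
      (\<lambda>y. hdbar (slice G u) c y + \<psi> c y) x = 0\<^sub>m (hrank (slice G u)) (hrank (slice G u))"
    using harm unfolding harmonic_metric_def by blast
  have D: "open (fxdom G c)" by (rule family_xdom(1)[OF fam uc])
  have H: "smooth_mat L (fxdom G c) 2 2 (H c)"
    using hermitian_metricD(1)[OF herm, rule_format, of c] uc frD(1) by simp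
  have A: "smooth_mat L (fxdom G c) 2 2 (fdbar G c u)" and F: "smooth_mat L (fxdom G c) 2 2 (fphi G c u)"
    using family_operators[OF fam uc] frD(1) by simp_all
  note car = smooth_mat_carrier[OF H] smooth_mat_carrier[OF A] smooth_mat_carrier[OF F]
  have bc: "b c x \<in> carrier_mat 2 2" "mat_dx (H c) x = H c x * b c x + mat_adjoint (fdbar G c u x) * H c x"
    if "x \<in> fxdom G c" for x
    using b[unfolded chern_10_def, rule_format, of x c] that uc frD(1) by simp_all
  have pc: "\<psi> c x \<in> carrier_mat 2 2" "H c x * fphi G c u x = mat_adjoint (\<psi> c x) * H c x"
    if "x \<in> fxdom G c" for x
    using \<psi>[unfolded higgs_adjoint_def, rule_format, of x c] that uc frD(1) by simp_all
  have "local_harmonic_frame (fxdom G c) (\<lambda>x. m2 (H c x)) (\<lambda>x. m2 (fdbar G c u x))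
    (\<lambda>x. m2 (fphi G c u x)) (\<lambda>x. m2 (b c x)) (\<lambda>x. m2 (\<psi> c x)) (\<lambda>x. f c u x ** S) \<Lambda>"
  proof
    show "open (fxdom G c)" by (rule D)
    show "msmooth (fxdom G c) (\<lambda>x. m2 (H c x))" "msmooth (fxdom G c) (\<lambda>x. m2 (fdbar G c u x))"
      "msmooth (fxdom G c) (\<lambda>x. m2 (fphi G c u x))" using msmooth_m2 H A F by blast+
    show smP: "msmooth (fxdom G c) (\<lambda>x. f c u x ** S)"
      by (rule msmooth_mult[OF D frD(3)[OF uc] msmooth_const])
    fix x assume x: "x \<in> fxdom G c"
    show "madj (m2 (H c x)) = m2 (H c x)"
      using hermitian_metricD(2)[OF herm, rule_format, of x c] x uc m2_simps(4)[OF car(1)[OF x] car(1)[OF x]]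
      by simp
    show "0 < Re ((madj T ** (m2 (H c x) ** T)) $ 1 $ 1)" if "T$1$1 \<noteq> 0 \<or> T$2$1 \<noteq> 0" for T
      by (rule m2_pos[OF car(1)[OF x] _ that])
        (use hermitian_metricD(3)[OF herm, rule_format, of x c] x uc frD(1) in simp)
    show "mdx (\<lambda>x. m2 (H c x)) x = m2 (H c x) ** m2 (b c x) + madj (m2 (fdbar G c u x)) ** m2 (H c x)"
      using arg_cong[OF bc(2)[OF x], of m2] car[OF x] bc(1)[OF x] mat_adjoint_carrier[OF car(2)[OF x]]
      by (simp add: m2_simps m2_mat_dx)
    show "m2 (H c x) ** m2 (fphi G c u x) = madj (m2 (\<psi> c x)) ** m2 (H c x)"
      using arg_cong[OF pc(2)[OF x], of m2] car[OF x] pc(1)[OF x] mat_adjoint_carrier[OF pc(1)[OF x]]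
      by (simp add: m2_simps)
    have "curvature (\<lambda>y. b c y + fphi G c u y) (\<lambda>y. fdbar G c u y + \<psi> c y) x = 0\<^sub>m 2 2"
      using flat[rule_format, of x c] x uc frD(1) by simp
    then show "mdx (\<lambda>y. m2 (fdbar G c u y) + m2 (\<psi> c y)) x - mdxbar (\<lambda>y. m2 (b c y) + m2 (fphi G c u y)) x
      + (m2 (b c x) + m2 (fphi G c u x)) ** (m2 (fdbar G c u x) + m2 (\<psi> c x))
      - (m2 (fdbar G c u x) + m2 (\<psi> c x)) ** (m2 (b c x) + m2 (fphi G c u x)) = 0"
      using m2_curvature[OF D x, of "b c" "fphi G c u" "fdbar G c u" "\<psi> c"] bc(1) pc(1) car by simp
    have "mat_dxbar (fphi G c u) x + fdbar G c u x * fphi G c u x - fphi G c u x * fdbar G c u x = 0\<^sub>m 2 2"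
      using family_integrable[OF fam uc x] frD(1) by simp
    then show "mdxbar (\<lambda>x. m2 (fphi G c u x)) x + m2 (fdbar G c u x) ** m2 (fphi G c u x)
        - m2 (fphi G c u x) ** m2 (fdbar G c u x) = 0"
      using m2_add_commutator[OF mat_dx_carrier(2)[of "fphi G c u"], OF car(3)[OF x] car(2)[OF x] car(3)[OF x]]
        m2_mat_dx(2)[of "fphi G c u", OF car(3)[OF x]] by simp
    have "mdxbar (\<lambda>x. f c u x ** S) x = mdxbar (f c u) x ** S"
      using mdx_mult(2)[OF D x frD(3)[OF uc] msmooth_const, of S] by (simp add: mmult_distrib)
    then show "mdxbar (\<lambda>x. f c u x ** S) x + m2 (fdbar G c u x) ** (f c u x ** S) = 0"
      using arg_cong[OF frD(5)[OF uc x], of "\<lambda>M. M ** S"] by (simp add: mmult_distrib mmult_assoc)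
    show "m2 (fphi G c u x) ** (f c u x ** S) = f c u x ** S ** \<Lambda>"
      using arg_cong[OF frD(6)[OF uc x], of "\<lambda>M. M ** S"] S by (simp add: mmult_assoc)
  qed (use \<Lambda> in auto)
  then show ?thesis by blast
qed

text \<open>The Gram matrix of the eigensections is the same in all charts, so the squared length of
  the first one is a global function on the torus and has a maximum. There the local result applies
  in every chart containing the point.\<close>

lemma orthogonal_point:
  assumes fam: "is_higgs_family L R V G" and fr: "theta_frame L \<alpha> G f"
    and harm: "harmonic_metric L (slice G u) H" and u: "u \<in> V" and L: "lattice_basis L w1 w2"
    and S: "Theta \<alpha> u ** S = S ** \<Lambda>" and \<Lambda>: "\<Lambda>$1$2 = 0" "\<Lambda>$2$1 = 0" "\<Lambda>$1$1 \<noteq> \<Lambda>$2$2"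
  obtains p where "p \<in> (\<lambda>(s, t). of_real s * w1 + of_real t * w2) ` ({0..1} \<times> {0..1})"
    "\<And>c. u \<in> fbase G (fst c) \<Longrightarrow> p \<in> fxdom G c \<Longrightarrow>
      (madj (f c u p ** S) ** (m2 (H c p) ** (f c u p ** S))) $ 1 $ 2 = 0"
proof -
  note frD = theta_frameD[OF fr]
  define K where "K c x = madj (f c u x ** S) ** (m2 (H c x) ** (f c u x ** S))" for c x
  have herm: "hermitian_metric L (slice G u) H" using harm unfolding harmonic_metric_def by blast
  have Hs: "smooth_mat L (fxdom G c) 2 2 (H c)" if "u \<in> fbase G (fst c)" for c
    using hermitian_metricD(1)[OF herm, rule_format, of c] that frD(1) by simp
  have indep: "K c x = K c' x"
    if "u \<in> fbase G (fst c)" "u \<in> fbase G (fst c')" "x \<in> fxdom G c" "x \<in> fxdom G c'" for c c' x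
  proof -
    define t where "t = ftrans G c c' u x"
    have t: "t \<in> carrier_mat 2 2" "mat_adjoint t \<in> carrier_mat 2 2"
      using smooth_mat_carrier[OF family_trans[OF fam that(1,2)], of x] that frD(1)
      by (simp_all add: t_def mat_adjoint_carrier)
    have h: "H c x \<in> carrier_mat 2 2" using smooth_mat_carrier[OF Hs] that by blast
    have "mat_adjoint t * H c x * t = H c' x"
      using hermitian_metricD(4)[OF herm, rule_format, of x c c'] that unfolding t_def by simp
    then have "m2 (H c' x) = m2 (mat_adjoint t * H c x * t)" by simp
    also have "\<dots> = madj (m2 t) ** m2 (H c x) ** m2 t"
      using t h by (subst m2_simps(1)) (auto simp: m2_simps)
    finally have H': "m2 (H c' x) = madj (m2 t) ** m2 (H c x) ** m2 t" .
    have f': "f c u x = m2 t ** f c' u x" using frD(7)[OF that] by (simp add: t_def)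
    show ?thesis unfolding K_def H' f' by (simp add: mmult_assoc)
  qed
  \<comment> \<open>Glued from arbitrary choices of a chart; \<open>indep\<close> makes the choice
    immaterial.\<close>
  define k where "k x = Re (K (SOME c. u \<in> fbase G (fst c) \<and> x \<in> fxdom G c) x $ 1 $ 1)" for x
  have k: "k x = Re (K c x $ 1 $ 1)" if "u \<in> fbase G (fst c)" "x \<in> fxdom G c" for c x
  proof -
    define c0 where "c0 = (SOME c. u \<in> fbase G (fst c) \<and> x \<in> fxdom G c)"
    have "u \<in> fbase G (fst c0) \<and> x \<in> fxdom G c0"
      unfolding c0_def by (rule someI[of _ c]) (use that in auto)
    then have "K c0 x = K c x" using indep that by blast
    then show ?thesis by (simp add: k_def c0_def)
  qed
  have smK: "msmooth (fxdom G c) (K c)" if "u \<in> fbase G (fst c)" for c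
    unfolding K_def[abs_def]
    by (intro msmooth_mult msmooth_madj family_xdom(1)[OF fam that] frD(3)[OF that] msmooth_const
        msmooth_m2[OF Hs[OF that]])
  have "isCont k x" for x
  proof -
    obtain c where c: "u \<in> fbase G (fst c)" "x \<in> fxdom G c" using family_chart_exists[OF fam u] by metis
    have "continuous_on (fxdom G c) (\<lambda>x. K c x $ 1 $ 1)"
      using smK[OF c(1)] smooth_fun_continuous_on unfolding msmooth_def by blast
    then have "continuous_on (fxdom G c) (\<lambda>x. Re (K c x $ 1 $ 1))" by (rule continuous_on_Re)
    then have "continuous_on (fxdom G c) k" using k[OF c(1)] by (subst continuous_on_cong[OF refl]) auto
    then show ?thesis using c family_xdom(1)[OF fam c(1)] continuous_on_eq_continuous_at by blast
  qed
  then have cont: "continuous_on UNIV k" by (simp add: continuous_at_imp_continuous_on)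
  have "k (x + w) = k x" if "w \<in> L" for x w
  proof -
    obtain c where c: "u \<in> fbase G (fst c)" "x \<in> fxdom G c" using family_chart_exists[OF fam u] by metis
    have "f c u (x + w) = f c u x" "H c (x + w) = H c x"
      using frD(2)[OF c(1)] smooth_mat_periodic[OF Hs[OF c(1)]] c that unfolding periodic_on_def by blast+
    then show ?thesis using k[OF c] k[OF c(1) family_xdom(2)[OF fam c(1,2) that]] by (simp add: K_def)
  qed
  then have per: "periodic_on L UNIV k" by (simp add: periodic_on_def)
  obtain p where p: "p \<in> (\<lambda>(s, t). of_real s * w1 + of_real t * w2) ` ({0..1} \<times> {0..1})" "\<And>y. k y \<le> k p"
    using periodic_attains_max[OF L cont per] by blast
  show ?thesis
  proof (rule that[OF p(1)])
    fix c assume c: "u \<in> fbase G (fst c)" "p \<in> fxdom G c"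
    obtain b \<psi> where "local_harmonic_frame (fxdom G c) (\<lambda>x. m2 (H c x)) (\<lambda>x. m2 (fdbar G c u x))
      (\<lambda>x. m2 (fphi G c u x)) b \<psi> (\<lambda>x. f c u x ** S) \<Lambda>"
      using local_harmonic_frame_of_metric[OF fam fr harm c(1) S \<Lambda>(1,2)] by blast
    then interpret loc: local_harmonic_frame "fxdom G c" "\<lambda>x. m2 (H c x)" "\<lambda>x. m2 (fdbar G c u x)"
      "\<lambda>x. m2 (fphi G c u x)" b \<psi> "\<lambda>x. f c u x ** S" \<Lambda> .
    have eq: "loc.K = K c" by (rule ext) (simp add: loc.K_def K_def)
    have "Re (loc.K y $ 1 $ 1) \<le> Re (loc.K p $ 1 $ 1)" if "y \<in> fxdom G c" for y
      unfolding eq using p(2)[of y] unfolding k[OF c(1) that] k[OF c] .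
    then have "loc.K p $ 1 $ 2 = 0"
      by (rule loc.eigensections_orthogonal_at_max[OF c(2) _ \<Lambda>(3)])
    then show "(madj (f c u p ** S) ** (m2 (H c p) ** (f c u p ** S))) $ 1 $ 2 = 0"
      unfolding eq K_def .
  qed
qed

lemma m2_jointly_continuous:
  assumes "regular_mat (Cd_smooth d) B D 2 2 M" "open D"
  shows "continuous_on (B \<times> D) (\<lambda>(u, x). m2 (M u x) $ i $ j)"
proof -
  have "Cd_smooth d B D (\<lambda>u x. M u x $$ (idx i, idx j))"
    using assms(1) unfolding regular_mat_def by simp
  then have "cont_smooth B D (\<lambda>u x. M u x $$ (idx i, idx j))" by (rule Cd_smooth_imp_cont_smooth)
  then show ?thesis using cont_smooth_jointly_continuous[OF _ assms(2)] by simp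
qed

lemma mmult_jointly_continuous:
  fixes M N :: "complex \<Rightarrow> complex \<Rightarrow> cmat"
  assumes "\<And>i j. continuous_on X (\<lambda>(u, x). M u x $ i $ j)" "\<And>i j. continuous_on X (\<lambda>(u, x). N u x $ i $ j)"
  shows "continuous_on X (\<lambda>(u, x). (M u x ** N u x) $ i $ j)"
  using assms unfolding mmult_nth case_prod_beta by (intro continuous_on_add continuous_on_mult) auto

lemma madj_jointly_continuous:
  fixes M :: "complex \<Rightarrow> complex \<Rightarrow> cmat"
  assumes "\<And>i j. continuous_on X (\<lambda>(u, x). M u x $ i $ j)"
  shows "continuous_on X (\<lambda>(u, x). madj (M u x) $ i $ j)"
  using assms unfolding madj_nth case_prod_beta by (intro continuous_on_cnj) auto

text \<open>The eigenvectors \<open>(1, \<plusminus>s)\<close> of \<open>Theta \<alpha> (s\<^sup>2)\<close> are orthogonal somewhere on each slice \<open>s \<noteq> 0\<close>, but they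
  merge as \<open>s\<close> tends to \<open>0\<close>.\<close>

lemma no_continuous_harmonic_metric:
  assumes fam: "is_higgs_family L R V G" and fr: "theta_frame L \<alpha> G f"
    and "0 \<in> V" "\<alpha> \<noteq> 0" "is_lattice L"
  shows "\<not> admits_harmonic_metric L (Cd_smooth d) V G"
proof
  assume "admits_harmonic_metric L (Cd_smooth d) V G"
  then obtain H where reg: "\<And>c. regular_mat (Cd_smooth d) (fbase G (fst c)) (fxdom G c) (frank G) (frank G) (H c)"
    and harm: "\<And>u. u \<in> V \<Longrightarrow> harmonic_metric L (slice G u) (\<lambda>c. H c u)"
    unfolding admits_harmonic_metric_def by blast
  note frD = theta_frameD[OF fr]
  obtain w1 w2 where L: "lattice_basis L w1 w2" using assms(5) unfolding is_lattice_def by blast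
  define C where "C = (\<lambda>(s :: real, t :: real). of_real s * w1 + of_real t * w2) ` ({0..1} \<times> {0..1})"
  have "compact C"
    unfolding C_def by (intro compact_continuous_image compact_Times)
      (auto simp: case_prod_beta intro!: continuous_intros)
  have "open V" using is_higgs_familyD(1,2)[OF fam] by blast
  then obtain e where e: "e > 0" "ball 0 e \<subseteq> V" using \<open>0 \<in> V\<close> open_contains_ball by blast
  \<comment> \<open>The parameters used are \<open>(s n)\<^sup>2\<close>. With
    \<open>\<delta> < 1\<close> their norm is at most \<open>\<delta>\<close>, hence below
    \<open>e\<close>.\<close>
  define \<delta> where "\<delta> = min 1 e / 2"
  have \<delta>: "0 < \<delta>" "\<delta> < 1" "\<delta> < e" using e by (auto simp: \<delta>_def)
  define s :: "nat \<Rightarrow> complex" where "s n = of_real (\<delta> / real (Suc n))" for n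
  \<comment> \<open>Columns \<open>(1, s)\<close> and \<open>(1, -s)\<close>, with eigenvalues plus
    and minus \<open>\<alpha> s\<^sup>3\<close> of
    \<open>Theta \<alpha> (s\<^sup>2)\<close>.\<close>
  define S :: "nat \<Rightarrow> cmat" where "S n = (\<chi> i j. if i = 1 then 1 else if j = 1 then s n else - s n)" for n
  define \<Lambda> :: "nat \<Rightarrow> cmat" where "\<Lambda> n = (\<chi> i j. if i \<noteq> j then 0 else if i = 1 then \<alpha> * (s n)\<^sup>2 * s n
      else - (\<alpha> * (s n)\<^sup>2 * s n))" for n
  have s0: "s n \<noteq> 0" for n unfolding s_def of_real_eq_0_iff using \<delta> by simp
  have uV: "(s n)\<^sup>2 \<in> V" for n
  proof -
    have "norm (s n) \<le> \<delta>" unfolding s_def norm_of_real using \<delta> by (simp add: divide_le_eq)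
    then have "norm (s n) * norm (s n) \<le> \<delta> * 1" using \<delta> by (intro mult_mono) auto
    then show ?thesis using \<delta> e(2) by (auto simp: norm_mult power2_eq_square)
  qed
  have "\<exists>p \<in> C. \<forall>c. (s n)\<^sup>2 \<in> fbase G (fst c) \<longrightarrow> p \<in> fxdom G c \<longrightarrow>
      (madj (f c ((s n)\<^sup>2) p ** S n) ** (m2 (H c ((s n)\<^sup>2) p) ** (f c ((s n)\<^sup>2) p ** S n))) $ 1 $ 2 = 0" for n
  proof -
    have eig: "Theta \<alpha> ((s n)\<^sup>2) ** S n = S n ** \<Lambda> n"
      by (simp add: cmat_eq_iff mmult_nth Theta_def S_def \<Lambda>_def power2_eq_square)
    have diag: "\<Lambda> n $1$2 = 0" "\<Lambda> n $2$1 = 0" by (simp_all add: \<Lambda>_def)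
    have dist: "\<Lambda> n $1$1 \<noteq> \<Lambda> n $2$2" using s0[of n] \<open>\<alpha> \<noteq> 0\<close> by (simp add: \<Lambda>_def)
    show ?thesis
      by (rule orthogonal_point[OF fam fr harm[OF uV[of n]] uV[of n] L eig diag dist])
        (unfold C_def, rule bexI, blast)
  qed
  then obtain p where p: "\<And>n. p n \<in> C" and orth: "\<And>n c. (s n)\<^sup>2 \<in> fbase G (fst c) \<Longrightarrow> p n \<in> fxdom G c \<Longrightarrow>
      (madj (f c ((s n)\<^sup>2) (p n) ** S n) ** (m2 (H c ((s n)\<^sup>2) (p n)) ** (f c ((s n)\<^sup>2) (p n) ** S n))) $ 1 $ 2 = 0"
    by metis
  \<comment> \<open>The orthogonality points vary with \<open>n\<close> but stay in one
    parallelogram. A chart around a limit point contains the tail of the subsequence, so a single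
    chart suffices from here on.\<close>
  obtain x r where r: "strict_mono r" "(p \<circ> r) \<longlonglongrightarrow> x"
    using \<open>compact C\<close> p unfolding compact_def by meson
  obtain c where c: "0 \<in> fbase G (fst c)" "x \<in> fxdom G c" using family_chart_exists[OF fam \<open>0 \<in> V\<close>] by metis
  have D: "open (fxdom G c)" by (rule family_xdom(1)[OF fam c(1)])
  define M where "M u x = madj (f c u x) ** (m2 (H c u x) ** f c u x)" for u x
  have "continuous_on (fbase G (fst c) \<times> fxdom G c) (\<lambda>(u, x). M u x $ i $ j)" for i j
    unfolding M_def
    using m2_jointly_continuous[OF reg[of c, unfolded frD(1)] D]
    by (intro mmult_jointly_continuous madj_jointly_continuous frD(8))
  moreover have op: "open (fbase G (fst c) \<times> fxdom G c)"
    using D family_base(1)[OF fam] by (intro open_Times)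
  ultimately have cont: "isCont (\<lambda>(u, x). M u x $ i $ j) (0, x)" for i j
    using c continuous_on_eq_continuous_at by blast
  have "s \<longlonglongrightarrow> 0"
  proof -
    have "(\<lambda>n. \<delta> / real (Suc n)) \<longlonglongrightarrow> 0" by (rule LIMSEQ_Suc[OF lim_const_over_n])
    then have "(\<lambda>n. complex_of_real (\<delta> / real (Suc n))) \<longlonglongrightarrow> of_real 0" by (rule tendsto_of_real)
    then show ?thesis by (simp add: s_def[abs_def])
  qed
  then have sr: "(\<lambda>n. s (r n)) \<longlonglongrightarrow> 0" using LIMSEQ_subseq_LIMSEQ[OF _ r(1), of s 0] by (simp add: o_def)
  have "(\<lambda>n. (s (r n))\<^sup>2) \<longlonglongrightarrow> 0\<^sup>2" by (intro tendsto_intros sr)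
  then have pt: "(\<lambda>n. ((s (r n))\<^sup>2, p (r n))) \<longlonglongrightarrow> (0, x)"
    using r(2) by (intro tendsto_Pair) (simp_all add: o_def)
  have ev: "\<forall>\<^sub>F n in sequentially. ((s (r n))\<^sup>2, p (r n)) \<in> fbase G (fst c) \<times> fxdom G c"
    using topological_tendstoD[OF pt op] c by simp
  have lim: "(\<lambda>n. M ((s (r n))\<^sup>2) (p (r n)) $ i $ j) \<longlonglongrightarrow> M 0 x $ i $ j" for i j
    using isCont_tendsto_compose[OF cont pt, of i j] by simp
  \<comment> \<open>The entry \<open>(1, 2)\<close> of \<open>S\<^sup>* M S\<close>, the product of
    \<open>(1, -s)\<close> with \<open>(1, s)\<close>, multiplied out. It is zero along the
    sequence, and as \<open>s\<close> tends to \<open>0\<close> it tends to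
    \<open>M 0 x $ 1 $ 1\<close>.\<close>
  define Z where "Z n = M ((s (r n))\<^sup>2) (p (r n)) $ 1 $ 1 - s (r n) * M ((s (r n))\<^sup>2) (p (r n)) $ 1 $ 2
    + cnj (s (r n)) * M ((s (r n))\<^sup>2) (p (r n)) $ 2 $ 1
    - cnj (s (r n)) * s (r n) * M ((s (r n))\<^sup>2) (p (r n)) $ 2 $ 2" for n
  have "Z \<longlonglongrightarrow> M 0 x $ 1 $ 1 - 0 * M 0 x $ 1 $ 2 + cnj 0 * M 0 x $ 2 $ 1 - cnj 0 * 0 * M 0 x $ 2 $ 2"
    unfolding Z_def[abs_def]
    by (intro tendsto_add tendsto_diff tendsto_mult tendsto_cnj lim sr)
  then have "Z \<longlonglongrightarrow> M 0 x $ 1 $ 1" by simp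
  moreover have "\<forall>\<^sub>F n in sequentially. Z n = 0"
    using ev
  proof eventually_elim
    case (elim n)
    then have "(madj (S (r n)) ** (M ((s (r n))\<^sup>2) (p (r n)) ** S (r n))) $ 1 $ 2 = 0"
      using orth[of "r n" c] by (simp add: M_def mmult_assoc)
    then show ?case
      unfolding mmult_nth[of "madj _"] mmult_nth[of "M _ _"] by (simp add: Z_def S_def algebra_simps)
  qed
  ultimately have "M 0 x $ 1 $ 1 = 0"
    using tendsto_eventually[of Z 0 sequentially] LIMSEQ_unique by blast
  \<comment> \<open>This entry is the squared length of the first frame vector, which is nonzero
    since the frame is invertible.\<close>
  moreover have "0 < Re (M 0 x $ 1 $ 1)"
    unfolding M_def
  proof (rule m2_pos)
    have herm: "hermitian_metric L (slice G 0) (\<lambda>c. H c 0)"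
      using harm[OF \<open>0 \<in> V\<close>] unfolding harmonic_metric_def by blast
    show "H c 0 x \<in> carrier_mat 2 2"
      using smooth_mat_carrier[OF hermitian_metricD(1)[OF herm, rule_format, of c], of x] c frD(1) by simp
    show "\<forall>v \<in> carrier_vec 2. v \<noteq> 0\<^sub>v 2 \<longrightarrow> 0 < Re ((H c 0 x *\<^sub>v v) \<bullet>c v)"
      using hermitian_metricD(3)[OF herm, rule_format, of x c] c frD(1) by simp
    show "f c 0 x $ 1 $ 1 \<noteq> 0 \<or> f c 0 x $ 2 $ 1 \<noteq> 0"
      using frD(4)[OF c] by (auto simp: mdet_def)
  qed
  ultimately show False by simp
qed

section \<open>Transport along isomorphisms\<close>

lemma m2_one_right: "(M :: cmat) ** m2 (1\<^sub>m 2) = M"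
  by (simp add: cmat_eq_iff mmult_nth)

lemma family_cocycle:
  assumes fam: "is_higgs_family L R V G" and rank: "frank G = 2"
    and "u \<in> fbase G (fst c)" "u \<in> fbase G (fst c')" "x \<in> fxdom G c" "x \<in> fxdom G c'"
  shows "m2 (ftrans G c c' u x) ** (m2 (ftrans G c' c u x) ** M) = (M :: cmat)"
proof -
  have "\<forall>c c' c''. \<forall>x \<in> hdom (slice G u) c \<inter> hdom (slice G u) c' \<inter> hdom (slice G u) c''.
        htrans (slice G u) c c' x * htrans (slice G u) c' c'' x = htrans (slice G u) c c'' x"
    using family_slice[OF fam family_base(2)[OF fam assms(3)]]
    unfolding is_higgs_bundle_def is_vector_bundle_def by - (elim conjE; assumption)
  from this[rule_format, of x c c' c] have "ftrans G c c' u x * ftrans G c' c u x = 1\<^sub>m 2"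
    using assms family_trans_refl[OF fam assms(3,5)] by simp
  moreover have "ftrans G c c' u x \<in> carrier_mat 2 2" "ftrans G c' c u x \<in> carrier_mat 2 2"
    using smooth_mat_carrier[OF family_trans[OF fam assms(3,4)], of x]
      smooth_mat_carrier[OF family_trans[OF fam assms(4,3)], of x] assms by simp_all
  ultimately have "m2 (ftrans G c c' u x) ** m2 (ftrans G c' c u x) = m2 (1\<^sub>m 2)"
    using m2_simps(1) by metis
  then have "(m2 (ftrans G c c' u x) ** m2 (ftrans G c' c u x)) ** M = M" by (simp add: m2_one)
  then show ?thesis by (simp add: mmult_assoc)
qed

text \<open>An isomorphism from \<open>G\<close> to \<open>G'\<close>, with one matrix for every
  pair of charts, required only to be continuous in the parameter. In this class inversion is
  elementary, by the formula for \<open>minv\<close>.\<close>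

definition frame_change ::
    "complex set \<Rightarrow> higgs_family \<Rightarrow> higgs_family \<Rightarrow> (chart \<Rightarrow> chart \<Rightarrow> complex \<Rightarrow> complex \<Rightarrow> cmat) \<Rightarrow> bool" where
  "frame_change L G G' N \<longleftrightarrow>
     (\<forall>b c. \<forall>u \<in> fbase G' (fst b) \<inter> fbase G (fst c).
        periodic_on L (fxdom G' b \<inter> fxdom G c) (N b c u) \<and> msmooth (fxdom G' b \<inter> fxdom G c) (N b c u) \<and>
        (\<forall>x \<in> fxdom G' b \<inter> fxdom G c. mdet (N b c u x) \<noteq> 0 \<and>
           mdxbar (N b c u) x + m2 (fdbar G' b u x) ** N b c u x = N b c u x ** m2 (fdbar G c u x) \<and>
           m2 (fphi G' b u x) ** N b c u x = N b c u x ** m2 (fphi G c u x))) \<and>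
     (\<forall>b b' c c'. \<forall>u \<in> fbase G' (fst b) \<inter> fbase G' (fst b') \<inter> fbase G (fst c) \<inter> fbase G (fst c').
        \<forall>x \<in> fxdom G' b \<inter> fxdom G' b' \<inter> fxdom G c \<inter> fxdom G c'.
        m2 (ftrans G' b' b u x) ** (N b c u x ** m2 (ftrans G c c' u x)) = N b' c' u x) \<and>
     (\<forall>b c i j. continuous_on ((fbase G' (fst b) \<inter> fbase G (fst c)) \<times> (fxdom G' b \<inter> fxdom G c))
        (\<lambda>(u, x). N b c u x $ i $ j))"

lemma frame_changeD:
  assumes "frame_change L G G' N"
  shows "\<And>b c u. u \<in> fbase G' (fst b) \<Longrightarrow> u \<in> fbase G (fst c) \<Longrightarrow>
      periodic_on L (fxdom G' b \<inter> fxdom G c) (N b c u)"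
    and "\<And>b c u. u \<in> fbase G' (fst b) \<Longrightarrow> u \<in> fbase G (fst c) \<Longrightarrow>
      msmooth (fxdom G' b \<inter> fxdom G c) (N b c u)"
    and "\<And>b c u x. u \<in> fbase G' (fst b) \<Longrightarrow> u \<in> fbase G (fst c) \<Longrightarrow> x \<in> fxdom G' b \<Longrightarrow> x \<in> fxdom G c \<Longrightarrow>
      mdet (N b c u x) \<noteq> 0"
    and "\<And>b c u x. u \<in> fbase G' (fst b) \<Longrightarrow> u \<in> fbase G (fst c) \<Longrightarrow> x \<in> fxdom G' b \<Longrightarrow> x \<in> fxdom G c \<Longrightarrow>
      mdxbar (N b c u) x + m2 (fdbar G' b u x) ** N b c u x = N b c u x ** m2 (fdbar G c u x)"
    and "\<And>b c u x. u \<in> fbase G' (fst b) \<Longrightarrow> u \<in> fbase G (fst c) \<Longrightarrow> x \<in> fxdom G' b \<Longrightarrow> x \<in> fxdom G c \<Longrightarrow>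
      m2 (fphi G' b u x) ** N b c u x = N b c u x ** m2 (fphi G c u x)"
    and "\<And>b b' c c' u x. u \<in> fbase G' (fst b) \<Longrightarrow> u \<in> fbase G' (fst b') \<Longrightarrow> u \<in> fbase G (fst c) \<Longrightarrow>
      u \<in> fbase G (fst c') \<Longrightarrow> x \<in> fxdom G' b \<Longrightarrow> x \<in> fxdom G' b' \<Longrightarrow> x \<in> fxdom G c \<Longrightarrow> x \<in> fxdom G c' \<Longrightarrow>
      m2 (ftrans G' b' b u x) ** (N b c u x ** m2 (ftrans G c c' u x)) = N b' c' u x"
    and "\<And>b c i j. continuous_on ((fbase G' (fst b) \<inter> fbase G (fst c)) \<times> (fxdom G' b \<inter> fxdom G c))
        (\<lambda>(u, x). N b c u x $ i $ j)"
  using assms unfolding frame_change_def by blast+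

lemma continuous_on_locally:
  fixes F :: "'a :: t2_space \<Rightarrow> 'b :: topological_space"
  assumes "\<And>p. p \<in> S \<Longrightarrow> \<exists>T. open T \<and> p \<in> T \<and> continuous_on (S \<inter> T) F"
  shows "continuous_on S F"
  unfolding continuous_on_eq_continuous_within
proof
  fix p assume p: "p \<in> S"
  then obtain T where T: "open T" "p \<in> T" "continuous_on (S \<inter> T) F" using assms by blast
  then have "continuous (at p within S \<inter> T) F" using p by (simp add: continuous_on_eq_continuous_within)
  moreover have "at p within S \<inter> T = at p within S"
    by (rule at_within_nhd[OF T(2,1)]) auto
  ultimately show "continuous (at p within S) F" by simp
qed

lemma msmooth_subset: "msmooth D M \<Longrightarrow> D' \<subseteq> D \<Longrightarrow> msmooth D' M"
  unfolding msmooth_def using smooth_fun_subset by blast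

text \<open>The new frame is the composite \<open>N ** f\<close>. The regularity classes
  \<open>R\<close> and \<open>R'\<close> are independent, since one family may be the analytic model
  and the other of class C^d.\<close>

lemma theta_frame_transport:
  assumes fam: "is_higgs_family L R V G" and fam': "is_higgs_family L R' V G'"
    and fr: "theta_frame L \<alpha> G f" and ch: "frame_change L G G' N" and rank: "frank G' = 2"
  shows "\<exists>f'. theta_frame L \<alpha> G' f'"
proof -
  note frD = theta_frameD[OF fr] and chD = frame_changeD[OF ch]
  have indep: "N b c' u x ** f c' u x = N b c u x ** f c u x"
    if "u \<in> fbase G' (fst b)" "u \<in> fbase G (fst c)" "u \<in> fbase G (fst c')"
      "x \<in> fxdom G' b" "x \<in> fxdom G c" "x \<in> fxdom G c'" for b c c' u x
  proof -
    have "N b c' u x = N b c u x ** m2 (ftrans G c c' u x)"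
      using chD(6)[OF that(1,1,2,3,4,4,5,6)] family_trans_refl[OF fam' that(1,4)] rank by (simp add: m2_one)
    then show ?thesis using frD(7)[OF that(2,3,5,6)] by (simp add: mmult_assoc)
  qed
  \<comment> \<open>The composite passes through a chart of \<open>G\<close>, which can cover only a
    part of the chart of \<open>G'\<close>. It is therefore chosen pointwise; all choices agree, so
    every property can be checked locally with one fixed chart.\<close>
  define f' where "f' b u x = (let c = SOME c. u \<in> fbase G (fst c) \<and> x \<in> fxdom G c in N b c u x ** f c u x)"
    for b u x
  have f': "f' b u x = N b c u x ** f c u x"
    if "u \<in> fbase G' (fst b)" "u \<in> fbase G (fst c)" "x \<in> fxdom G' b" "x \<in> fxdom G c" for b c u x
  proof -
    define c0 where "c0 = (SOME c. u \<in> fbase G (fst c) \<and> x \<in> fxdom G c)"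
    have "u \<in> fbase G (fst c0) \<and> x \<in> fxdom G c0"
      unfolding c0_def by (rule someI[of _ c]) (use that in auto)
    then have "N b c0 u x ** f c0 u x = N b c u x ** f c u x" using indep that by blast
    then show ?thesis unfolding f'_def c0_def[symmetric] Let_def .
  qed
  have chart: "\<exists>c. u \<in> fbase G (fst c) \<and> x \<in> fxdom G c" if "u \<in> fbase G' (fst b)" for b u x
    using family_chart_exists[OF fam family_base(2)[OF fam' that]] by metis
  have prod_smooth: "open (fxdom G' b \<inter> fxdom G c)" "msmooth (fxdom G' b \<inter> fxdom G c) (f c u)"
    "msmooth (fxdom G' b \<inter> fxdom G c) (\<lambda>x. N b c u x ** f c u x)"
    if "u \<in> fbase G' (fst b)" "u \<in> fbase G (fst c)" for b c u
  proof -
    show o: "open (fxdom G' b \<inter> fxdom G c)"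
      using family_xdom(1)[OF fam' that(1)] family_xdom(1)[OF fam that(2)] by blast
    show s: "msmooth (fxdom G' b \<inter> fxdom G c) (f c u)" by (rule msmooth_subset[OF frD(3)[OF that(2)]]) auto
    show "msmooth (fxdom G' b \<inter> fxdom G c) (\<lambda>x. N b c u x ** f c u x)"
      by (rule msmooth_mult[OF o chD(2)[OF that] s])
  qed
  have "theta_frame L \<alpha> G' f'"
    unfolding theta_frame_def
  proof (intro conjI allI ballI)
    show "frank G' = 2" by (rule rank)
  next
    fix b :: chart and u assume u: "u \<in> fbase G' (fst b)"
    show "periodic_on L (fxdom G' b) (f' b u)"
      unfolding periodic_on_def
    proof (intro ballI)
      fix x w assume x: "x \<in> fxdom G' b" and w: "w \<in> L"
      obtain c where c: "u \<in> fbase G (fst c)" "x \<in> fxdom G c" using chart[OF u] by blast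
      have xw: "x + w \<in> fxdom G' b" "x + w \<in> fxdom G c"
        using family_xdom(2)[OF fam' u x w] family_xdom(2)[OF fam c w] by auto
      have "N b c u (x + w) = N b c u x" "f c u (x + w) = f c u x"
        using chD(1)[OF u c(1)] frD(2)[OF c(1)] x c w unfolding periodic_on_def by blast+
      then show "f' b u (x + w) = f' b u x" using f'[OF u c(1) x c(2)] f'[OF u c(1) xw] by simp
    qed
    show "msmooth (fxdom G' b) (f' b u)"
      unfolding msmooth_def
    proof (intro allI smooth_fun_local)
      fix i j x assume x: "x \<in> fxdom G' b"
      obtain c where c: "u \<in> fbase G (fst c)" "x \<in> fxdom G c" using chart[OF u] by blast
      show "\<exists>D' g. open D' \<and> x \<in> D' \<and> smooth_fun D' g \<and> (\<forall>y\<in>D'. f' b u y $ i $ j = g y)"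
      proof (intro exI conjI)
        show "open (fxdom G' b \<inter> fxdom G c)" by (rule prod_smooth(1)[OF u c(1)])
        show "smooth_fun (fxdom G' b \<inter> fxdom G c) (\<lambda>x. (N b c u x ** f c u x) $ i $ j)"
          using prod_smooth(3)[OF u c(1)] unfolding msmooth_def by blast
        show "\<forall>y\<in>fxdom G' b \<inter> fxdom G c. f' b u y $ i $ j = (N b c u y ** f c u y) $ i $ j"
          using f'[OF u c(1)] by simp
      qed (use x c in simp)
    qed
    fix x assume x: "x \<in> fxdom G' b"
    obtain c where c: "u \<in> fbase G (fst c)" "x \<in> fxdom G c" using chart[OF u] by blast
    note fx = f'[OF u c(1) x c(2)]
    show "mdet (f' b u x) \<noteq> 0"
      unfolding fx mdet_mult using chD(3)[OF u c(1) x c(2)] frD(4)[OF c] by simp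
    have xin: "x \<in> fxdom G' b \<inter> fxdom G c" using x c by simp
    have "mdxbar (f' b u) x = mdxbar (\<lambda>x. N b c u x ** f c u x) x"
      by (rule mdx_cong(2)[OF prod_smooth(1)[OF u c(1)] xin]) (use f'[OF u c(1)] in simp)
    also have "\<dots> = mdxbar (N b c u) x ** f c u x + N b c u x ** mdxbar (f c u) x"
      by (rule mdx_mult(2)[OF prod_smooth(1)[OF u c(1)] xin chD(2)[OF u c(1)] prod_smooth(2)[OF u c(1)]])
    also have "mdxbar (N b c u) x = N b c u x ** m2 (fdbar G c u x) - m2 (fdbar G' b u x) ** N b c u x"
      using chD(4)[OF u c(1) x c(2)] by (simp add: algebra_simps)
    also have "mdxbar (f c u) x = - (m2 (fdbar G c u x) ** f c u x)"
      using frD(5)[OF c] by (simp add: eq_neg_iff_add_eq_0)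
    finally show "mdxbar (f' b u) x + m2 (fdbar G' b u x) ** f' b u x = 0"
      unfolding fx by (simp add: mmult_distrib mmult_assoc)
    show "m2 (fphi G' b u x) ** f' b u x = f' b u x ** Theta \<alpha> u"
      unfolding fx using arg_cong[OF chD(5)[OF u c(1) x c(2)], of "\<lambda>M. M ** f c u x"] frD(6)[OF c]
      by (simp add: mmult_assoc)
  next
    fix b b' :: chart and u x assume u: "u \<in> fbase G' (fst b) \<inter> fbase G' (fst b')" and x: "x \<in> fxdom G' b \<inter> fxdom G' b'"
    obtain c where c: "u \<in> fbase G (fst c)" "x \<in> fxdom G c" using chart u by blast
    have "m2 (ftrans G' b b' u x) ** N b' c u x = N b c u x"
      using chD(6)[of u b' b c c x] u x c family_trans_refl[OF fam c] frD(1) by (simp add: m2_one_right)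
    then have "m2 (ftrans G' b b' u x) ** (N b' c u x ** f c u x) = N b c u x ** f c u x"
      by (simp add: mmult_assoc[symmetric])
    then show "m2 (ftrans G' b b' u x) ** f' b' u x = f' b u x"
      using f'[of u b' c x] f'[of u b c x] u x c by simp
  next
    fix b :: chart and i j :: 2
    show "continuous_on (fbase G' (fst b) \<times> fxdom G' b) (\<lambda>(u, x). f' b u x $ i $ j)"
    proof (rule continuous_on_locally)
      fix p assume "p \<in> fbase G' (fst b) \<times> fxdom G' b"
      then obtain u x where p: "p = (u, x)" "u \<in> fbase G' (fst b)" "x \<in> fxdom G' b" by auto
      obtain c where c: "u \<in> fbase G (fst c)" "x \<in> fxdom G c" using chart[OF p(2)] by blast
      define T where "T = fbase G (fst c) \<times> fxdom G c"
      have int: "(fbase G' (fst b) \<times> fxdom G' b) \<inter> T =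
          (fbase G' (fst b) \<inter> fbase G (fst c)) \<times> (fxdom G' b \<inter> fxdom G c)"
        unfolding T_def by auto
      have prod: "continuous_on ((fbase G' (fst b) \<times> fxdom G' b) \<inter> T) (\<lambda>(u, x). (N b c u x ** f c u x) $ i $ j)"
        unfolding int
        by (intro mmult_jointly_continuous chD(7), rule continuous_on_subset[OF frD(8)]) auto
      have eq: "(case q of (u, x) \<Rightarrow> (N b c u x ** f c u x) $ i $ j) = (case q of (u, x) \<Rightarrow> f' b u x $ i $ j)"
        if "q \<in> (fbase G' (fst b) \<times> fxdom G' b) \<inter> T" for q
        using that f'[of "fst q" b c "snd q"] unfolding T_def by (auto simp: case_prod_beta)
      have "continuous_on ((fbase G' (fst b) \<times> fxdom G' b) \<inter> T) (\<lambda>(u, x). f' b u x $ i $ j)"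
        by (rule continuous_on_eq[OF prod eq])
      moreover have "open T" unfolding T_def
        using family_base(1)[OF fam] family_xdom(1)[OF fam c(1)] by (intro open_Times)
      ultimately show "\<exists>T. open T \<and> p \<in> T \<and>
          continuous_on ((fbase G' (fst b) \<times> fxdom G' b) \<inter> T) (\<lambda>(u, x). f' b u x $ i $ j)"
        using p c unfolding T_def by blast
    qed
  qed
  then show ?thesis by blast
qed

text \<open>Every identity for the inverse is proved after multiplication by \<open>N\<close> on the
  left, which can be cancelled.\<close>

lemma frame_change_inverse:
  assumes fam: "is_higgs_family L R V G" and fam': "is_higgs_family L R' V G'"
    and ch: "frame_change L G G' N" and rank: "frank G = 2" "frank G' = 2"
  shows "frame_change L G' G (\<lambda>c b u x. minv (N b c u x))"
proof -
  note chD = frame_changeD[OF ch]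
  have cancel: "minv (N b c u x) ** (N b c u x ** M) = M" "N b c u x ** (minv (N b c u x) ** M) = M"
    if "u \<in> fbase G' (fst b)" "u \<in> fbase G (fst c)" "x \<in> fxdom G' b" "x \<in> fxdom G c" for b c u x and M :: cmat
    by (rule minv_cancel[OF chD(3)[OF that]])+
  have inv_eq: "X = Y" if "N b c u x ** X = N b c u x ** Y" "u \<in> fbase G' (fst b)" "u \<in> fbase G (fst c)"
      "x \<in> fxdom G' b" "x \<in> fxdom G c" for b c u x and X Y :: cmat
    using mmult_left_cancel[OF chD(3)[OF that(2-5)] that(1)] .
  have one: "minv (N b c u x) ** m2 (1\<^sub>m 2) = minv (N b c u x)" for b c u x by (rule m2_one_right)
  show ?thesis
    unfolding frame_change_def
  proof (intro conjI allI ballI)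
    fix c b :: chart and u assume "u \<in> fbase G (fst c) \<inter> fbase G' (fst b)"
    then have u: "u \<in> fbase G' (fst b)" "u \<in> fbase G (fst c)" by auto
    let ?D = "fxdom G c \<inter> fxdom G' b"
    have D: "open ?D" using family_xdom(1)[OF fam' u(1)] family_xdom(1)[OF fam u(2)] by blast
    have smN: "msmooth ?D (N b c u)" using chD(2)[OF u] by (simp add: Int_commute)
    show "periodic_on L ?D (\<lambda>x. minv (N b c u x))"
      using chD(1)[OF u] unfolding periodic_on_def by auto
    show smi: "msmooth ?D (\<lambda>x. minv (N b c u x))"
      by (rule msmooth_minv[OF D smN]) (use chD(3)[OF u] in auto)
    fix x assume xD: "x \<in> ?D"
    then have x: "x \<in> fxdom G' b" "x \<in> fxdom G c" by auto
    show "mdet (minv (N b c u x)) \<noteq> 0"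
    proof
      assume "mdet (minv (N b c u x)) = 0"
      then have "mdet (minv (N b c u x) ** (N b c u x ** m2 (1\<^sub>m 2))) = 0" by (simp add: mdet_mult)
      then show False unfolding cancel(1)[OF u x] by (simp add: mdet_def)
    qed
    \<comment> \<open>Differentiating \<open>N N\<^sup>-\<^sup>1 = 1\<close> determines dbar of the
      inverse; \<open>m2 (1\<^sub>m 2)\<close> serves as the identity matrix.\<close>
    have "mdxbar (\<lambda>x. N b c u x ** minv (N b c u x)) x = mdxbar (\<lambda>x. m2 (1\<^sub>m 2)) x"
      by (rule mdx_cong(2)[OF D xD]) (use cancel(2)[OF u, of _ "m2 (1\<^sub>m 2)"] in \<open>simp add: one\<close>)
    then have "mdxbar (N b c u) x ** minv (N b c u x) + N b c u x ** mdxbar (\<lambda>x. minv (N b c u x)) x = 0"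
      using mdx_mult(2)[OF D xD smN smi] by simp
    moreover have "mdxbar (N b c u) x = N b c u x ** m2 (fdbar G c u x) - m2 (fdbar G' b u x) ** N b c u x"
      using chD(4)[OF u x] by (simp add: algebra_simps)
    moreover have "N b c u x ** minv (N b c u x) = m2 (1\<^sub>m 2)"
      using cancel(2)[OF u x, of "m2 (1\<^sub>m 2)"] by (simp add: one)
    ultimately have "N b c u x ** (mdxbar (\<lambda>x. minv (N b c u x)) x + m2 (fdbar G c u x) ** minv (N b c u x))
        = N b c u x ** (minv (N b c u x) ** m2 (fdbar G' b u x))"
      using cancel(2)[OF u x, of "m2 (fdbar G' b u x)"]
      by (simp add: mmult_distrib mmult_assoc m2_one_right add_eq_0_iff algebra_simps)
    then show "mdxbar (\<lambda>x. minv (N b c u x)) x + m2 (fdbar G c u x) ** minv (N b c u x)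
        = minv (N b c u x) ** m2 (fdbar G' b u x)"
      using inv_eq u x by blast
    have "N b c u x ** (m2 (fphi G c u x) ** minv (N b c u x)) = m2 (fphi G' b u x) ** (N b c u x ** minv (N b c u x))"
      using arg_cong[OF chD(5)[OF u x], of "\<lambda>M. M ** minv (N b c u x)"] by (simp add: mmult_assoc)
    also have "\<dots> = N b c u x ** (minv (N b c u x) ** m2 (fphi G' b u x))"
      using cancel(2)[OF u x, of "m2 (1\<^sub>m 2)"] cancel(2)[OF u x, of "m2 (fphi G' b u x)"]
      by (simp add: one m2_one_right)
    finally show "m2 (fphi G c u x) ** minv (N b c u x) = minv (N b c u x) ** m2 (fphi G' b u x)"
      using inv_eq u x by blast
  next
    fix c c' b b' :: chart and u x
    assume "u \<in> fbase G (fst c) \<inter> fbase G (fst c') \<inter> fbase G' (fst b) \<inter> fbase G' (fst b')"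
      and "x \<in> fxdom G c \<inter> fxdom G c' \<inter> fxdom G' b \<inter> fxdom G' b'"
    then have u: "u \<in> fbase G' (fst b)" "u \<in> fbase G' (fst b')" "u \<in> fbase G (fst c)" "u \<in> fbase G (fst c')"
      and x: "x \<in> fxdom G' b" "x \<in> fxdom G' b'" "x \<in> fxdom G c" "x \<in> fxdom G c'" by auto
    \<comment> \<open>Write \<open>N b' c'\<close> through \<open>N b c\<close> by the gluing rule;
      the transition matrices then cancel in pairs, leaving the identity.\<close>
    have "N b' c' u x ** (m2 (ftrans G c' c u x) ** (minv (N b c u x) ** m2 (ftrans G' b b' u x)))
        = m2 (ftrans G' b' b u x) ** (N b c u x ** (m2 (ftrans G c c' u x) **
            (m2 (ftrans G c' c u x) ** (minv (N b c u x) ** m2 (ftrans G' b b' u x)))))"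
      unfolding chD(6)[OF u x, symmetric] by (simp add: mmult_assoc)
    also have "\<dots> = m2 (ftrans G' b' b u x) ** (m2 (ftrans G' b b' u x) ** m2 (1\<^sub>m 2))"
      unfolding family_cocycle[OF fam rank(1) u(3,4) x(3,4)] cancel(2)[OF u(1,3) x(1,3)] m2_one_right ..
    also have "\<dots> = m2 (1\<^sub>m 2)" by (rule family_cocycle[OF fam' rank(2) u(2,1) x(2,1)])
    also have "\<dots> = N b' c' u x ** minv (N b' c' u x)"
      using cancel(2)[OF u(2,4) x(2,4), of "m2 (1\<^sub>m 2)"] by (simp add: one)
    finally show "m2 (ftrans G c' c u x) ** (minv (N b c u x) ** m2 (ftrans G' b b' u x)) = minv (N b' c' u x)"
      using inv_eq u x by blast
  next
    fix c b :: chart and i j :: 2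
    let ?X = "(fbase G (fst c) \<inter> fbase G' (fst b)) \<times> (fxdom G c \<inter> fxdom G' b)"
    have c: "continuous_on ?X (\<lambda>p. N b c (fst p) (snd p) $ i $ j)" for i j
      using chD(7)[of b c i j] by (simp add: Int_commute case_prod_beta)
    then have n: "continuous_on ?X (\<lambda>p. - N b c (fst p) (snd p) $ i $ j)" for i j
      by (rule continuous_on_minus)
    have d: "continuous_on ?X (\<lambda>p. mdet (N b c (fst p) (snd p)))"
      unfolding mdet_def by (intro continuous_on_diff continuous_on_mult c)
    have nz: "\<forall>p\<in>?X. mdet (N b c (fst p) (snd p)) \<noteq> 0" using chD(3) by auto
    have "\<forall>i j. continuous_on ?X (\<lambda>p. minv (N b c (fst p) (snd p)) $ i $ j)"
      unfolding forall_2 minv_def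
      by (simp only: if_True if_False simp_thms two_neq_one_type2 vec_lambda_beta)
        (intro conjI continuous_on_divide c n d nz)
    then show "continuous_on ?X (\<lambda>(u, x). minv (N b c u x) $ i $ j)" by (simp add: case_prod_beta)
  qed
qed

section \<open>Morphisms of families as changes of frame\<close>

lemma higgs_homD:
  assumes "higgs_hom L S E f"
  shows "\<forall>c b. smooth_mat L (hdom E c \<inter> hdom S b) (hrank E) (hrank S) (f c b)"
    "\<forall>c c' b b'. \<forall>x \<in> hdom E c \<inter> hdom E c' \<inter> hdom S b \<inter> hdom S b'.
        htrans E c' c x * f c b x * htrans S b b' x = f c' b' x"
    "\<forall>c b. \<forall>x \<in> hdom E c \<inter> hdom S b.
        mat_dxbar (f c b) x + hdbar E c x * f c b x = f c b x * hdbar S b x"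
    "\<forall>c b. \<forall>x \<in> hdom E c \<inter> hdom S b. hphi E c x * f c b x = f c b x * hphi S b x"
  using assms unfolding higgs_hom_def by - (elim conjE; assumption)+

lemma hom_regular:
  assumes "family_hom L R V S G g"
  shows "regular_mat R (fbase G (fst c) \<inter> fbase S (fst b)) (fxdom G c \<inter> fxdom S b) (frank G) (frank S) (g c b)"
  using assms unfolding family_hom_def by blast

context
  fixes L R V S G g u and b c :: chart
  assumes hom: "family_hom L R V S G g" and u: "u \<in> V" "u \<in> fbase G (fst c)" "u \<in> fbase S (fst b)"
begin

lemma slice_hom: "higgs_hom L (slice S u) (slice G u) (map_slice g u)"
  using hom u unfolding family_hom_def by blast

lemma hom_smooth: "smooth_mat L (fxdom G c \<inter> fxdom S b) (frank G) (frank S) (g c b u)"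
  using higgs_homD(1)[OF slice_hom, rule_format, of c b] u by (simp add: map_slice_def)

context
  fixes x
  assumes x: "x \<in> fxdom G c" "x \<in> fxdom S b"
begin

lemma hom_carrier: "g c b u x \<in> carrier_mat (frank G) (frank S)"
  using smooth_mat_carrier[OF hom_smooth] x by blast

lemma hom_dbar: "mat_dxbar (g c b u) x + fdbar G c u x * g c b u x = g c b u x * fdbar S b u x"
  using higgs_homD(3)[OF slice_hom, rule_format, of x c b] u x by (simp add: map_slice_def)

lemma hom_phi: "fphi G c u x * g c b u x = g c b u x * fphi S b u x"
  using higgs_homD(4)[OF slice_hom, rule_format, of x c b] u x by (simp add: map_slice_def)

lemma hom_trans:
  assumes "u \<in> fbase G (fst c')" "u \<in> fbase S (fst b')" "x \<in> fxdom G c'" "x \<in> fxdom S b'"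
  shows "ftrans G c' c u x * g c b u x * ftrans S b b' u x = g c' b' u x"
  using higgs_homD(2)[OF slice_hom, rule_format, of x c c' b b'] u x assms by (simp add: map_slice_def)

end

end

text \<open>Between families of rank two, fibrewise injectivity already gives an invertible matrix
  at every point.\<close>

lemma frame_change_of_hom:
  assumes fam: "is_higgs_family L R V S" and fam': "is_higgs_family L R' V G"
    and rank: "frank S = 2" "frank G = 2" and hom: "family_hom L (Cd_smooth d) V S G g"
    and inj: "\<And>u. u \<in> V \<Longrightarrow> fibrewise_inj (slice S u) (slice G u) (map_slice g u)"
  shows "frame_change L S G (\<lambda>c b u x. m2 (g c b u x))"
  unfolding frame_change_def
proof (intro conjI allI ballI)
  fix c b :: chart and u assume "u \<in> fbase G (fst c) \<inter> fbase S (fst b)"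
  then have u: "u \<in> V" "u \<in> fbase G (fst c)" "u \<in> fbase S (fst b)" using family_base(2)[OF fam] by auto
  have sm: "smooth_mat L (fxdom G c \<inter> fxdom S b) 2 2 (g c b u)" using hom_smooth[OF hom u] rank by simp
  show "periodic_on L (fxdom G c \<inter> fxdom S b) (\<lambda>x. m2 (g c b u x))"
    using smooth_mat_periodic[OF sm] unfolding periodic_on_def by simp
  show "msmooth (fxdom G c \<inter> fxdom S b) (\<lambda>x. m2 (g c b u x))" by (rule msmooth_m2[OF sm])
  fix x assume "x \<in> fxdom G c \<inter> fxdom S b"
  then have x: "x \<in> fxdom G c" "x \<in> fxdom S b" by auto
  have car: "g c b u x \<in> carrier_mat 2 2" using hom_carrier[OF hom u x] rank by simp
  have ops: "fdbar G c u x \<in> carrier_mat 2 2" "fphi G c u x \<in> carrier_mat 2 2"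
    "fdbar S b u x \<in> carrier_mat 2 2" "fphi S b u x \<in> carrier_mat 2 2"
    using smooth_mat_carrier[OF family_operators(1)[OF fam' u(2)] x(1)]
      smooth_mat_carrier[OF family_operators(2)[OF fam' u(2)] x(1)]
      smooth_mat_carrier[OF family_operators(1)[OF fam u(3)] x(2)]
      smooth_mat_carrier[OF family_operators(2)[OF fam u(3)] x(2)] rank by simp_all
  have "fibre_kernel (g c b u x) = {0\<^sub>v 2}"
    using inj[OF u(1), unfolded fibrewise_inj_def, rule_format, of x c b] u x rank by (simp add: map_slice_def)
  then show "mdet (m2 (g c b u x)) \<noteq> 0" by (rule mdet_m2_if_inj[OF car])
  show "mdxbar (\<lambda>x. m2 (g c b u x)) x + m2 (fdbar G c u x) ** m2 (g c b u x)
      = m2 (g c b u x) ** m2 (fdbar S b u x)"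
    using arg_cong[OF hom_dbar[OF hom u x], of m2] car ops mat_dx_carrier(2)[of "g c b u" x, OF car]
      m2_mat_dx(2)[of "g c b u" x, OF car]
    by (simp add: m2_simps)
  show "m2 (fphi G c u x) ** m2 (g c b u x) = m2 (g c b u x) ** m2 (fphi S b u x)"
    using arg_cong[OF hom_phi[OF hom u x], of m2] car ops by (simp add: m2_simps)
next
  fix c c' b b' :: chart and u x
  assume "u \<in> fbase G (fst c) \<inter> fbase G (fst c') \<inter> fbase S (fst b) \<inter> fbase S (fst b')"
    and "x \<in> fxdom G c \<inter> fxdom G c' \<inter> fxdom S b \<inter> fxdom S b'"
  then have u: "u \<in> V" "u \<in> fbase G (fst c)" "u \<in> fbase S (fst b)" "u \<in> fbase G (fst c')" "u \<in> fbase S (fst b')"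
    and x: "x \<in> fxdom G c" "x \<in> fxdom S b" "x \<in> fxdom G c'" "x \<in> fxdom S b'"
    using family_base(2)[OF fam] by auto
  have car: "g c b u x \<in> carrier_mat 2 2" "ftrans G c' c u x \<in> carrier_mat 2 2" "ftrans S b b' u x \<in> carrier_mat 2 2"
    using hom_carrier[OF hom u(1-3) x(1,2)] smooth_mat_carrier[OF family_trans[OF fam' u(4,2)], of x]
      smooth_mat_carrier[OF family_trans[OF fam u(3,5)], of x] x rank by simp_all
  show "m2 (ftrans G c' c u x) ** (m2 (g c b u x) ** m2 (ftrans S b b' u x)) = m2 (g c' b' u x)"
    using arg_cong[OF hom_trans[OF hom u(1-3) x(1,2) u(4,5) x(3,4)], of m2] car
    by (simp add: m2_simps mmult_assoc)
next
  fix c b :: chart and i j :: 2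
  let ?B = "fbase G (fst c) \<inter> fbase S (fst b)" and ?D = "fxdom G c \<inter> fxdom S b"
  show "continuous_on (?B \<times> ?D) (\<lambda>(u, x). m2 (g c b u x) $ i $ j)"
  proof (cases "?B = {}")
    case False
    then obtain u where "u \<in> fbase G (fst c)" "u \<in> fbase S (fst b)" by auto
    then have "open ?D" using family_xdom(1)[OF fam] family_xdom(1)[OF fam'] by blast
    moreover have "regular_mat (Cd_smooth d) ?B ?D 2 2 (g c b)"
      using hom_regular[OF hom, of c b] rank by simp
    ultimately show ?thesis using m2_jointly_continuous by blast
  qed simp
qed

section \<open>Ranks\<close>

text \<open>If there were fewer rows than columns, zero rows could be added to make a square matrix.
  Its determinant vanishes by expansion along the added row \<open>m\<close>, and a kernel vector of
  it is a kernel vector of \<open>A\<close>.\<close>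

lemma rank_le_of_inj:
  assumes A: "A \<in> carrier_mat m n" and inj: "fibre_kernel A = {0\<^sub>v n}"
  shows "n \<le> m"
proof (rule ccontr)
  assume "\<not> n \<le> m"
  then have mn: "m < n" by simp
  define B where "B = Matrix.mat n n (\<lambda>(i, j). if i < m then A $$ (i, j) else 0)"
  have B: "B \<in> carrier_mat n n" by (simp add: B_def)
  have "Determinant.det B = (\<Sum>j<n. B $$ (m, j) * cofactor B m j)" by (rule laplace_expansion_row[OF B mn])
  also have "\<dots> = 0" using mn by (intro sum.neutral) (simp add: B_def)
  finally obtain v where v: "v \<in> carrier_vec n" "v \<noteq> 0\<^sub>v n" "B *\<^sub>v v = 0\<^sub>v n"
    using det_0_iff_vec_prod_zero[OF B] by blast
  have "A *\<^sub>v v = 0\<^sub>v m"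
  proof (rule eq_vecI)
    fix i assume i: "i < dim_vec (0\<^sub>v m)"
    then have im: "i < m" by simp
    have "row B i = row A i" using im mn A by (intro eq_vecI) (auto simp: B_def)
    then have "vec_index (A *\<^sub>v v) i = vec_index (B *\<^sub>v v) i" using im mn A B by simp
    then show "vec_index (A *\<^sub>v v) i = vec_index (0\<^sub>v m) i" using v(3) im mn by simp
  qed (use A in simp)
  then have "v \<in> fibre_kernel A" using A v by (auto simp: fibre_kernel_def)
  then show False using inj v by simp
qed

text \<open>The transpose of a surjective matrix is injective: a vector killed by the transpose is
  orthogonal to the image, hence to all unit vectors.\<close>

lemma rank_le_of_surj:
  assumes A: "A \<in> carrier_mat m n" and surj: "fibre_image A = carrier_vec m"
  shows "m \<le> n"
proof (rule rank_le_of_inj)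
  show At: "transpose_mat A \<in> carrier_mat n m" using A by simp
  have "v = 0\<^sub>v m" if v: "v \<in> carrier_vec m" "transpose_mat A *\<^sub>v v = 0\<^sub>v n" for v
  proof (rule eq_vecI)
    fix i assume "i < dim_vec (0\<^sub>v m)"
    then have i: "i < m" by simp
    have "unit_vec m i \<in> fibre_image A" using surj by simp
    then obtain w where w: "w \<in> carrier_vec n" "A *\<^sub>v w = unit_vec m i" using A unfolding fibre_image_def by auto
    have "v \<bullet> unit_vec m i = (transpose_mat A *\<^sub>v v) \<bullet> w"
      using transpose_vec_mult_scalar[OF A w(1) v(1)] w(2) by simp
    also have "\<dots> = 0" using v(2) w(1) by simp
    finally show "vec_index v i = vec_index (0\<^sub>v m) i" using v(1) i by simp
  qed (use v in simp)
  moreover have "transpose_mat A *\<^sub>v 0\<^sub>v m = 0\<^sub>v n"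
    using A by (intro eq_vecI) auto
  ultimately show "fibre_kernel (transpose_mat A) = {0\<^sub>v m}" using A unfolding fibre_kernel_def by auto
qed

section \<open>An invariant line subbundle does not exist\<close>

text \<open>The quotient of \<open>\<sigma>\<close> by the half-angle root takes only the values
  \<open>1\<close> and \<open>-1\<close>, so it is constant on the interval. The half-angle root
  changes sign after a full turn while \<open>\<sigma>\<close> does not.\<close>

lemma no_continuous_sqrt_on_circle:
  assumes cont: "continuous_on X \<sigma>" and sq: "\<And>z. z \<in> X \<Longrightarrow> (\<sigma> z)\<^sup>2 = z"
    and \<rho>: "\<rho> > 0" "sphere (0 :: complex) \<rho> \<subseteq> X"
  shows False
proof -
  define h where "h t = \<sigma> (of_real \<rho> * cis t) / (of_real (sqrt \<rho>) * cis (t / 2))" for t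
  have inX: "of_real \<rho> * cis t \<in> X" for t using \<rho> by (auto simp: norm_mult)
  have nz: "of_real (sqrt \<rho>) * cis (t / 2) \<noteq> 0" for t using \<rho> by simp
  have "continuous_on {0..2*pi} (\<lambda>t. \<sigma> (of_real \<rho> * cis t))"
    by (rule continuous_on_compose2[OF cont]) (use inX in \<open>auto intro!: continuous_intros\<close>)
  then have "continuous_on {0..2*pi} h"
    unfolding h_def using nz by (intro continuous_on_divide continuous_intros) auto
  then have conn: "connected (h ` {0..2*pi})" by (intro connected_continuous_image) auto
  have pm: "h t = 1 \<or> h t = -1" for t
  proof -
    have "(of_real (sqrt \<rho>) * cis (t / 2))\<^sup>2 = of_real \<rho> * cis t"
    proof -
      have "(of_real (sqrt \<rho>))\<^sup>2 = (of_real \<rho> :: complex)"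
        using \<rho>(1) by (metis less_imp_le of_real_power real_sqrt_pow2)
      moreover have "(cis (t / 2))\<^sup>2 = cis t" by (simp add: Complex.DeMoivre)
      ultimately show ?thesis by (simp add: power_mult_distrib)
    qed
    then have "(h t)\<^sup>2 = 1"
      unfolding h_def power_divide sq[OF inX] using \<rho>(1) by simp
    then show ?thesis by (simp add: power2_eq_1_iff)
  qed
  have "h ` {0..2*pi} \<subseteq> {1, -1}" using pm by blast
  then have "finite (h ` {0..2*pi})" by (rule finite_subset) simp
  moreover have mem: "h 0 \<in> h ` {0..2*pi}" "h (2*pi) \<in> h ` {0..2*pi}" by (auto intro!: imageI)
  ultimately obtain k where "h ` {0..2*pi} = {k}" using connected_finite_iff_sing[OF conn] by blast
  then have "h 0 = h (2*pi)" using mem by simp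
  moreover have "h (2*pi) = - h 0" by (simp add: h_def)
  ultimately show False using pm[of 0] by auto
qed

definition mscale :: "complex \<Rightarrow> cmat \<Rightarrow> cmat" where
  "mscale t M = (\<chi> i j. t * M $ i $ j)"

lemma mscale_nth [simp]: "mscale t M $ i $ j = t * M $ i $ j"
  by (simp add: mscale_def)

lemma mmult_mscale: "M ** mscale t N = mscale t (M ** N)"
  by (simp add: cmat_eq_iff mmult_nth algebra_simps)

text \<open>An invariant line is spanned by an eigenvector \<open>(1, s)\<close> with \<open>s\<^sup>2 = u\<close>, so \<open>s\<close> is a continuous square
  root on a punctured neighbourhood of \<open>0\<close>.\<close>

lemma no_line_subbundle:
  assumes fam: "is_higgs_family L R V G" and fr: "theta_frame L \<alpha> G f"
    and famS: "is_higgs_family L R' V S" and hom: "family_hom L (Cd_smooth d) V S G g"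
    and inj: "\<And>u. u \<in> V \<Longrightarrow> fibrewise_inj (slice S u) (slice G u) (map_slice g u)"
    and "0 \<in> V" "\<alpha> \<noteq> 0"
  shows "frank S \<noteq> 1"
proof
  assume rank1: "frank S = 1"
  note frD = theta_frameD[OF fr]
  \<comment> \<open>The line is followed over the single point \<open>0\<close> of X. The pairs of
    charts that matter are those containing it.\<close>
  define at0 where "at0 c b u \<longleftrightarrow> u \<in> fbase G (fst c) \<and> u \<in> fbase S (fst b) \<and> 0 \<in> fxdom G c \<and> 0 \<in> fxdom S b"
    for c b :: chart and u
  have at0D: "u \<in> V" "u \<in> fbase G (fst c)" "u \<in> fbase S (fst b)" "0 \<in> fxdom G c" "0 \<in> fxdom S b"
    if "at0 c b u" for c b u
    using that family_base(2)[OF fam] unfolding at0_def by auto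
  have chart: "\<exists>c b. at0 c b u" if "u \<in> V" for u
    using family_chart_exists[OF fam that, of 0] family_chart_exists[OF famS that, of 0] unfolding at0_def by metis
  \<comment> \<open>\<open>W\<close> holds the vector spanning the line in both of its columns.
    \<open>Y\<close> expresses it in the frame \<open>f\<close>, where the Higgs field is
    \<open>Theta \<alpha> u\<close>.\<close>
  define W :: "chart \<Rightarrow> chart \<Rightarrow> complex \<Rightarrow> cmat" where "W c b u = (\<chi> i j. g c b u 0 $$ (idx i, 0))" for c b u
  define Y where "Y c b u = minv (f c u 0) ** W c b u" for c b u
  have car: "g c b u 0 \<in> carrier_mat 2 1" if "at0 c b u" for c b u
    using hom_carrier[OF hom at0D(1-3)[OF that] at0D(4,5)[OF that]] rank1 frD(1) by simp
  have fY: "f c u 0 ** Y c b u = W c b u" if "at0 c b u" for c b u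
    unfolding Y_def by (rule minv_cancel(2)[OF frD(4)[OF at0D(2,4)[OF that]]])
  have W0: "W c b u $ 1 $ 1 \<noteq> 0 \<or> W c b u $ 2 $ 1 \<noteq> 0" if a: "at0 c b u" for c b u
  proof (rule ccontr)
    assume "\<not> ?thesis"
    then have "g c b u 0 $$ (0, 0) = 0" "g c b u 0 $$ (1, 0) = 0" by (simp_all add: W_def)
    then have "g c b u 0 *\<^sub>v unit_vec 1 0 = 0\<^sub>v 2"
      using car[OF a] by (intro eq_vecI) (auto simp: scalar_prod_def numeral_2_eq_2 less_Suc_eq)
    then have "unit_vec 1 0 \<in> fibre_kernel (g c b u 0)" using car[OF a] by (auto simp: fibre_kernel_def)
    moreover have "fibre_kernel (g c b u 0) = {0\<^sub>v 1}"
      using inj[OF at0D(1)[OF a], unfolded fibrewise_inj_def, rule_format, of 0 c b] at0D[OF a] rank1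
      by (simp add: map_slice_def)
    ultimately have "(unit_vec 1 0 :: complex Matrix.vec) = 0\<^sub>v 1" by simp
    then have "vec_index (unit_vec 1 0 :: complex Matrix.vec) 0 = vec_index (0\<^sub>v 1) 0" by simp
    then show False by simp
  qed
  have Y0: "Y c b u $ 1 $ 1 \<noteq> 0 \<or> Y c b u $ 2 $ 1 \<noteq> 0" if a: "at0 c b u" for c b u
  proof (rule ccontr)
    assume "\<not> ?thesis"
    then have "(f c u 0 ** Y c b u) $ i $ 1 = 0" for i by (simp add: mmult_nth)
    then show False using W0[OF a] fY[OF a] by simp
  qed
  have eigen: "Theta \<alpha> u ** Y c b u = mscale (fphi S b u 0 $$ (0, 0)) (Y c b u)" if a: "at0 c b u" for c b u
  proof (rule mmult_left_cancel[OF frD(4)[OF at0D(2,4)[OF a]]])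
    have cars: "fphi G c u 0 \<in> carrier_mat 2 2" "fphi S b u 0 \<in> carrier_mat 1 1"
      using smooth_mat_carrier[OF family_operators(2)[OF fam at0D(2)[OF a]] at0D(4)[OF a]]
        smooth_mat_carrier[OF family_operators(2)[OF famS at0D(3)[OF a]] at0D(5)[OF a]] frD(1) rank1 by simp_all
    have "fphi G c u 0 * g c b u 0 = g c b u 0 * fphi S b u 0"
      by (rule hom_phi[OF hom at0D[OF a]])
    note eq = this
    have "fphi G c u 0 $$ (i, 0) * g c b u 0 $$ (0, 0) + fphi G c u 0 $$ (i, 1) * g c b u 0 $$ (1, 0)
        = g c b u 0 $$ (i, 0) * fphi S b u 0 $$ (0, 0)" if "i < 2" for i
      using arg_cong[OF eq, of "\<lambda>M. M $$ (i, 0)"] car[OF a] cars that by (simp add: scalar_prod_def numeral_2_eq_2)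
    from this[of 0] this[of 1]
    have "m2 (fphi G c u 0) ** W c b u = mscale (fphi S b u 0 $$ (0, 0)) (W c b u)"
      by (simp add: cmat_eq_iff mmult_nth W_def mult.commute)
    then have "m2 (fphi G c u 0) ** (f c u 0 ** Y c b u) = mscale (fphi S b u 0 $$ (0, 0)) (f c u 0 ** Y c b u)"
      using fY[OF a] by simp
    moreover have "m2 (fphi G c u 0) ** (f c u 0 ** Y c b u) = f c u 0 ** (Theta \<alpha> u ** Y c b u)"
      using arg_cong[OF frD(6)[OF at0D(2,4)[OF a]], of "\<lambda>M. M ** Y c b u"] by (simp add: mmult_assoc)
    ultimately show "f c u 0 ** (Theta \<alpha> u ** Y c b u) = f c u 0 ** mscale (fphi S b u 0 $$ (0, 0)) (Y c b u)"
      by (simp add: mmult_mscale)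
  qed
  \<comment> \<open>As \<open>S\<close> has rank one, a change of charts only rescales the spanning
    vector; the ratio of its components depends on the line alone.\<close>
  have Y_change: "\<exists>t. Y c' b' u = mscale t (Y c b u)" if a: "at0 c b u" and a': "at0 c' b' u" for c b c' b' u
  proof -
    define t where "t = ftrans S b b' u 0 $$ (0, 0)"
    have cars: "ftrans G c' c u 0 \<in> carrier_mat 2 2" "ftrans S b b' u 0 \<in> carrier_mat 1 1"
      using smooth_mat_carrier[OF family_trans[OF fam at0D(2)[OF a'] at0D(2)[OF a]], of 0]
        smooth_mat_carrier[OF family_trans[OF famS at0D(3)[OF a] at0D(3)[OF a']], of 0]
        at0D(4,5)[OF a] at0D(4,5)[OF a'] frD(1) rank1 by simp_all
    have "ftrans G c' c u 0 * g c b u 0 * ftrans S b b' u 0 = g c' b' u 0"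
      by (rule hom_trans[OF hom at0D[OF a] at0D(2,3)[OF a'] at0D(4,5)[OF a']])
    note eq = this
    have "(ftrans G c' c u 0 $$ (i, 0) * g c b u 0 $$ (0, 0) + ftrans G c' c u 0 $$ (i, 1) * g c b u 0 $$ (1, 0))
        * t = g c' b' u 0 $$ (i, 0)" if "i < 2" for i
      using arg_cong[OF eq, of "\<lambda>M. M $$ (i, 0)"] car[OF a] cars that by (simp add: scalar_prod_def numeral_2_eq_2 t_def)
    from this[of 0] this[of 1]
    have "W c' b' u = mscale t (m2 (ftrans G c' c u 0) ** W c b u)"
      by (simp add: cmat_eq_iff mmult_nth W_def mult.commute)
    also have "\<dots> = f c' u 0 ** mscale t (Y c b u)"
      using arg_cong[OF frD(7)[OF at0D(2)[OF a'] at0D(2)[OF a] at0D(4)[OF a'] at0D(4)[OF a]], of "\<lambda>M. M ** Y c b u"]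
      by (simp add: fY[OF a, symmetric] mmult_mscale mmult_assoc)
    finally have "f c' u 0 ** Y c' b' u = f c' u 0 ** mscale t (Y c b u)" using fY[OF a'] by simp
    then show ?thesis using mmult_left_cancel[OF frD(4)[OF at0D(2,4)[OF a']]] by blast
  qed
  have Y1: "Y c b u $ 1 $ 1 \<noteq> 0" "(Y c b u $ 2 $ 1 / Y c b u $ 1 $ 1)\<^sup>2 = u" if a: "at0 c b u" and "u \<noteq> 0" for c b u
  proof -
    define \<mu> where "\<mu> = fphi S b u 0 $$ (0, 0)"
    define y1 where "y1 = Y c b u $ 1 $ 1"
    define y2 where "y2 = Y c b u $ 2 $ 1"
    have e1: "\<alpha> * u * y2 = \<mu> * y1" and e2: "\<alpha> * u\<^sup>2 * y1 = \<mu> * y2"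
      using eigen[OF a] unfolding cmat_eq_iff mmult_nth Theta_def by (simp_all add: \<mu>_def y1_def y2_def)
    \<comment> \<open>For \<open>u \<noteq> 0\<close>, a vanishing first component would force the
      second to vanish by \<open>e1\<close>.\<close>
    have y1: "y1 \<noteq> 0" using e1 Y0[OF a] \<open>\<alpha> \<noteq> 0\<close> \<open>u \<noteq> 0\<close> unfolding y1_def y2_def by auto
    then show "Y c b u $ 1 $ 1 \<noteq> 0" by (simp add: y1_def)
    have "\<alpha> * u * (u * y1 * y1) = \<alpha> * u\<^sup>2 * y1 * y1" by (simp add: power2_eq_square)
    also have "\<dots> = \<mu> * y1 * y2" using e2 by simp
    also have "\<dots> = \<alpha> * u * (y2 * y2)" unfolding e1[symmetric] by simp
    finally have "u * y1 * y1 = y2 * y2" using \<open>\<alpha> \<noteq> 0\<close> \<open>u \<noteq> 0\<close> by simp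
    then have "(y2 / y1)\<^sup>2 = u" using y1 by (simp add: power2_eq_square field_simps)
    then show "(Y c b u $ 2 $ 1 / Y c b u $ 1 $ 1)\<^sup>2 = u" by (simp add: y1_def y2_def)
  qed
  \<comment> \<open>The slope of the invariant line. It is controlled only away from
    \<open>u = 0\<close>, where \<open>Theta\<close> vanishes and every line is invariant.\<close>
  define \<sigma> where "\<sigma> u = (let (c, b) = SOME (c, b). at0 c b u in Y c b u $ 2 $ 1 / Y c b u $ 1 $ 1)" for u
  have \<sigma>: "\<sigma> u = Y c b u $ 2 $ 1 / Y c b u $ 1 $ 1" if a: "at0 c b u" and "u \<noteq> 0" for c b u
  proof -
    obtain c0 b0 where cb: "(SOME (c, b). at0 c b u) = (c0, b0)" by (rule prod.exhaust)
    have "case (SOME (c, b). at0 c b u) of (c, b) \<Rightarrow> at0 c b u" by (rule someI[of _ "(c, b)"]) (use a in simp)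
    then have a0: "at0 c0 b0 u" unfolding cb by simp
    obtain t where t: "Y c b u = mscale t (Y c0 b0 u)" using Y_change[OF a0 a] by blast
    have "t \<noteq> 0" using Y1(1)[OF a \<open>u \<noteq> 0\<close>] unfolding t by auto
    then show ?thesis unfolding \<sigma>_def cb Let_def t by simp
  qed
  have "\<exists>T. open T \<and> u \<in> T \<and> continuous_on ((V - {0}) \<inter> T) \<sigma>" if uV: "u \<in> V - {0}" for u
  proof -
    obtain c b where a: "at0 c b u" using chart[of u] uV by auto
    let ?T = "fbase G (fst c) \<inter> fbase S (fst b)"
    have a': "at0 c b w" if "w \<in> ?T" for w using a that unfolding at0_def by simp
    have f: "continuous_on ?T (\<lambda>w. f c w 0 $ i $ j)" for i j
      by (rule continuous_on_compose2[OF frD(8)[of c i j], where f = "\<lambda>w. (w, 0)", simplified])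
        (use at0D(4)[OF a] in \<open>auto intro!: continuous_intros\<close>)
    have "Cd_smooth d ?T (fxdom G c \<inter> fxdom S b) (\<lambda>u x. g c b u x $$ (idx i, 0))" for i
      using hom_regular[OF hom, of c b] rank1 frD(1) unfolding regular_mat_def by simp
    moreover have "open (fxdom G c \<inter> fxdom S b)"
      using family_xdom(1)[OF fam at0D(2)[OF a]] family_xdom(1)[OF famS at0D(3)[OF a]] by blast
    ultimately have gc: "continuous_on (?T \<times> (fxdom G c \<inter> fxdom S b)) (\<lambda>(u, x). g c b u x $$ (idx i, 0))" for i
      using cont_smooth_jointly_continuous Cd_smooth_imp_cont_smooth by blast
    have g: "continuous_on ?T (\<lambda>w. W c b w $ i $ j)" for i j
    proof -
      have "continuous_on ?T (\<lambda>w. case (w, 0) of (u, x) \<Rightarrow> g c b u x $$ (idx i, 0))"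
        by (rule continuous_on_compose2[OF gc[of i]])
          (use at0D(4,5)[OF a] in \<open>auto intro!: continuous_intros\<close>)
      then show ?thesis by (simp add: W_def)
    qed
    have det: "mdet (f c w 0) \<noteq> 0" if "w \<in> ?T" for w using frD(4)[OF at0D(2,4)[OF a'[OF that]]] .
    have "continuous_on ?T (\<lambda>w. minv (f c w 0) $ i $ j)" for i j
    proof -
      have n: "continuous_on ?T (\<lambda>w. - f c w 0 $ i $ j)" for i j by (rule continuous_on_minus[OF f])
      have d: "continuous_on ?T (\<lambda>w. mdet (f c w 0))"
        unfolding mdet_def by (intro continuous_on_diff continuous_on_mult f)
      have nz: "\<forall>w\<in>?T. mdet (f c w 0) \<noteq> 0" using det by blast
      have "\<forall>i j. continuous_on ?T (\<lambda>w. minv (f c w 0) $ i $ j)"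
        unfolding forall_2 minv_def
        by (simp only: if_True if_False simp_thms two_neq_one_type2 vec_lambda_beta)
          (intro conjI continuous_on_divide f n d nz)
      then show ?thesis by blast
    qed
    then have Yc: "continuous_on ?T (\<lambda>w. Y c b w $ i $ j)" for i j
      unfolding Y_def mmult_nth by (intro continuous_on_add continuous_on_mult g)
    have "continuous_on ((V - {0}) \<inter> ?T) (\<lambda>w. Y c b w $ 2 $ 1 / Y c b w $ 1 $ 1)"
      using Y1(1)[OF a'] by (intro continuous_on_divide continuous_on_subset[OF Yc]) auto
    then have "continuous_on ((V - {0}) \<inter> ?T) \<sigma>"
      by (rule continuous_on_eq) (use \<sigma>[OF a'] in simp)
    moreover have "open ?T" using family_base(1)[OF fam] family_base(1)[OF famS] by blast
    ultimately show ?thesis using at0D(2,3)[OF a] by blast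
  qed
  then have cont: "continuous_on (V - {0}) \<sigma>" by (rule continuous_on_locally)
  have "open V" using is_higgs_familyD(1,2)[OF fam] by blast
  then obtain e where e: "e > 0" "cball 0 e \<subseteq> V" using \<open>0 \<in> V\<close> open_contains_cball by blast
  show False
  proof (rule no_continuous_sqrt_on_circle[OF cont _ e(1)])
    show "(\<sigma> z)\<^sup>2 = z" if z: "z \<in> V - {0}" for z
    proof -
      obtain c b where a: "at0 c b z" using chart[of z] z by auto
      show ?thesis using \<sigma>[OF a] Y1(2)[OF a] z by simp
    qed
    show "sphere 0 e \<subseteq> V - {0}" using e by auto
  qed
qed

section \<open>Extensions and filtrations\<close>

lemma fibre_image_no_columns:
  assumes "A \<in> carrier_mat m 0"
  shows "fibre_image A = {0\<^sub>v m}"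
proof -
  have zero: "A *\<^sub>v v = 0\<^sub>v m" if "v \<in> carrier_vec 0" for v
    using assms that by (intro eq_vecI) (auto simp: scalar_prod_def)
  have "fibre_image A = (\<lambda>v. 0\<^sub>v m) ` (carrier_vec 0 :: complex Matrix.vec set)"
    unfolding fibre_image_def carrier_matD(2)[OF assms] by (rule image_cong[OF refl zero])
  then show ?thesis using image_constant[OF zero_carrier_vec[of 0]] by metis
qed

context
  fixes L R R' V S G d g
  assumes fam: "is_higgs_family L R V S" and fam': "is_higgs_family L R' V G"
    and hom: "family_hom L (Cd_smooth d) V S G g" and V: "0 \<in> V"
begin

text \<open>The rank is the same on all slices, so one fibre over the parameter \<open>0\<close>
  decides.\<close>

lemma frank_le_of_inj:
  assumes "\<And>u. u \<in> V \<Longrightarrow> fibrewise_inj (slice S u) (slice G u) (map_slice g u)"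
  shows "frank S \<le> frank G"
proof -
  obtain b where b: "0 \<in> fbase S (fst b)" "0 \<in> fxdom S b" using family_chart_exists[OF fam V] by metis
  obtain c where c: "0 \<in> fbase G (fst c)" "0 \<in> fxdom G c" using family_chart_exists[OF fam' V] by metis
  show ?thesis
    by (rule rank_le_of_inj[OF hom_carrier[OF hom V c(1) b(1) c(2) b(2)]])
      (use assms[OF V, unfolded fibrewise_inj_def, rule_format, of 0 c b] b c in \<open>simp add: map_slice_def\<close>)
qed

lemma frank_le_of_surj:
  assumes "\<And>u. u \<in> V \<Longrightarrow> fibrewise_surj (slice S u) (slice G u) (map_slice g u)"
  shows "frank G \<le> frank S"
proof -
  obtain b where b: "0 \<in> fbase S (fst b)" "0 \<in> fxdom S b" using family_chart_exists[OF fam V] by metis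
  obtain c where c: "0 \<in> fbase G (fst c)" "0 \<in> fxdom G c" using family_chart_exists[OF fam' V] by metis
  show ?thesis
    by (rule rank_le_of_surj[OF hom_carrier[OF hom V c(1) b(1) c(2) b(2)]])
      (use assms[OF V, unfolded fibrewise_surj_def, rule_format, of 0 c b] b c in \<open>simp add: map_slice_def\<close>)
qed

lemma theta_frame_push:
  assumes fr: "theta_frame L \<alpha> S f"
    and inj: "\<And>u. u \<in> V \<Longrightarrow> fibrewise_inj (slice S u) (slice G u) (map_slice g u)"
    and surj: "\<And>u. u \<in> V \<Longrightarrow> fibrewise_surj (slice S u) (slice G u) (map_slice g u)"
  shows "\<exists>f'. theta_frame L \<alpha> G f'"
proof -
  have S: "frank S = 2" by (rule theta_frameD(1)[OF fr])
  then have G: "frank G = 2" using frank_le_of_inj[OF inj] frank_le_of_surj[OF surj] by simp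
  show ?thesis
    by (rule theta_frame_transport[OF fam fam' fr frame_change_of_hom[OF fam fam' S G hom inj] G])
qed

text \<open>In rank two an injective morphism is an isomorphism, and the frame travels backwards
  along its inverse.\<close>

lemma theta_frame_pull:
  assumes fr: "theta_frame L \<alpha> G f" and S: "frank S = 2"
    and inj: "\<And>u. u \<in> V \<Longrightarrow> fibrewise_inj (slice S u) (slice G u) (map_slice g u)"
  shows "\<exists>f'. theta_frame L \<alpha> S f'"
proof -
  have G: "frank G = 2" by (rule theta_frameD(1)[OF fr])
  show ?thesis
    by (rule theta_frame_transport[OF fam' fam fr
          frame_change_inverse[OF fam fam' frame_change_of_hom[OF fam fam' S G hom inj] S G] S])
qed

end

lemma prestack_family: "prestack_Dol L d V G \<Longrightarrow> is_higgs_family L (Cd_smooth d) V G"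
  by (erule prestack_Dol.cases) auto

text \<open>Induction over the generation of the prestack, for all families with a frame at once. In
  an extension the subfamily has rank 0 or 2, rank 1 being excluded by the square root. Accordingly
  the quotient or the subfamily is isomorphic to the whole, inherits a frame, and the induction
  hypothesis refutes it.\<close>

lemma prestack_no_theta_frame:
  assumes "prestack_Dol L d V G" "0 \<in> V" "\<alpha> \<noteq> 0" "is_lattice L"
  shows "\<not> theta_frame L \<alpha> G f"
  using assms(1)
proof (induction arbitrary: f rule: prestack_Dol.induct)
  case (harmonic G)
  then show ?case using no_continuous_harmonic_metric[OF harmonic(1) _ assms(2-4)] by blast
next
  case (extension S Q G)
  show ?case
  proof
    assume fr: "theta_frame L \<alpha> G f"
    have famS: "is_higgs_family L (Cd_smooth d) V S" and famQ: "is_higgs_family L (Cd_smooth d) V Q"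
      using extension.hyps prestack_family by blast+
    note famG = extension.hyps(3)
    have rG: "frank G = 2" by (rule theta_frameD(1)[OF fr])
    obtain g h where g: "family_hom L (Cd_smooth d) V S G g" and h: "family_hom L (Cd_smooth d) V G Q h"
      and ex: "\<forall>u\<in>V. fibrewise_inj (slice S u) (slice G u) (map_slice g u) \<and>
                fibrewise_surj (slice G u) (slice Q u) (map_slice h u) \<and>
                (\<forall>b c q. \<forall>x \<in> hdom (slice S u) b \<inter> hdom (slice G u) c \<inter> hdom (slice Q u) q.
                   fibre_image (g c b u x) = fibre_kernel (h q c u x))"
      using extension.hyps(4) unfolding short_exact_def by blast
    have inj: "fibrewise_inj (slice S u) (slice G u) (map_slice g u)"
      and surj: "fibrewise_surj (slice G u) (slice Q u) (map_slice h u)" if "u \<in> V" for u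
      using ex that by blast+
    have "frank S \<le> 2" using frank_le_of_inj[OF famS famG g assms(2) inj] rG by simp
    moreover have "frank S \<noteq> 1"
      by (rule no_line_subbundle[OF famG fr famS g inj assms(2,3)])
    ultimately consider "frank S = 0" | "frank S = 2" by linarith
    then show False
    proof cases
      case 1
      \<comment> \<open>By exactness the kernel of \<open>h\<close> is the image of a matrix without
        columns, which is zero.\<close>
      have "fibrewise_inj (slice G u) (slice Q u) (map_slice h u)" if u: "u \<in> V" for u
        unfolding fibrewise_inj_def
      proof (intro allI ballI)
        fix q c x assume x: "x \<in> hdom (slice Q u) q \<inter> hdom (slice G u) c"
        obtain b where b: "u \<in> fbase S (fst b)" "x \<in> fxdom S b" using family_chart_exists[OF famS u] by metis
        have x': "u \<in> fbase Q (fst q)" "x \<in> fxdom Q q" "u \<in> fbase G (fst c)" "x \<in> fxdom G c"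
          using x by (auto split: if_splits)
        have "fibre_image (g c b u x) = fibre_kernel (h q c u x)"
          using ex[rule_format, OF u, THEN conjunct2, THEN conjunct2, rule_format, of x b c q] b x' by simp
        moreover have "g c b u x \<in> carrier_mat 2 0"
          using hom_carrier[OF g u x'(3) b(1) x'(4) b(2)] 1 rG by simp
        ultimately show "fibre_kernel (map_slice h u q c x) = {0\<^sub>v (hrank (slice G u))}"
          using fibre_image_no_columns rG by (simp add: map_slice_def)
      qed
      then have "\<exists>f'. theta_frame L \<alpha> Q f'"
        using theta_frame_push[OF famG famQ h assms(2) fr _ surj] by blast
      then show False using extension.IH(2) by blast
    next
      case 2
      have "\<exists>f'. theta_frame L \<alpha> S f'" by (rule theta_frame_pull[OF famS famG g assms(2) fr 2 inj])
      then show False using extension.IH(1) by blast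
    qed
  qed
qed

text \<open>Consider the first member of rank 2. Its predecessor cannot have rank 1 and so has rank
  0. The graded piece between them is then isomorphic to the whole family, and it would carry a
  continuous harmonic metric.\<close>

lemma no_harmonic_filtration:
  assumes famG: "is_higgs_family L R V G" and fr: "theta_frame L \<alpha> G f"
    and V: "0 \<in> V" and "\<alpha> \<noteq> 0" "is_lattice L"
  shows "\<not> admits_harmonic_filtration L (Cd_smooth d) V G"
proof
  assume "admits_harmonic_filtration L (Cd_smooth d) V G"
  then obtain l F j where sub: "\<forall>i\<le>l. higgs_subbundle L (Cd_smooth d) V (F i) G (j i)"
    and ends: "frank (F 0) = 0" "frank (F l) = frank G"
    and quot: "\<forall>i<l. subbundle_le V G (F i) (j i) (F (Suc i)) (j (Suc i)) \<and>
           (\<exists>Q. is_quotient L (Cd_smooth d) V G (F i) (j i) (F (Suc i)) (j (Suc i)) Q \<and>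
                admits_harmonic_metric L (Cd_smooth d) V Q)"
    unfolding admits_harmonic_filtration_def by (elim exE conjE)
  have rG: "frank G = 2" by (rule theta_frameD(1)[OF fr])
  have famF: "is_higgs_family L (Cd_smooth d) V (F i)" and homF: "family_hom L (Cd_smooth d) V (F i) G (j i)"
    and injF: "\<And>u. u \<in> V \<Longrightarrow> fibrewise_inj (slice (F i) u) (slice G u) (map_slice (j i) u)"
    if "i \<le> l" for i
    using sub that unfolding higgs_subbundle_def by blast+
  define m where "m = (LEAST i. frank (F i) = 2)"
  have m: "frank (F m) = 2" "m \<le> l"
    unfolding m_def using ends rG LeastI[of "\<lambda>i. frank (F i) = 2" l] Least_le[of "\<lambda>i. frank (F i) = 2" l] by auto
  have "m \<noteq> 0" using m(1) ends(1) by (metis zero_neq_numeral)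
  then obtain k where k: "m = Suc k" using not0_implies_Suc by blast
  then have kl: "k \<le> l" "k < l" "Suc k \<le> l" using m by auto
  have "frank (F k) \<noteq> 2" using not_less_Least[of k "\<lambda>i. frank (F i) = 2"] k m_def by simp
  moreover have "frank (F k) \<le> 2"
    using frank_le_of_inj[OF famF[OF kl(1)] famG homF[OF kl(1)] V injF[OF kl(1)]] rG by simp
  moreover have "frank (F k) \<noteq> 1"
    by (rule no_line_subbundle[OF famG fr famF[OF kl(1)] homF[OF kl(1)] injF[OF kl(1)] V assms(4)])
  ultimately have r0: "frank (F k) = 0" by linarith
  have rS: "frank (F (Suc k)) = 2" using m(1) k by simp
  obtain f1 where fr1: "theta_frame L \<alpha> (F (Suc k)) f1"
    using theta_frame_pull[OF famF[OF kl(3)] famG homF[OF kl(3)] V fr rS injF[OF kl(3)]] by blast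
  obtain Q where Q: "is_quotient L (Cd_smooth d) V G (F k) (j k) (F (Suc k)) (j (Suc k)) Q"
    and harm: "admits_harmonic_metric L (Cd_smooth d) V Q"
    using quot kl(2) by blast
  obtain p where famQ: "is_higgs_family L (Cd_smooth d) V Q"
    and p: "family_hom L (Cd_smooth d) V (F (Suc k)) Q p"
    and ker: "\<forall>u\<in>V. fibrewise_surj (slice (F (Suc k)) u) (slice Q u) (map_slice p u) \<and>
           (\<forall>c b b' q. \<forall>x \<in> hdom (slice G u) c \<inter> hdom (slice (F k) u) b
                              \<inter> hdom (slice (F (Suc k)) u) b' \<inter> hdom (slice Q u) q.
              fibre_kernel (p q b' u x)
                = {v \<in> carrier_vec (frank (F (Suc k))). j (Suc k) c b' u x *\<^sub>v v \<in> fibre_image (j k c b u x)})"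
    using Q unfolding is_quotient_def by blast
  have inj: "fibrewise_inj (slice (F (Suc k)) u) (slice Q u) (map_slice p u)" if u: "u \<in> V" for u
    unfolding fibrewise_inj_def
  proof (intro allI ballI)
    fix q b' x assume "x \<in> hdom (slice Q u) q \<inter> hdom (slice (F (Suc k)) u) b'"
    then have x: "u \<in> fbase Q (fst q)" "x \<in> fxdom Q q" "u \<in> fbase (F (Suc k)) (fst b')" "x \<in> fxdom (F (Suc k)) b'"
      by (auto split: if_splits)
    obtain b where b: "u \<in> fbase (F k) (fst b)" "x \<in> fxdom (F k) b"
      using family_chart_exists[OF famF[OF kl(1)] u] by metis
    obtain c where c: "u \<in> fbase G (fst c)" "x \<in> fxdom G c" using family_chart_exists[OF famG u] by metis
    have car: "j k c b u x \<in> carrier_mat 2 0" "j (Suc k) c b' u x \<in> carrier_mat 2 2"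
      using hom_carrier[OF homF[OF kl(1)] u c(1) b(1) c(2) b(2)]
        hom_carrier[OF homF[OF kl(3)] u c(1) x(3) c(2) x(4)] rG r0 rS by simp_all
    have "fibre_kernel (p q b' u x)
        = {v \<in> carrier_vec (frank (F (Suc k))). j (Suc k) c b' u x *\<^sub>v v \<in> fibre_image (j k c b u x)}"
      using ker[rule_format, OF u, THEN conjunct2, rule_format, of x c b b' q] b c x by simp
    \<comment> \<open>The predecessor has the zero image, so the kernel of the quotient map is that
      of the inclusion.\<close>
    also have "\<dots> = fibre_kernel (j (Suc k) c b' u x)"
      unfolding fibre_image_no_columns[OF car(1)] using car(2) rS by (auto simp: fibre_kernel_def)
    also have "\<dots> = {0\<^sub>v 2}"
      using injF[OF kl(3) u, unfolded fibrewise_inj_def, rule_format, of x c b'] c x rS by (simp add: map_slice_def)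
    finally show "fibre_kernel (map_slice p u q b' x) = {0\<^sub>v (hrank (slice (F (Suc k)) u))}"
      using rS by (simp add: map_slice_def)
  qed
  have surj: "fibrewise_surj (slice (F (Suc k)) u) (slice Q u) (map_slice p u)" if "u \<in> V" for u
    using ker that by blast
  obtain f2 where "theta_frame L \<alpha> Q f2"
    using theta_frame_push[OF famF[OF kl(3)] famQ p V fr1 inj surj] by blast
  then show False using no_continuous_harmonic_metric[OF famQ _ V assms(4,5)] harm by blast
qed

section \<open>The family\<close>

lemma entire_periodic_constant:
  assumes "is_lattice L" "a holomorphic_on UNIV" "periodic_on L UNIV a"
  obtains \<alpha> where "a = (\<lambda>x. \<alpha>)"
proof -
  obtain w1 w2 where L: "lattice_basis L w1 w2" using assms(1) unfolding is_lattice_def by blast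
  have "continuous_on UNIV a" using assms(2) by (rule holomorphic_on_imp_continuous_on)
  then have "continuous_on UNIV (\<lambda>x. norm (a x))" by (rule continuous_on_norm)
  moreover have "periodic_on L UNIV (\<lambda>x. norm (a x))" using assms(3) by (simp add: periodic_on_def)
  ultimately obtain p where p: "\<And>y. norm (a y) \<le> norm (a p)" using periodic_attains_max[OF L] by blast
  then have "bounded (range a)" by (auto intro!: boundedI)
  then have "a constant_on UNIV" using Liouville_theorem assms(2) by blast
  then obtain \<alpha> where "\<And>x. a x = \<alpha>" unfolding constant_on_def by auto
  then show ?thesis using that by blast
qed

definition theta_mat :: "complex \<Rightarrow> complex \<Rightarrow> complex mat" where
  "theta_mat \<alpha> z = \<alpha> \<cdot>\<^sub>m mat_of_rows_list 2 [[0, z], [z\<^sup>2, 0]]"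

lemma theta_mat_carrier [simp]: "theta_mat \<alpha> z \<in> carrier_mat 2 2"
  by (rule carrier_matI) (simp_all add: theta_mat_def mat_of_rows_list_def)

lemma theta_mat_index [simp]: "theta_mat \<alpha> z $$ (0, 0) = 0" "theta_mat \<alpha> z $$ (0, Suc 0) = \<alpha> * z"
  "theta_mat \<alpha> z $$ (Suc 0, 0) = \<alpha> * z\<^sup>2" "theta_mat \<alpha> z $$ (Suc 0, Suc 0) = 0"
  by (simp_all add: theta_mat_def mat_of_rows_list_def)

lemma theta_family_simps [simp]:
  "frank (theta_family a U) = 2" "fbase (theta_family a U) i = U" "fxdom (theta_family a U) c = UNIV"
  "ftrans (theta_family a U) c c' z x = 1\<^sub>m 2" "fdbar (theta_family a U) c z x = 0\<^sub>m 2 2"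
  "fphi (theta_family a U) c z x = theta_mat (a x) z"
  by (simp_all add: theta_family_def theta_mat_def)

lemma restrict_theta_family: "W \<subseteq> U \<Longrightarrow> restrict_family (theta_family a U) W = theta_family a W"
  by (auto simp: restrict_family_def theta_family_def Int_absorb1)

section \<open>Polystability of the slices\<close>

definition const_bundle :: "nat \<Rightarrow> complex mat \<Rightarrow> higgs_bundle" where
  "const_bundle n M = \<lparr>hrank = n, hdom = (\<lambda>c. UNIV), htrans = (\<lambda>c c' x. 1\<^sub>m n),
     hdbar = (\<lambda>c x. 0\<^sub>m n n), hphi = (\<lambda>c x. M)\<rparr>"

lemma const_bundle_simps [simp]:
  "hrank (const_bundle n M) = n" "hdom (const_bundle n M) c = UNIV"
  "htrans (const_bundle n M) c c' x = 1\<^sub>m n" "hdbar (const_bundle n M) c x = 0\<^sub>m n n"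
  "hphi (const_bundle n M) c x = M"
  by (simp_all add: const_bundle_def)

lemma slice_theta_family: "z \<in> U \<Longrightarrow> slice (theta_family (\<lambda>x. \<alpha>) U) z = const_bundle 2 (theta_mat \<alpha> z)"
  by (simp add: slice_def const_bundle_def theta_family_def theta_mat_def)

lemma smooth_mat_const: "M \<in> carrier_mat m n \<Longrightarrow> smooth_mat L D m n (\<lambda>x. M)"
  by (simp add: smooth_mat_def periodic_on_def smooth_fun_const)

lemma mat_dx_const: "M \<in> carrier_mat m n \<Longrightarrow> mat_dx (\<lambda>x. M) x = 0\<^sub>m m n"
  "M \<in> carrier_mat m n \<Longrightarrow> mat_dxbar (\<lambda>x. M) x = 0\<^sub>m m n"
  by (auto simp: mat_dx_def mat_dxbar_def)

lemma is_higgs_bundle_const: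
  assumes "M \<in> carrier_mat n n"
  shows "is_higgs_bundle L (const_bundle n M)"
proof -
  have e: "htrans (const_bundle n M) c c' = (\<lambda>x. 1\<^sub>m n)" "hdbar (const_bundle n M) c = (\<lambda>x. 0\<^sub>m n n)"
    "hphi (const_bundle n M) c = (\<lambda>x. M)" for c c' by (simp_all add: const_bundle_def)
  have "is_vector_bundle L (const_bundle n M)"
    unfolding is_vector_bundle_def e by (simp add: invariant_open_def smooth_mat_const)
  then show ?thesis
    unfolding is_higgs_bundle_def e
    using assms smooth_mat_const mat_dx_const[OF one_carrier_mat] mat_dx_const[OF assms] by simp
qed

text \<open>The constant metric has the trivial connection as its Chern connection, with zero
  curvature, so the degree is zero.\<close>

lemma has_slope_const_line:
  assumes "is_lattice L" "M \<in> carrier_mat 1 1"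
  shows "has_slope L (const_bundle 1 M) 0"
proof -
  obtain w1 w2 where L: "lattice_basis L w1 w2" using assms(1) unfolding is_lattice_def by blast
  have e: "htrans (const_bundle 1 M) c c' = (\<lambda>x. 1\<^sub>m 1)" "hdbar (const_bundle 1 M) c = (\<lambda>x. 0\<^sub>m 1 1)"
    for c c' by (simp_all add: const_bundle_def)
  have adj: "mat_adjoint (1\<^sub>m 1) = (1\<^sub>m 1 :: complex mat)"
    using mat_adjoint_index[of "1\<^sub>m 1" 1 1] mat_adjoint_carrier[of "1\<^sub>m 1" 1 1]
    by (intro eq_matI) auto
  have pos: "0 < Re (v \<bullet>c v)" if v: "v \<in> carrier_vec 1" "v \<noteq> 0\<^sub>v 1" for v
  proof -
    have "vec_index v 0 \<noteq> 0" using v by (metis carrier_vecD eq_vecI index_zero_vec less_one)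
    then show ?thesis using v(1)
      by (simp add: scalar_prod_def complex_norm_square[symmetric] flip: of_real_power)
  qed
  have herm: "hermitian_metric L (const_bundle 1 M) (\<lambda>c x. 1\<^sub>m 1)"
    unfolding hermitian_metric_def e using smooth_mat_const[of "1\<^sub>m 1" 1 1] adj pos by simp
  have "mat_adjoint (0\<^sub>m 1 1 :: complex mat) \<in> carrier_mat 1 1" by (rule mat_adjoint_carrier) simp
  then have "mat_adjoint (0\<^sub>m 1 1) = (0\<^sub>m 1 1 :: complex mat)"
    using mat_adjoint_index[of "0\<^sub>m 1 1" 1 1] by (intro eq_matI) auto
  then have chern: "chern_10 (const_bundle 1 M) (\<lambda>c x. 1\<^sub>m 1) (\<lambda>c x. 0\<^sub>m 1 1)"
    unfolding chern_10_def e using mat_dx_const(1)[of "1\<^sub>m 1" 1 1] by simp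
  have "curvature (\<lambda>x. 0\<^sub>m 1 1) (\<lambda>x. 0\<^sub>m 1 1) x = 0\<^sub>m 1 1" for x
    unfolding curvature_def mat_dx_const[OF zero_carrier_mat] by (intro eq_matI) auto
  then have curv: "\<forall>c. \<forall>x\<in>hdom (const_bundle 1 M) c. (0 :: complex) =
      (\<Sum>i<hrank (const_bundle 1 M). curvature ((\<lambda>c x. 0\<^sub>m 1 1) c) (hdbar (const_bundle 1 M) c) x $$ (i, i))"
    unfolding e by simp
  have int: "((\<lambda>x. 0 :: complex) has_integral of_real (pi * 0))
          {of_real s * w1 + of_real t * w2 | s t. s \<in> {0..1} \<and> t \<in> {0..1}}" by simp
  have "has_degree L (const_bundle 1 M) 0"
    unfolding has_degree_def
    by (intro exI[of _ "\<lambda>c x. 1\<^sub>m 1"] exI[of _ "\<lambda>c x. 0\<^sub>m 1 1"] exI[of _ "\<lambda>x. 0"] exI[of _ w1] exI[of _ w2]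
        conjI herm chern curv L int)
  then show ?thesis unfolding has_slope_def by force
qed

text \<open>No rank lies strictly between 0 and 1, so a line bundle with a Higgs field is
  stable.\<close>

lemma polystable_const_line:
  assumes "is_lattice L" "M \<in> carrier_mat 1 1"
  shows "polystable_of_slope L 0 (const_bundle 1 M)"
proof (rule polystable_of_slope.stable)
  show "stable L (const_bundle 1 M)"
    using is_higgs_bundle_const[OF assms(2)] by (auto simp: stable_def)
qed (rule has_slope_const_line[OF assms])

definition column2 :: "complex \<Rightarrow> complex \<Rightarrow> complex mat" where
  "column2 v w = Matrix.mat 2 1 (\<lambda>(i, j). if i = 0 then v else w)"

lemma column2_carrier [simp]: "column2 v w \<in> carrier_mat 2 1"
  by (simp add: column2_def)

text \<open>A constant eigenvector embeds the trivial line with its eigenvalue as Higgs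
  field.\<close>

lemma higgs_hom_column:
  assumes M: "M \<in> carrier_mat 2 2"
    and "M $$ (0, 0) * v + M $$ (0, 1) * w = \<mu> * v" "M $$ (1, 0) * v + M $$ (1, 1) * w = \<mu> * w"
  shows "higgs_hom L (const_bundle 1 (\<mu> \<cdot>\<^sub>m 1\<^sub>m 1)) (const_bundle 2 M) (\<lambda>c b x. column2 v w)"
proof -
  have "M * column2 v w = column2 v w * (\<mu> \<cdot>\<^sub>m 1\<^sub>m 1)"
    using assms
    by (intro eq_matI) (auto simp: column2_def scalar_prod_def numeral_2_eq_2 less_Suc_eq mult.commute)
  moreover have "1\<^sub>m 2 * column2 v w * 1\<^sub>m 1 = column2 v w"
    unfolding left_mult_one_mat[OF column2_carrier] by (rule right_mult_one_mat[OF column2_carrier])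
  moreover have "0\<^sub>m 2 1 + 0\<^sub>m 2 2 * column2 v w = column2 v w * 0\<^sub>m 1 1"
    unfolding left_mult_zero_mat[OF column2_carrier] right_mult_zero_mat[OF column2_carrier]
    by (rule left_add_zero_mat) simp
  ultimately show ?thesis
    unfolding higgs_hom_def
    using smooth_mat_const[OF column2_carrier] mat_dx_const(2)[OF column2_carrier] by simp
qed

lemma polystable_const_diagonalizable:
  assumes L: "is_lattice L" and M: "M \<in> carrier_mat 2 2"
    and v: "M $$ (0, 0) * v1 + M $$ (0, 1) * v2 = \<mu> * v1" "M $$ (1, 0) * v1 + M $$ (1, 1) * v2 = \<mu> * v2"
    and w: "M $$ (0, 0) * w1 + M $$ (0, 1) * w2 = \<nu> * w1" "M $$ (1, 0) * w1 + M $$ (1, 1) * w2 = \<nu> * w2"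
    and indep: "v1 * w2 - v2 * w1 \<noteq> 0"
  shows "polystable L (const_bundle 2 M)"
proof -
  define B where "B = (\<lambda>(y, z). column2 v1 v2 *\<^sub>v y + column2 w1 w2 *\<^sub>v z)"
  \<comment> \<open>The inverse of \<open>B\<close> by Cramer's rule.\<close>
  define C where "C y = (Matrix.vec 1 (\<lambda>i. (vec_index y 0 * w2 - vec_index y 1 * w1) / (v1 * w2 - v2 * w1)),
    Matrix.vec 1 (\<lambda>i. (v1 * vec_index y 1 - v2 * vec_index y 0) / (v1 * w2 - v2 * w1)))" for y :: "complex Matrix.vec"
  have B0: "vec_index (B (y, z)) 0 = v1 * vec_index y 0 + w1 * vec_index z 0"
    and B1: "vec_index (B (y, z)) 1 = v2 * vec_index y 0 + w2 * vec_index z 0"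
    if "y \<in> carrier_vec 1" "z \<in> carrier_vec 1" for y z :: "complex Matrix.vec"
    using that by (auto simp: B_def column2_def scalar_prod_def)
  have Bc: "B (y, z) \<in> carrier_vec 2" if "y \<in> carrier_vec 1" "z \<in> carrier_vec 1" for y z :: "complex Matrix.vec"
    unfolding B_def using that
    by (auto intro!: add_carrier_vec mult_mat_vec_carrier[OF column2_carrier] simp del: One_nat_def)
  have "bij_betw B (carrier_vec 1 \<times> carrier_vec 1) (carrier_vec 2)"
  proof (rule bij_betwI[where g = C])
    show "B \<in> carrier_vec 1 \<times> carrier_vec 1 \<rightarrow> carrier_vec 2" using Bc by auto
    show "C \<in> carrier_vec 2 \<rightarrow> carrier_vec 1 \<times> carrier_vec 1" by (auto simp: C_def)
    fix p :: "complex Matrix.vec \<times> complex Matrix.vec" assume "p \<in> carrier_vec 1 \<times> carrier_vec 1"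
    then obtain y z where p: "p = (y, z)" "y \<in> carrier_vec 1" "z \<in> carrier_vec 1" by auto
    have "(v1 * vec_index y 0 + w1 * vec_index z 0) * w2 - (v2 * vec_index y 0 + w2 * vec_index z 0) * w1
        = vec_index y 0 * (v1 * w2 - v2 * w1)"
      "v1 * (v2 * vec_index y 0 + w2 * vec_index z 0) - v2 * (v1 * vec_index y 0 + w1 * vec_index z 0)
        = vec_index z 0 * (v1 * w2 - v2 * w1)" by (simp_all add: algebra_simps)
    then have "C (B p) = (Matrix.vec 1 (\<lambda>i. vec_index y 0), Matrix.vec 1 (\<lambda>i. vec_index z 0))"
      unfolding C_def p B0[OF p(2,3)] B1[OF p(2,3)] using indep by simp
    also have "\<dots> = p" unfolding p using p(2,3) by (auto intro!: eq_vecI)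
    finally show "C (B p) = p" .
  next
    fix y :: "complex Matrix.vec" assume y: "y \<in> carrier_vec 2"
    obtain a b where C: "C y = (a, b)" "a \<in> carrier_vec 1" "b \<in> carrier_vec 1"
      "vec_index a 0 = (vec_index y 0 * w2 - vec_index y 1 * w1) / (v1 * w2 - v2 * w1)"
      "vec_index b 0 = (v1 * vec_index y 1 - v2 * vec_index y 0) / (v1 * w2 - v2 * w1)"
      by (simp add: C_def)
    have "v1 * vec_index a 0 + w1 * vec_index b 0 = vec_index y 0"
      "v2 * vec_index a 0 + w2 * vec_index b 0 = vec_index y 1"
      unfolding C(4,5) using indep by (simp_all add: divide_simps) (simp_all add: algebra_simps)
    then have "vec_index (B (a, b)) 0 = vec_index y 0" "vec_index (B (a, b)) 1 = vec_index y 1"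
      using B0[OF C(2,3)] B1[OF C(2,3)] by simp_all
    then show "B (C y) = y"
      unfolding C(1) using y Bc[OF C(2,3)] by (intro eq_vecI) (auto simp: numeral_2_eq_2 less_Suc_eq)
  qed
  then have "higgs_direct_sum L (const_bundle 1 (\<mu> \<cdot>\<^sub>m 1\<^sub>m 1)) (const_bundle 1 (\<nu> \<cdot>\<^sub>m 1\<^sub>m 1)) (const_bundle 2 M)"
    unfolding higgs_direct_sum_def const_bundle_simps B_def
    using higgs_hom_column[OF M v] higgs_hom_column[OF M w] by blast
  then have "polystable_of_slope L 0 (const_bundle 2 M)"
    by (intro polystable_of_slope.sum[OF polystable_const_line[OF L] polystable_const_line[OF L]
          is_higgs_bundle_const[OF M]]) auto
  then show ?thesis unfolding polystable_def by blast
qed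

lemma polystable_theta:
  assumes "is_lattice L"
  shows "polystable L (const_bundle 2 (theta_mat \<alpha> z))"
proof (cases "z = 0")
  case True
  \<comment> \<open>The vectors \<open>(1, s)\<close> and \<open>(1, -s)\<close> coincide at
    \<open>z = 0\<close>, but the Higgs field is zero there and the standard basis serves, with both
    eigenvalues \<open>0\<close>.\<close>
  show ?thesis
    by (rule polystable_const_diagonalizable[OF assms, of _ 1 0 0 0 1 0]) (simp_all add: True)
next
  case False
  define s where "s = csqrt z"
  have z: "z = s * s" by (simp add: s_def flip: power2_eq_square)
  have "s \<noteq> 0" using False z by auto
  then show ?thesis
    by (intro polystable_const_diagonalizable[OF assms, of _ 1 s "\<alpha> * z * s" 1 "-s" "- (\<alpha> * z * s)"])
      (simp_all add: z power2_eq_square)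
qed

text \<open>Since \<open>\<alpha>\<close> is a constant coefficient, regularity reduces to that of
  constants and of the two nonzero entries.\<close>

lemma is_higgs_family_theta:
  assumes "open U" and R: "\<And>c. R U UNIV (\<lambda>u x. c)" "R U UNIV (\<lambda>u x. \<alpha> * u)" "R U UNIV (\<lambda>u x. \<alpha> * u\<^sup>2)"
  shows "is_higgs_family L R U (theta_family (\<lambda>x. \<alpha>) U)"
proof -
  have e: "ftrans (theta_family (\<lambda>x. \<alpha>) U) c c' = (\<lambda>u x. 1\<^sub>m 2)" "fdbar (theta_family (\<lambda>x. \<alpha>) U) c = (\<lambda>u x. 0\<^sub>m 2 2)"
    "fphi (theta_family (\<lambda>x. \<alpha>) U) c = (\<lambda>u x. theta_mat \<alpha> u)" for c c'
    by (rule ext, rule ext, simp)+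
  have const: "regular_mat R U UNIV 2 2 (\<lambda>u x. M)" if "M \<in> carrier_mat 2 2" for M
    using that R(1) by (simp add: regular_mat_def)
  have "regular_mat R U UNIV 2 2 (\<lambda>u x. theta_mat \<alpha> u)"
    unfolding regular_mat_def
  proof (intro conjI ballI allI impI)
    fix i j :: nat assume "i < 2" "j < 2"
    then show "R U UNIV (\<lambda>u x. theta_mat \<alpha> u $$ (i, j))"
      using R less_2_cases[of i] less_2_cases[of j] by auto
  qed simp
  then show ?thesis
    unfolding is_higgs_family_def e
    using assms(1) const is_higgs_bundle_const[OF theta_mat_carrier] by (simp add: slice_theta_family)
qed

lemma theta_frame_theta: "theta_frame L \<alpha> (theta_family (\<lambda>x. \<alpha>) U) (\<lambda>c u x. m2 (1\<^sub>m 2))"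
proof -
  have "m2 (theta_mat \<alpha> u) = Theta \<alpha> u" for u by (simp add: cmat_eq_iff Theta_def)
  then show ?thesis
    unfolding theta_frame_def
    by (simp add: periodic_on_def msmooth_const mdet_def m2_one m2_one_right mmult_distrib case_prod_beta)
qed

section \<open>Real-analytic dependence on the parameter\<close>

lemma smooth_tendsto_eventually:
  assumes "\<forall>\<^sub>F t in F. f t = l"
  shows "smooth_tendsto D f l F"
  unfolding smooth_tendsto_def uniform_limit_iff
proof (intro allI impI)
  fix vs K and e :: real assume "0 < e"
  show "\<forall>\<^sub>F n in F. \<forall>x\<in>K. dist (iter_dird vs (f n) x) (iter_dird vs l x) < e"
    using assms by eventually_elim (simp add: \<open>0 < e\<close>)
qed

text \<open>For a finite expansion the net of partial sums is constant as soon as the index set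
  contains the support \<open>N\<close>, so it converges whatever the radius.\<close>

lemma analytic_smooth_polynomial:
  assumes "\<And>u0. \<exists>c N. finite N \<and> (\<forall>u. (\<Sum>(m, n)\<in>N. c m n * of_real (Re (u - u0) ^ m * Im (u - u0) ^ n)) = P u)
    \<and> (\<forall>m n. (m, n) \<notin> N \<longrightarrow> c m n = 0)"
  shows "analytic_smooth B D (\<lambda>u x. P u)"
  unfolding analytic_smooth_def
proof (intro conjI ballI)
  fix u0
  obtain c N where N: "finite N" "\<And>u. (\<Sum>(m, n)\<in>N. c m n * of_real (Re (u - u0) ^ m * Im (u - u0) ^ n)) = P u"
    "\<And>m n. (m, n) \<notin> N \<Longrightarrow> c m n = 0" using assms by meson
  have "smooth_tendsto D (\<lambda>F x. \<Sum>(m, n)\<in>F. c m n * of_real (Re (u - u0) ^ m * Im (u - u0) ^ n))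
      (\<lambda>x. P u) (finite_subsets_at_top UNIV)" for u
  proof (rule smooth_tendsto_eventually)
    show "\<forall>\<^sub>F F in finite_subsets_at_top UNIV.
        (\<lambda>x. \<Sum>(m, n)\<in>F. c m n * of_real (Re (u - u0) ^ m * Im (u - u0) ^ n)) = (\<lambda>x :: complex. P u)"
      unfolding eventually_finite_subsets_at_top
    proof (intro exI[of _ N] conjI allI impI ext)
      fix F and x :: complex assume F: "finite F \<and> N \<subseteq> F \<and> F \<subseteq> UNIV"
      have "(\<Sum>(m, n)\<in>N. c m n * of_real (Re (u - u0) ^ m * Im (u - u0) ^ n))
          = (\<Sum>(m, n)\<in>F. c m n * of_real (Re (u - u0) ^ m * Im (u - u0) ^ n))"
        by (rule sum.mono_neutral_left) (use F N(3) in auto)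
      then show "(\<Sum>(m, n)\<in>F. c m n * of_real (Re (u - u0) ^ m * Im (u - u0) ^ n)) = P u"
        unfolding N(2) by simp
    qed (use N in auto)
  qed
  then show "\<exists>c \<rho>. \<rho> > 0 \<and> (\<forall>m n. smooth_fun D (c m n)) \<and> (\<forall>u \<in> B \<inter> ball u0 \<rho>. smooth_tendsto D
      (\<lambda>F x. \<Sum>(m, n)\<in>F. c m n x * of_real (Re (u - u0) ^ m * Im (u - u0) ^ n)) (\<lambda>x. P u)
      (finite_subsets_at_top (UNIV :: (nat \<times> nat) set)))"
    by (intro exI[of _ "\<lambda>m n x. c m n"] exI[of _ 1]) (auto simp: smooth_fun_const)
qed (rule smooth_fun_const)

lemma analytic_smooth_quadratic: "analytic_smooth B D (\<lambda>u x. k0 + k1 * u + k2 * u\<^sup>2)"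
proof (rule analytic_smooth_polynomial)
  fix u0
  \<comment> \<open>Taylor coefficients at \<open>u0\<close>: \<open>l0\<close> is the value and
    \<open>l1\<close> the complex derivative. With \<open>u - u0 = x + \<i> y\<close>, expanding
    \<open>k2 (x + \<i> y)\<^sup>2\<close> gives the coefficients \<open>k2\<close>,
    \<open>2 \<i> k2\<close> and \<open>- k2\<close> of degree two.\<close>
  define l0 where "l0 = k0 + k1 * u0 + k2 * u0\<^sup>2"
  define l1 where "l1 = k1 + 2 * k2 * u0"
  define c :: "nat \<Rightarrow> nat \<Rightarrow> complex" where "c m n =
    (if (m, n) = (0, 0) then l0 else if (m, n) = (1, 0) then l1 else if (m, n) = (0, 1) then \<i> * l1
     else if (m, n) = (2, 0) then k2 else if (m, n) = (1, 1) then 2 * \<i> * k2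
     else if (m, n) = (0, 2) then - k2 else 0)" for m n
  define N :: "(nat \<times> nat) set" where "N = {(0, 0), (1, 0), (0, 1), (2, 0), (1, 1), (0, 2)}"
  have "(\<Sum>(m, n)\<in>N. c m n * of_real (Re (u - u0) ^ m * Im (u - u0) ^ n)) = k0 + k1 * u + k2 * u\<^sup>2" for u
  proof -
    define x where "x = complex_of_real (Re (u - u0))"
    define y where "y = complex_of_real (Im (u - u0))"
    have u: "u = u0 + (x + \<i> * y)" using complex_eq[of "u - u0"] by (simp add: x_def y_def algebra_simps)
    have "(\<Sum>(m, n)\<in>N. c m n * of_real (Re (u - u0) ^ m * Im (u - u0) ^ n))
        = l0 + l1 * x + \<i> * l1 * y + k2 * x\<^sup>2 + 2 * \<i> * k2 * (x * y) - k2 * y\<^sup>2"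
      unfolding N_def by (simp add: c_def x_def y_def)
    also have "\<dots> = k0 + k1 * u + k2 * u\<^sup>2"
      unfolding u l0_def l1_def by (simp add: power2_eq_square algebra_simps)
    finally show ?thesis .
  qed
  moreover have "finite N" "\<forall>m n. (m, n) \<notin> N \<longrightarrow> c m n = 0" by (auto simp: N_def c_def)
  ultimately show "\<exists>c N. finite N \<and>
      (\<forall>u. (\<Sum>(m, n)\<in>N. c m n * of_real (Re (u - u0) ^ m * Im (u - u0) ^ n)) = k0 + k1 * u + k2 * u\<^sup>2)
      \<and> (\<forall>m n. (m, n) \<notin> N \<longrightarrow> c m n = 0)" by blast
qed

theorem proposition14p3:
  fixes L :: "complex set" and a :: "complex \<Rightarrow> complex" and r :: real
  assumes "is_lattice L"
    and "a holomorphic_on UNIV" and "periodic_on L UNIV a" and "\<forall>x. a x \<noteq> 0"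
    and "r > 0"
  shows "is_higgs_family L analytic_smooth (ball 0 r) (theta_family a (ball 0 r)) \<and>
    (\<forall>z \<in> ball 0 r. polystable L (slice (theta_family a (ball 0 r)) z)) \<and>
    (\<forall>W. open W \<and> 0 \<in> W \<and> W \<subseteq> ball 0 r \<longrightarrow>
       \<not> admits_harmonic_metric L (Cd_smooth 0) W (restrict_family (theta_family a (ball 0 r)) W) \<and>
       \<not> admits_harmonic_filtration L (Cd_smooth 0) W (restrict_family (theta_family a (ball 0 r)) W) \<and>
       (\<forall>d :: enat. \<not> stack_Dol L d W (restrict_family (theta_family a (ball 0 r)) W)))"
proof -
  obtain \<alpha> where a: "a = (\<lambda>x. \<alpha>)" using entire_periodic_constant[OF assms(1-3)] by blast
  have \<alpha>: "\<alpha> \<noteq> 0" using assms(4) by (simp add: a)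
  have fam: "is_higgs_family L analytic_smooth U (theta_family a U)" if "open U" for U
    unfolding a
    by (rule is_higgs_family_theta[OF that])
      (use analytic_smooth_quadratic[of U UNIV _ 0 0] analytic_smooth_quadratic[of U UNIV 0 \<alpha> 0]
        analytic_smooth_quadratic[of U UNIV 0 0 \<alpha>] in simp_all)
  have fr: "theta_frame L \<alpha> (theta_family a U) (\<lambda>c u x. m2 (1\<^sub>m 2))" for U
    unfolding a by (rule theta_frame_theta)
  show ?thesis
  proof (intro conjI allI ballI impI)
    show "is_higgs_family L analytic_smooth (ball 0 r) (theta_family a (ball 0 r))" by (rule fam) simp
    show "polystable L (slice (theta_family a (ball 0 r)) z)" if "z \<in> ball 0 r" for z
      unfolding a slice_theta_family[OF that] by (rule polystable_theta[OF assms(1)])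
    fix W :: "complex set" assume "open W \<and> 0 \<in> W \<and> W \<subseteq> ball 0 r"
    then have W: "open W" "0 \<in> W" "W \<subseteq> ball 0 r" by auto
    show "\<not> admits_harmonic_metric L (Cd_smooth 0) W (restrict_family (theta_family a (ball 0 r)) W)"
      unfolding restrict_theta_family[OF W(3)]
      by (rule no_continuous_harmonic_metric[OF fam[OF W(1)] fr W(2) \<alpha> assms(1)])
    show "\<not> admits_harmonic_filtration L (Cd_smooth 0) W (restrict_family (theta_family a (ball 0 r)) W)"
      unfolding restrict_theta_family[OF W(3)]
      by (rule no_harmonic_filtration[OF fam[OF W(1)] fr W(2) \<alpha> assms(1)])
    show "\<not> stack_Dol L d W (restrict_family (theta_family a (ball 0 r)) W)" for d
    proof
      assume "stack_Dol L d W (restrict_family (theta_family a (ball 0 r)) W)"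
      \<comment> \<open>Only the local description around the parameter \<open>0\<close> is used:
        the prestack object \<open>G'\<close> over \<open>W'\<close> is isomorphic to the model over
        \<open>W'\<close>, hence has a frame.\<close>
      then obtain W' G' where W': "open W'" "0 \<in> W'" "W' \<subseteq> W" "prestack_Dol L d W' G'"
        "family_iso L (Cd_smooth d) W' (theta_family a W') G'"
        unfolding stack_Dol_def restrict_theta_family[OF W(3)] using W(2) restrict_theta_family by metis
      obtain g where g: "family_hom L (Cd_smooth d) W' (theta_family a W') G' g"
        and bij: "\<And>u. u \<in> W' \<Longrightarrow> fibrewise_inj (slice (theta_family a W') u) (slice G' u) (map_slice g u)"
          "\<And>u. u \<in> W' \<Longrightarrow> fibrewise_surj (slice (theta_family a W') u) (slice G' u) (map_slice g u)"
        using W'(5) unfolding family_iso_def by blast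
      obtain f where "theta_frame L \<alpha> G' f"
        using theta_frame_push[OF fam[OF W'(1)] prestack_family[OF W'(4)] g W'(2) fr bij] by blast
      then show False using prestack_no_theta_frame[OF W'(4,2) \<alpha> assms(1)] by blast
    qed
  qed
qed

end
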